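(* Let $n\ge 1$, let $\Omega\subset\mathbb{R}^n$ be a bounded Lipschitz domain satisfying the exterior ball condition, let $\frac12<s<1$ and let $f\in C^\beta(\Omega)$ for some $\beta>0$. Let $u\in\mathbb{V}$ be the weak solution of $(-\Delta)^s u=f$ in $\Omega$, $u=0$ in $\Omega^c$. Then, for all $\varepsilon>0$, $u$ belongs to $H^{s+\frac12-\varepsilon}(\mathbb{R}^n)$ and $$|u|_{H^{s+\frac12-\varepsilon}(\mathbb{R}^n)}\le\frac{C(\Omega,s,n,\beta)}{\sqrt{\varepsilon}\,(2s-1)}\,\|f\|_{C^\beta(\Omega)},$$ where $C(\Omega,s,n,\beta)$ is a constant depending on $\Omega$, $s$, $n$ and $\beta$.
   Context: For $t\in(0,1)$ and $G\subset\mathbb{R}^n$ open, $|v|_{H^t(G)}^2=\iint_{G\times G}\frac{|v(x)-v(y)|^2}{|x-y|^{n+2t}}\,dx\,dy$ and $H^t(G)=\{v\in L^2(G):|v|_{H^t(G)}<\infty\}$. $H^1(G)$ is the usual Sobolev space, with $|v|_{H^1(G)}=\|Dv\|_{L^2(G)}$. For order $1+t$ with $t\in(0,1)$: $|v|_{H^{1+t}(G)}=\sum_{|\alpha|=1}|D^\alpha v|_{H^t(G)}$ and $H^{1+t}(G)=\{v\in H^1(G):|v|_{H^{1+t}(G)}<\infty\}$. $\Omega^c=\mathbb{R}^n\setminus\Omega$ and $\mathbb{V}=\{v\in H^s(\mathbb{R}^n): v=0 \text{ in }\Omega^c\}$. The operator is the integral fractional Laplacian $(-\Delta)^su(x)=C(n,s)\,\mathrm{P.V.}\int_{\mathbb{R}^n}\frac{u(x)-u(y)}{|x-y|^{n+2s}}\,dy$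 with $C(n,s)=\frac{2^{2s}s\,\Gamma(s+\frac n2)}{\pi^{n/2}\Gamma(1-s)}$. With $Q=(\Omega\times\mathbb{R}^n)\cup(\mathbb{R}^n\times\Omega)$, the weak solution is the unique $u\in\mathbb{V}$ with $$\frac{C(n,s)}{2}\iint_Q\frac{(u(x)-u(y))(v(x)-v(y))}{|x-y|^{n+2s}}\,dx\,dy=\int_\Omega f v\,dx\quad\forall v\in\mathbb{V}.$$ Exterior ball condition: there is $\rho>0$ such that every point of $\partial\Omega$ lies on the boundary of a ball of radius $\rho$ contained in $\mathbb{R}^n\setminus\overline\Omega$. $\|\cdot\|_{C^{\beta}(\Omega)}$ is the usual full Hölder norm on $\Omega$.
   Formalization: One constant for all ε fails: the unnormalised seminorms blow up as the order s+1/2−ε tends to 0 or 1. The bound is for orders ≥ δ that equal 1 or differ from 1 by ≥ δ, with C depending also on δ > 0; membership is for all 0 < ε < s+1/2, where the space is defined. *)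

theory Defs
  imports "HOL-Analysis.Analysis"
begin

section \<open>Iterated partial derivatives and test functions\<close>

text \<open>A multi-index \<open>\<alpha>\<close> is encoded by any list of basis vectors in which the
  \<open>i\<close>-th one occurs \<open>\<alpha>\<^sub>i\<close> times; its order is the length of the list.\<close>

primrec pderivs :: "'a::euclidean_space list \<Rightarrow> ('a \<Rightarrow> real) \<Rightarrow> 'a \<Rightarrow> real" where
  "pderivs [] f = f"
| "pderivs (b # bs) f = (\<lambda>x. frechet_derivative (pderivs bs f) (at x) b)"

definition multi_indices :: "nat \<Rightarrow> 'a::euclidean_space list set" where
  "multi_indices k = {bs. set bs \<subseteq> Basis \<and> length bs = k}"

definition smooth :: "('a::euclidean_space \<Rightarrow> real) \<Rightarrow> bool" where
  "smooth \<phi> \<longleftrightarrow> (\<forall>k. \<forall>bs\<in>multi_indices k. pderivs bs \<phi> differentiable_on UNIV)"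

definition test_functions :: "'a::euclidean_space set \<Rightarrow> ('a \<Rightarrow> real) set" where
  "test_functions G =
     {\<phi>. smooth \<phi> \<and> (\<exists>K. compact K \<and> K \<subseteq> G \<and> (\<forall>x. x \<notin> K \<longrightarrow> \<phi> x = 0))}"


section \<open>Hoelder spaces\<close>

text \<open>We write \<open>\<beta> = k + \<beta>'\<close> with \<open>k\<close> a natural number and \<open>0 < \<beta>' \<le> 1\<close>, so that
  \<open>C\<^sup>\<beta>\<close> is \<open>C\<^sup>k\<^sup>,\<^sup>\<beta>\<^sup>'\<close>; for integer \<open>\<beta>\<close> this is \<open>C\<^sup>\<beta>\<^sup>-\<^sup>1\<^sup>,\<^sup>1\<close>.\<close>

definition hoelder_order :: "real \<Rightarrow> nat" where
  "hoelder_order \<beta> = nat (\<lceil>\<beta>\<rceil> - 1)"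

definition hoelder_exponent :: "real \<Rightarrow> real" where
  "hoelder_exponent \<beta> = \<beta> - real (hoelder_order \<beta>)"

definition sup_values :: "nat \<Rightarrow> 'a::euclidean_space set \<Rightarrow> ('a \<Rightarrow> real) \<Rightarrow> real set" where
  "sup_values j S f = {\<bar>pderivs bs f x\<bar> | bs x. bs \<in> multi_indices j \<and> x \<in> S}"

definition hoelder_quotients ::
    "nat \<Rightarrow> real \<Rightarrow> 'a::euclidean_space set \<Rightarrow> ('a \<Rightarrow> real) \<Rightarrow> real set" where
  "hoelder_quotients k \<gamma> S f =
     {\<bar>pderivs bs f x - pderivs bs f y\<bar> / norm (x - y) powr \<gamma> | bs x y.
        bs \<in> multi_indices k \<and> x \<in> S \<and> y \<in> S \<and> x \<noteq> y}"

text \<open>Continuity of the derivatives of top order follows from the bound on the Hoelder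
  quotients, so it is not required separately. The set \<open>S\<close> is meant to be open.\<close>

definition hoelder_space :: "real \<Rightarrow> 'a::euclidean_space set \<Rightarrow> ('a \<Rightarrow> real) set" where
  "hoelder_space \<beta> S = {f.
     (\<forall>j < hoelder_order \<beta>. \<forall>bs\<in>multi_indices j. pderivs bs f differentiable_on S) \<and>
     (\<forall>j \<le> hoelder_order \<beta>. bdd_above (sup_values j S f)) \<and>
     bdd_above (hoelder_quotients (hoelder_order \<beta>) (hoelder_exponent \<beta>) S f)}"

definition hoelder_norm :: "real \<Rightarrow> 'a::euclidean_space set \<Rightarrow> ('a \<Rightarrow> real) \<Rightarrow> real" where
  "hoelder_norm \<beta> S f =
     (\<Sum>j\<le>hoelder_order \<beta>. Sup (sup_values j S f)) +
     Sup (hoelder_quotients (hoelder_order \<beta>) (hoelder_exponent \<beta>) S f)"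


section \<open>Sobolev spaces of order between 0 and 2\<close>

text \<open>Elements of function spaces are represented by functions rather than by classes
  modulo null sets; the spaces and seminorms of this section do not see null sets.\<close>

definition L2_space :: "'a::euclidean_space set \<Rightarrow> ('a \<Rightarrow> real) set" where
  "L2_space G = {v. v \<in> borel_measurable (lebesgue_on G) \<and>
                    integrable (lebesgue_on G) (\<lambda>x. (v x)\<^sup>2)}"

definition gagliardo :: "real \<Rightarrow> 'a::euclidean_space set \<Rightarrow> ('a \<Rightarrow> real) \<Rightarrow> ennreal" where
  "gagliardo t G v =
     (\<integral>\<^sup>+ (x, y). ennreal ((v x - v y)\<^sup>2 / norm (x - y) powr (real DIM('a) + 2 * t))
        \<partial>(lebesgue_on G \<Otimes>\<^sub>M lebesgue_on G))"

text \<open>To be used for \<open>v\<close> and \<open>g\<close> in \<open>L\<^sup>2(G)\<close>, where all the integrals exist.\<close>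

definition is_weak_pderiv ::
    "'a::euclidean_space set \<Rightarrow> 'a \<Rightarrow> ('a \<Rightarrow> real) \<Rightarrow> ('a \<Rightarrow> real) \<Rightarrow> bool" where
  "is_weak_pderiv G b v g \<longleftrightarrow> (\<forall>\<phi>\<in>test_functions G.
     (\<integral>x. v x * pderivs [b] \<phi> x \<partial>lebesgue_on G) = - (\<integral>x. g x * \<phi> x \<partial>lebesgue_on G))"

definition weak_pderiv ::
    "'a::euclidean_space set \<Rightarrow> 'a \<Rightarrow> ('a \<Rightarrow> real) \<Rightarrow> 'a \<Rightarrow> real" where
  "weak_pderiv G b v = (SOME g. g \<in> L2_space G \<and> is_weak_pderiv G b v g)"

definition H1_space :: "'a::euclidean_space set \<Rightarrow> ('a \<Rightarrow> real) set" where
  "H1_space G = {v \<in> L2_space G. \<forall>b\<in>Basis. \<exists>g\<in>L2_space G. is_weak_pderiv G b v g}"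

text \<open>The order \<open>\<sigma>\<close> is meant to satisfy \<open>0 < \<sigma> < 2\<close>.\<close>

definition sobolev_space :: "real \<Rightarrow> 'a::euclidean_space set \<Rightarrow> ('a \<Rightarrow> real) set" where
  "sobolev_space \<sigma> G =
     (if \<sigma> < 1 then {v \<in> L2_space G. gagliardo \<sigma> G v < \<infinity>}
      else if \<sigma> = 1 then H1_space G
      else {v \<in> H1_space G. \<forall>b\<in>Basis. gagliardo (\<sigma> - 1) G (weak_pderiv G b v) < \<infinity>})"

definition sobolev_seminorm :: "real \<Rightarrow> 'a::euclidean_space set \<Rightarrow> ('a \<Rightarrow> real) \<Rightarrow> real" where
  "sobolev_seminorm \<sigma> G v =
     (if \<sigma> < 1 then sqrt (enn2real (gagliardo \<sigma> G v))
      else if \<sigma> = 1 then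
        sqrt (\<integral>x. (\<Sum>b\<in>Basis. (weak_pderiv G b v x)\<^sup>2) \<partial>lebesgue_on G)
      else (\<Sum>b\<in>Basis. sqrt (enn2real (gagliardo (\<sigma> - 1) G (weak_pderiv G b v)))))"

text \<open>The seminorms above carry no normalising factor. On the whole space and for a fixed
  smooth \<open>v \<noteq> 0\<close> with compact support they tend to infinity as \<open>\<sigma>\<close> tends to \<open>0\<close> from
  above, or to \<open>1\<close> from either side, although they are finite at \<open>\<sigma> = 1\<close>. An upper
  bound that is uniform in the order therefore has to keep away from these limits.\<close>

definition order_separated :: "real \<Rightarrow> real \<Rightarrow> bool" where
  "order_separated \<delta> \<sigma> \<longleftrightarrow> \<delta> \<le> \<sigma> \<and> (\<sigma> = 1 \<or> \<delta> \<le> \<bar>\<sigma> - 1\<bar>)"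


section \<open>Domains\<close>

text \<open>Near each boundary point the domain is the strict epigraph, in some direction \<open>e\<close>,
  of a Lipschitz function defined on the hyperplane orthogonal to \<open>e\<close>.\<close>

definition lipschitz_domain :: "'a::euclidean_space set \<Rightarrow> bool" where
  "lipschitz_domain \<Omega> \<longleftrightarrow> open \<Omega> \<and> connected \<Omega> \<and> \<Omega> \<noteq> {} \<and>
     (\<forall>p\<in>frontier \<Omega>. \<exists>r>0. \<exists>e L \<phi>. norm e = 1 \<and> L-lipschitz_on {z. z \<bullet> e = 0} \<phi> \<and>
        (\<forall>x\<in>ball p r. x \<in> \<Omega> \<longleftrightarrow> \<phi> (x - (x \<bullet> e) *\<^sub>R e) < x \<bullet> e))"

definition exterior_ball_condition :: "'a::euclidean_space set \<Rightarrow> bool" where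
  "exterior_ball_condition \<Omega> \<longleftrightarrow>
     (\<exists>\<rho>>0. \<forall>p\<in>frontier \<Omega>. \<exists>c. p \<in> frontier (ball c \<rho>) \<and> ball c \<rho> \<subseteq> - closure \<Omega>)"


section \<open>The Dirichlet problem for the integral fractional Laplacian\<close>

definition frac_laplace_const :: "nat \<Rightarrow> real \<Rightarrow> real" where
  "frac_laplace_const n s =
     2 powr (2 * s) * s * Gamma (s + real n / 2) / (pi powr (real n / 2) * Gamma (1 - s))"

definition energy_space :: "real \<Rightarrow> 'a::euclidean_space set \<Rightarrow> ('a \<Rightarrow> real) set" where
  "energy_space s \<Omega> = {v \<in> sobolev_space s UNIV. AE x in lebesgue. x \<notin> \<Omega> \<longrightarrow> v x = 0}"

definition energy_form ::
    "real \<Rightarrow> 'a::euclidean_space set \<Rightarrow> ('a \<Rightarrow> real) \<Rightarrow> ('a \<Rightarrow> real) \<Rightarrow> real" where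
  "energy_form s \<Omega> u v = frac_laplace_const DIM('a) s / 2 *
     set_lebesgue_integral (lebesgue \<Otimes>\<^sub>M lebesgue) (\<Omega> \<times> UNIV \<union> UNIV \<times> \<Omega>)
       (\<lambda>(x, y). (u x - u y) * (v x - v y) / norm (x - y) powr (real DIM('a) + 2 * s))"

definition weak_solution ::
    "real \<Rightarrow> 'a::euclidean_space set \<Rightarrow> ('a \<Rightarrow> real) \<Rightarrow> ('a \<Rightarrow> real) \<Rightarrow> bool" where
  "weak_solution s \<Omega> f u \<longleftrightarrow> u \<in> energy_space s \<Omega> \<and>
     (\<forall>v\<in>energy_space s \<Omega>. energy_form s \<Omega> u v = (\<integral>x. f x * v x \<partial>lebesgue_on \<Omega>))"

end

theory Submission
  imports Defs
begin

text \<open>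
  The proof is variational, and \<open>f\<close> enters through \<open>sup \<bar>f\<bar>\<close>. It is Savare's difference quotient method for problems on Lipschitz domains, in the form of inner
  variations. Write \<open>B\<close> for the Gagliardo form of order \<open>s\<close>.

  Let \<open>\<Phi> x = x + c x *\<^sub>R h\<close> with a cutoff \<open>c\<close> near a boundary point and with \<open>h\<close> in a
  cone of directions pointing out of \<open>\<Omega>\<close>. Then \<open>\<Phi>\<close> maps the complement of \<open>\<Omega>\<close> into
  itself, so \<open>u \<circ> \<Phi>\<close> is an admissible test function, and since \<open>\<Phi>\<close> is bi-Lipschitz with
  constant \<open>1 + O(norm h)\<close>, its energy exceeds \<open>B(u, u)\<close> by at most \<open>O(norm h) * B(u, u)\<close>.
  Expanding the square and testing the equation with \<open>w = u \<circ> \<Phi> - u\<close> gives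
  \<open>B(w, w) \<le> O(norm h) * B(u, u) + C * sup \<bar>f\<bar> * (\<integral> \<bar>w\<bar>)\<close>
  (\<open>comp_near_identity_energy\<close>). Suppose the \<open>L\<^sup>2\<close> modulus of continuity of \<open>u\<close> under
  translations is of order \<open>t \<le> 1\<close>. Then \<open>B(w, w)\<close> is of order \<open>norm h powr t\<close>, and the
  embedding of the energy space bounds second differences of \<open>u\<close> with increments \<open>h\<close> and
  \<open>k\<close> by \<open>norm k powr s * norm h powr (t / 2)\<close> (\<open>second_difference_bound\<close>): vectors in the cone
  span all directions, and finitely many boundary and interior points suffice by compactness.

  The Marchaud inequality turns this into the translation modulus \<open>s + t / 2\<close> as long as this is
  less than one, and into order one as soon as it exceeds one (\<open>bootstrap_step\<close>). Because
  \<open>s > 1 / 2\<close>, finitely many steps from \<open>t = s\<close> reach \<open>t = 1\<close>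
  (\<open>translate_bound_one\<close>). With \<open>t = 1\<close> second differences are bounded by
  \<open>norm k powr s * norm h powr (1 / 2)\<close>, that is, \<open>u\<close> lies in the Besov space of order
  \<open>s + 1 / 2\<close> with indices \<open>2\<close> and \<open>\<infinity>\<close>.

  Since \<open>s + 1 / 2 > 1\<close>, the dyadic difference quotients converge in \<open>L\<^sup>2\<close> to weak derivatives
  whose translation modulus is of order \<open>s - 1 / 2\<close> (\<open>weak_derivative_estimates\<close>). Integrating
  \<open>norm h powr (2 * s - 1)\<close> against the Gagliardo kernel of order \<open>s - 1 / 2 - \<epsilon>\<close> gives
  \<open>\<integral> norm h powr (2 * \<epsilon> - n)\<close> over a ball, which is of size \<open>1 / \<epsilon>\<close>; the square root is the
  factor of the theorem (\<open>gag_le_of_translates\<close>, \<open>sobolev_regularity\<close>).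

  Weak derivatives are chosen arbitrarily among all possible ones, so their uniqueness is needed. It
  rests on smooth bump functions that increase to indicators of boxes (\<open>weak_pderiv_unique\<close>).
\<close>

section \<open>Change of variables for expanding maps\<close>

lemma emeasure_lborel_ball_eq_content:
  "emeasure lborel (ball c r) = ennreal (measure lborel (ball (c :: 'a::euclidean_space) r))"
  using emeasure_lborel_ball_finite[of c r] by (intro emeasure_eq_ennreal_measure) auto

text \<open>The preimage has radius at most \<open>L * r\<close> around a preimage of the centre; this is where
  surjectivity enters, since a set of diameter \<open>2 * L * r\<close> need not lie in a ball of radius
  \<open>L * r\<close>.\<close>

lemma expanding_vimage_ball:
  fixes \<Phi> :: "'a::euclidean_space \<Rightarrow> 'a"
  assumes cont: "continuous_on UNIV \<Phi>" and surj: "surj \<Phi>" and L: "1 \<le> L"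
    and exp: "\<And>x y. norm (x - y) \<le> L * norm (\<Phi> x - \<Phi> y)" and r: "0 < r"
  shows "emeasure lborel (\<Phi> -` ball c r) \<le> ennreal (L ^ DIM('a)) * emeasure lborel (ball c r)"
proof -
  obtain a where a: "\<Phi> a = c" using surj by (metis surjD)
  have "\<Phi> -` ball c r \<subseteq> ball a (L * r)"
  proof
    fix x assume "x \<in> \<Phi> -` ball c r"
    then have "norm (\<Phi> a - \<Phi> x) < r" by (simp add: a dist_norm)
    then have "L * norm (\<Phi> a - \<Phi> x) < L * r" using L by simp
    with exp[of a x] show "x \<in> ball a (L * r)" by (simp add: dist_norm)
  qed
  then have "emeasure lborel (\<Phi> -` ball c r) \<le> emeasure lborel (ball a (L * r))"
    by (intro emeasure_mono) auto
  also have "\<dots> = ennreal (measure lborel (ball a (L * r)))"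
    by (rule emeasure_lborel_ball_eq_content)
  also have "measure lborel (ball a (L * r)) = L ^ DIM('a) * measure lborel (ball c r)"
    using L r content_ball_conv_unit_ball[of "L * r" a] content_ball_conv_unit_ball[of r c]
    by (simp add: power_mult_distrib)
  also have "ennreal \<dots> = ennreal (L ^ DIM('a)) * emeasure lborel (ball c r)"
    using L by (subst ennreal_mult) (auto simp: emeasure_lborel_ball_eq_content)
  finally show ?thesis .
qed

lemma expanding_vimage_negligible:
  fixes \<Phi> :: "'a::euclidean_space \<Rightarrow> 'a"
  assumes exp: "\<And>x y. norm (x - y) \<le> L * norm (\<Phi> x - \<Phi> y)" and N: "negligible N"
  shows "negligible (\<Phi> -` N)"
proof -
  have inj: "inj \<Phi>"
  proof (rule injI)
    fix x y assume "\<Phi> x = \<Phi> y"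
    with exp[of x y] show "x = y" by simp
  qed
  have "negligible (inv \<Phi> ` (N \<inter> range \<Phi>))"
  proof (rule negligible_locally_Lipschitz_image)
    show "negligible (N \<inter> range \<Phi>)" using N by (rule negligible_subset) auto
    fix x assume x: "x \<in> N \<inter> range \<Phi>"
    have "norm (inv \<Phi> y - inv \<Phi> x) \<le> L * norm (y - x)" if "y \<in> N \<inter> range \<Phi>" for y
      using exp[of "inv \<Phi> y" "inv \<Phi> x"] that x by (simp add: f_inv_into_f)
    then show "\<exists>T B. open T \<and> x \<in> T \<and>
        (\<forall>y \<in> N \<inter> range \<Phi> \<inter> T. norm (inv \<Phi> y - inv \<Phi> x) \<le> B * norm (y - x))"
      by (intro exI[of _ UNIV] exI[of _ L]) auto
  qed auto
  moreover have "\<Phi> -` N \<subseteq> inv \<Phi> ` (N \<inter> range \<Phi>)"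
  proof
    fix x assume "x \<in> \<Phi> -` N"
    then show "x \<in> inv \<Phi> ` (N \<inter> range \<Phi>)"
      by (intro image_eqI[of _ _ "\<Phi> x"]) (auto simp: inv_f_f[OF inj])
  qed
  ultimately show ?thesis by (rule negligible_subset)
qed

lemma negligible_borel_iff:
  assumes "S \<in> sets borel"
  shows "negligible S \<longleftrightarrow> emeasure lborel S = 0"
proof -
  have "S \<in> null_sets lebesgue \<longleftrightarrow> S \<in> null_sets lborel"
    using assms by (intro null_sets_completion_iff) simp
  then show ?thesis
    using assms by (simp add: negligible_iff_null_sets null_setsI null_setsD1) (auto intro: null_setsI)
qed

text \<open>Lipschitz constants give the sharp factor \<open>L\<^sup>n\<close> directly on balls only, so the open set
  is exhausted, up to a negligible set, by countably many disjoint balls (Vitali). Sharpness matters: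
  for maps with \<open>L = 1 + O(\<tau>)\<close> the loss has to be a factor \<open>1 + O(\<tau>)\<close>, and a covering
  with overlaps would only give a constant.\<close>

lemma expanding_vimage_open:
  fixes \<Phi> :: "'a::euclidean_space \<Rightarrow> 'a"
  assumes cont: "continuous_on UNIV \<Phi>" and surj: "surj \<Phi>" and L: "1 \<le> L"
    and exp: "\<And>x y. norm (x - y) \<le> L * norm (\<Phi> x - \<Phi> y)" and U: "open U"
  shows "emeasure lborel (\<Phi> -` U) \<le> ennreal (L ^ DIM('a)) * emeasure lborel U"
proof -
  have vim [measurable]: "\<Phi> -` S \<in> sets borel" if "S \<in> sets borel" for S
    using measurable_sets[OF borel_measurable_continuous_onI[OF cont] that] by simp
  let ?K = "{(x, r). 0 < r \<and> ball x r \<subseteq> U}"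
  have *: "\<exists>i. i \<in> ?K \<and> x \<in> ball (fst i) (snd i) \<and> snd i < d" if "x \<in> U" "0 < d" for x d
  proof -
    obtain e where e: "e > 0" "ball x e \<subseteq> U" using U \<open>x \<in> U\<close> by (meson openE)
    then have "ball x (min e (d/2)) \<subseteq> U" by auto
    then show ?thesis using e \<open>0 < d\<close> by (intro exI[of _ "(x, min e (d/2))"]) auto
  qed
  obtain C where C: "countable C" "C \<subseteq> ?K"
    "pairwise (\<lambda>i j. disjnt (ball (fst i) (snd i)) (ball (fst j) (snd j))) C"
    "negligible (U - (\<Union>i\<in>C. ball (fst i) (snd i)))"
    by (rule Vitali_covering_theorem_balls[of U ?K fst snd, OF *])
  define B where "B i = ball (fst i) (snd i)" for i :: "'a \<times> real"
  have disj: "disjoint_family_on B C"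
    using C(3) by (auto simp: disjoint_family_on_def pairwise_def disjnt_def B_def)
  then have disj': "disjoint_family_on (\<lambda>i. \<Phi> -` B i) C"
    unfolding disjoint_family_on_def by blast
  have Bm [measurable]: "B i \<in> sets borel" for i by (simp add: B_def)
  define N where "N = U - (\<Union>i\<in>C. B i)"
  have UB: "(\<Union>i\<in>C. B i) \<in> sets borel" using C(1) by (intro sets.countable_UN') auto
  have Nm: "N \<in> sets borel" using U UB by (simp add: N_def)
  have "negligible (\<Phi> -` N)"
    using C(4) by (intro expanding_vimage_negligible[OF exp]) (simp add: N_def B_def)
  then have N0: "emeasure lborel (\<Phi> -` N) = 0"
    using negligible_borel_iff[OF vim[OF Nm]] by simp
  have "\<Phi> -` U \<subseteq> (\<Union>i\<in>C. \<Phi> -` B i) \<union> \<Phi> -` N" by (auto simp: N_def)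
  moreover have UB': "(\<Union>i\<in>C. \<Phi> -` B i) \<in> sets borel"
    using C(1) by (intro sets.countable_UN') auto
  ultimately have "emeasure lborel (\<Phi> -` U) \<le> emeasure lborel ((\<Union>i\<in>C. \<Phi> -` B i) \<union> \<Phi> -` N)"
    using vim[OF Nm] by (intro emeasure_mono) auto
  also have "\<dots> \<le> emeasure lborel (\<Union>i\<in>C. \<Phi> -` B i) + emeasure lborel (\<Phi> -` N)"
    using UB' vim[OF Nm] by (intro emeasure_subadditive) auto
  also have "\<dots> = (\<integral>\<^sup>+i. emeasure lborel (\<Phi> -` B i) \<partial>count_space C)"
    using C(1) disj' by (simp add: N0 emeasure_UN_countable)
  also have "\<dots> \<le> (\<integral>\<^sup>+i. ennreal (L ^ DIM('a)) * emeasure lborel (B i) \<partial>count_space C)"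
  proof (intro nn_integral_mono)
    fix i assume "i \<in> space (count_space C)"
    then have "0 < snd i" using C(2) by auto
    then show "emeasure lborel (\<Phi> -` B i) \<le> ennreal (L ^ DIM('a)) * emeasure lborel (B i)"
      unfolding B_def by (rule expanding_vimage_ball[OF cont surj L exp])
  qed
  also have "\<dots> = ennreal (L ^ DIM('a)) * emeasure lborel (\<Union>i\<in>C. B i)"
    using C(1) disj by (simp add: nn_integral_cmult emeasure_UN_countable)
  also have "\<dots> \<le> ennreal (L ^ DIM('a)) * emeasure lborel U"
    using U C(2) by (intro mult_left_mono emeasure_mono) (fastforce simp: B_def)+
  finally show ?thesis .
qed

lemma expanding_vimage_borel:
  fixes \<Phi> :: "'a::euclidean_space \<Rightarrow> 'a"
  assumes cont: "continuous_on UNIV \<Phi>" and surj: "surj \<Phi>" and L: "1 \<le> L"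
    and exp: "\<And>x y. norm (x - y) \<le> L * norm (\<Phi> x - \<Phi> y)" and E: "E \<in> sets borel"
  shows "emeasure lborel (\<Phi> -` E) \<le> ennreal (L ^ DIM('a)) * emeasure lborel E"
proof (rule ennreal_le_epsilon)
  fix e :: real assume e: "0 < e"
  have Ln: "0 < L ^ DIM('a)" using L by simp
  obtain U where U: "open U" "E \<subseteq> U" "emeasure lborel (U - E) < e / L ^ DIM('a)"
    using outer_regular_lborel[OF E, of "e / L ^ DIM('a)"] e Ln by auto
  have "\<Phi> -` U \<in> sets borel"
    using measurable_sets[OF borel_measurable_continuous_onI[OF cont], of U] U(1) by simp
  then have "emeasure lborel (\<Phi> -` E) \<le> emeasure lborel (\<Phi> -` U)"
    using U(2) by (intro emeasure_mono) auto
  also have "\<dots> \<le> ennreal (L ^ DIM('a)) * emeasure lborel U"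
    by (rule expanding_vimage_open[OF cont surj L exp U(1)])
  also have "emeasure lborel U \<le> emeasure lborel E + emeasure lborel (U - E)"
  proof -
    have "U = E \<union> (U - E)" using U(2) by auto
    then show ?thesis using E U(1) emeasure_subadditive[of E lborel "U - E"] by simp
  qed
  also have "emeasure lborel (U - E) \<le> ennreal (e / L ^ DIM('a))" using U(3) by simp
  also have "ennreal (L ^ DIM('a)) * (emeasure lborel E + ennreal (e / L ^ DIM('a)))
      = ennreal (L ^ DIM('a)) * emeasure lborel E + ennreal e"
    using Ln e L by (simp add: distrib_left ennreal_mult[symmetric])
  finally show "emeasure lborel (\<Phi> -` E) \<le> ennreal (L ^ DIM('a)) * emeasure lborel E + ennreal e"
    by (simp add: mult_left_mono)
qed

text \<open>This replaces the change of variables formula: only an upper bound is needed, so neither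
  differentiability nor a Jacobian determinant has to be considered.\<close>

lemma nn_integral_comp_expanding:
  fixes \<Phi> :: "'a::euclidean_space \<Rightarrow> 'a"
  assumes cont: "continuous_on UNIV \<Phi>" and surj: "surj \<Phi>" and L: "1 \<le> L"
    and exp: "\<And>x y. norm (x - y) \<le> L * norm (\<Phi> x - \<Phi> y)"
    and F: "F \<in> borel_measurable borel"
  shows "(\<integral>\<^sup>+x. F (\<Phi> x) \<partial>lborel) \<le> ennreal (L ^ DIM('a)) * (\<integral>\<^sup>+x. F x \<partial>lborel)"
proof -
  have \<Phi>m [measurable]: "\<Phi> \<in> borel_measurable borel"
    by (rule borel_measurable_continuous_onI[OF cont])
  have "distr lborel borel \<Phi> \<le> scale_measure (ennreal (L ^ DIM('a))) lborel"
    using expanding_vimage_borel[OF cont surj L exp]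
    by (subst le_measure) (auto simp: emeasure_distr le_fun_def)
  then have "nn_integral (distr lborel borel \<Phi>) F
      \<le> nn_integral (scale_measure (ennreal (L ^ DIM('a))) lborel) F"
    by (intro nn_integral_mono_measure) auto
  then show ?thesis using F by (simp add: nn_integral_distr nn_integral_scale_measure)
qed

section \<open>Translates and difference energies\<close>

definition l2sq :: "('a::euclidean_space \<Rightarrow> real) \<Rightarrow> ennreal" where
  "l2sq v = (\<integral>\<^sup>+x. ennreal ((v x)\<^sup>2) \<partial>lborel)"

definition fdiff :: "'a::euclidean_space \<Rightarrow> ('a \<Rightarrow> real) \<Rightarrow> 'a \<Rightarrow> real" where
  "fdiff h v = (\<lambda>x. v (x + h) - v x)"

text \<open>The square of the Gagliardo seminorm as an iterated Borel integral: unlike products of completed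
  measures, Borel measures are preserved by shears of the product space.\<close>

definition gag :: "real \<Rightarrow> ('a::euclidean_space \<Rightarrow> real) \<Rightarrow> ennreal" where
  "gag s v = (\<integral>\<^sup>+x. \<integral>\<^sup>+y. ennreal ((v x - v y)\<^sup>2 / norm (x - y) powr (real DIM('a) + 2 * s))
     \<partial>lborel \<partial>lborel)"

definition near_energy :: "real \<Rightarrow> ('a::euclidean_space \<Rightarrow> real) \<Rightarrow> ennreal" where
  "near_energy r v = (\<integral>\<^sup>+x. \<integral>\<^sup>+y. ennreal (if norm (x - y) < r then (v x - v y)\<^sup>2 else 0)
     \<partial>lborel \<partial>lborel)"

lemma power2_diff_le: "(a - b)\<^sup>2 \<le> 2 * a\<^sup>2 + 2 * (b :: real)\<^sup>2"
proof -
  have "0 \<le> (a + b)\<^sup>2" by simp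
  then show ?thesis by (simp add: power2_eq_square algebra_simps)
qed

lemma fdiff_measurable [measurable]:
  assumes [measurable]: "v \<in> borel_measurable borel"
  shows "fdiff h v \<in> borel_measurable borel"
  unfolding fdiff_def by measurable

lemma nn_integral_translate:
  fixes F :: "'a::euclidean_space \<Rightarrow> ennreal"
  assumes F: "F \<in> borel_measurable borel"
  shows "(\<integral>\<^sup>+x. F (x + h) \<partial>lborel) = (\<integral>\<^sup>+x. F x \<partial>lborel)"
proof -
  have "(\<integral>\<^sup>+x. F x \<partial>lborel) = (\<integral>\<^sup>+x. F x \<partial>distr lborel borel ((+) h))"
    by (simp add: lborel_distr_plus)
  also have "\<dots> = (\<integral>\<^sup>+x. F (x + h) \<partial>lborel)"
    using F by (subst nn_integral_distr) (auto simp: add.commute)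
  finally show ?thesis by simp
qed

text \<open>The coordinates \<open>(x, h)\<close> with \<open>y = x + h\<close> turn Gagliardo integrals into averages of
  squared \<open>L\<^sup>2\<close> norms of differences.\<close>

lemma nn_integral_diagonal_coordinates:
  fixes F :: "'a::euclidean_space \<Rightarrow> 'a \<Rightarrow> ennreal"
  assumes F [measurable]: "case_prod F \<in> borel_measurable (borel \<Otimes>\<^sub>M borel)"
  shows "(\<integral>\<^sup>+x. \<integral>\<^sup>+y. F x y \<partial>lborel \<partial>lborel) = (\<integral>\<^sup>+h. \<integral>\<^sup>+x. F x (x + h) \<partial>lborel \<partial>lborel)"
proof -
  have m: "(\<lambda>y. F x y) \<in> borel_measurable borel" for x
    using measurable_Pair2[OF F, of x] by simp
  have m2: "(\<lambda>(x, h). F x (x + h)) \<in> borel_measurable (lborel \<Otimes>\<^sub>M lborel)"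
  proof -
    have "(\<lambda>z. (fst z, fst z + snd z)) \<in> (lborel \<Otimes>\<^sub>M lborel) \<rightarrow>\<^sub>M ((borel :: 'a measure) \<Otimes>\<^sub>M (borel :: 'a measure))"
      by measurable
    from measurable_compose[OF this F] show ?thesis by (simp add: case_prod_unfold)
  qed
  have "(\<integral>\<^sup>+x. \<integral>\<^sup>+y. F x y \<partial>lborel \<partial>lborel) = (\<integral>\<^sup>+x. \<integral>\<^sup>+h. F x (h + x) \<partial>lborel \<partial>lborel)"
    using nn_integral_translate[OF m] by simp
  also have "\<dots> = (\<integral>\<^sup>+h. \<integral>\<^sup>+x. F x (x + h) \<partial>lborel \<partial>lborel)"
    using m2 by (subst lborel_pair.Fubini') (auto simp: add.commute)
  finally show ?thesis .
qed

lemma gag_eq_fdiff: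
  fixes v :: "'a::euclidean_space \<Rightarrow> real"
  assumes [measurable]: "v \<in> borel_measurable borel"
  shows "gag s v = (\<integral>\<^sup>+h. l2sq (fdiff h v) * ennreal (1 / norm h powr (real DIM('a) + 2 * s)) \<partial>lborel)"
proof -
  have "gag s v = (\<integral>\<^sup>+h. \<integral>\<^sup>+x. ennreal ((v x - v (x + h))\<^sup>2 / norm (x - (x + h)) powr (real DIM('a) + 2 * s))
     \<partial>lborel \<partial>lborel)"
    unfolding gag_def by (rule nn_integral_diagonal_coordinates) measurable
  also have "\<dots> = (\<integral>\<^sup>+h. \<integral>\<^sup>+x. ennreal ((fdiff h v x)\<^sup>2) * ennreal (1 / norm h powr (real DIM('a) + 2 * s))
     \<partial>lborel \<partial>lborel)"
    by (simp add: ennreal_mult[symmetric] fdiff_def power2_commute)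
  also have "\<dots> = (\<integral>\<^sup>+h. l2sq (fdiff h v) * ennreal (1 / norm h powr (real DIM('a) + 2 * s)) \<partial>lborel)"
    unfolding l2sq_def by (subst nn_integral_multc) auto
  finally show ?thesis .
qed

text \<open>On the set where \<open>norm (x - y) < r\<close> the kernel is at least \<open>1 / r powr (n + 2 * s)\<close>.\<close>

lemma near_energy_le_gag:
  fixes v :: "'a::euclidean_space \<Rightarrow> real"
  assumes [measurable]: "v \<in> borel_measurable borel" and s: "0 \<le> s"
  shows "near_energy r v \<le> ennreal (r powr (real DIM('a) + 2 * s)) * gag s v"
proof -
  have "near_energy r v \<le> (\<integral>\<^sup>+x. \<integral>\<^sup>+y. ennreal (r powr (real DIM('a) + 2 * s)) *
      ennreal ((v x - v y)\<^sup>2 / norm (x - y) powr (real DIM('a) + 2 * s)) \<partial>lborel \<partial>lborel)"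
    unfolding near_energy_def
  proof (intro nn_integral_mono)
    fix x y :: 'a
    show "ennreal (if norm (x - y) < r then (v x - v y)\<^sup>2 else 0)
      \<le> ennreal (r powr (real DIM('a) + 2 * s)) *
        ennreal ((v x - v y)\<^sup>2 / norm (x - y) powr (real DIM('a) + 2 * s))"
    proof (cases "norm (x - y) < r \<and> x \<noteq> y")
      case True
      then have "norm (x - y) powr (real DIM('a) + 2 * s) \<le> r powr (real DIM('a) + 2 * s)"
        using s by (intro powr_mono2) auto
      moreover have "0 < norm (x - y) powr (real DIM('a) + 2 * s)" using True by simp
      ultimately have "(v x - v y)\<^sup>2 \<le> r powr (real DIM('a) + 2 * s) *
          ((v x - v y)\<^sup>2 / norm (x - y) powr (real DIM('a) + 2 * s))"
        by (simp add: pos_le_divide_eq mult_left_mono mult.commute)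
      then show ?thesis using True by (simp add: ennreal_mult[symmetric])
    qed auto
  qed
  also have "\<dots> = ennreal (r powr (real DIM('a) + 2 * s)) * gag s v"
    unfolding gag_def by (simp add: nn_integral_cmult)
  finally show ?thesis .
qed

lemma near_energy_le_translates:
  fixes v :: "'a::euclidean_space \<Rightarrow> real"
  assumes [measurable]: "v \<in> borel_measurable borel"
    and M: "\<And>h. norm h < r \<Longrightarrow> l2sq (fdiff h v) \<le> M"
  shows "near_energy r v \<le> M * emeasure lborel (ball (0::'a) r)"
proof -
  have "near_energy r v = (\<integral>\<^sup>+h. \<integral>\<^sup>+x. ennreal (if norm (x - (x + h)) < r then (v x - v (x + h))\<^sup>2 else 0)
     \<partial>lborel \<partial>lborel)"
    unfolding near_energy_def by (rule nn_integral_diagonal_coordinates) measurable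
  also have "\<dots> \<le> (\<integral>\<^sup>+h. M * indicator (ball (0::'a) r) h \<partial>lborel)"
  proof (rule nn_integral_mono)
    fix h :: 'a
    show "(\<integral>\<^sup>+x. ennreal (if norm (x - (x + h)) < r then (v x - v (x + h))\<^sup>2 else 0) \<partial>lborel)
       \<le> M * indicator (ball 0 r) h"
      using M[of h] by (cases "norm h < r") (simp_all add: l2sq_def fdiff_def power2_commute)
  qed
  also have "\<dots> = M * emeasure lborel (ball (0::'a) r)"
    by (intro nn_integral_cmult_indicator) simp
  finally show ?thesis .
qed

text \<open>A shift that depends on the point is compared with an average of constant shifts: for \<open>z\<close> in the
  ball of radius \<open>r\<close> about \<open>x\<close>, both \<open>x\<close> and \<open>\<Phi> x\<close> are within \<open>2 * r\<close> of
  \<open>z\<close>. Insert \<open>v z\<close>, integrate over \<open>z\<close> and then over \<open>x\<close>, and change variables in the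
  term that contains \<open>\<Phi> x\<close>.\<close>

lemma l2sq_variable_shift:
  fixes v :: "'a::euclidean_space \<Rightarrow> real"
  assumes v [measurable]: "v \<in> borel_measurable borel"
    and cont: "continuous_on UNIV \<Phi>" and surj: "surj \<Phi>"
    and exp: "\<And>x y. norm (x - y) \<le> 2 * norm (\<Phi> x - \<Phi> y)"
    and disp: "\<And>x. norm (\<Phi> x - x) \<le> r"
  shows "emeasure lborel (ball (0::'a) r) * l2sq (\<lambda>x. v (\<Phi> x) - v x)
    \<le> ennreal (2 * 2 ^ DIM('a) + 2) * near_energy (2 * r) v"
proof -
  have \<Phi>m [measurable]: "\<Phi> \<in> borel_measurable borel"
    by (rule borel_measurable_continuous_onI[OF cont])
  define H where "H x = (\<integral>\<^sup>+z. ennreal (if norm (x - z) < 2 * r then (v x - v z)\<^sup>2 else 0) \<partial>lborel)" for x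
  have Hm [measurable]: "H \<in> borel_measurable borel"
    unfolding H_def by measurable
  have "emeasure lborel (ball (0::'a) r) * ennreal ((v (\<Phi> x) - v x)\<^sup>2) \<le> 2 * H (\<Phi> x) + 2 * H x" for x
  proof -
    have "emeasure lborel (ball (0::'a) r) = emeasure lborel (ball x r)"
    proof (cases "0 \<le> r")
      case True
      then show ?thesis
        using content_ball_conv_unit_ball[of r x] content_ball_conv_unit_ball[of r "0::'a"]
        by (simp add: emeasure_lborel_ball_eq_content)
    qed (simp add: ball_empty)
    then have "emeasure lborel (ball (0::'a) r) * ennreal ((v (\<Phi> x) - v x)\<^sup>2)
      = (\<integral>\<^sup>+z. ennreal ((v (\<Phi> x) - v x)\<^sup>2) * indicator (ball x r) z \<partial>lborel)"
      by (simp add: nn_integral_cmult_indicator mult.commute[of "emeasure lborel _"])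
    also have "\<dots> \<le> (\<integral>\<^sup>+z. 2 * ennreal (if norm (\<Phi> x - z) < 2 * r then (v (\<Phi> x) - v z)\<^sup>2 else 0)
        + 2 * ennreal (if norm (x - z) < 2 * r then (v x - v z)\<^sup>2 else 0) \<partial>lborel)"
    proof (rule nn_integral_mono)
      fix z
      show "ennreal ((v (\<Phi> x) - v x)\<^sup>2) * indicator (ball x r) z
        \<le> 2 * ennreal (if norm (\<Phi> x - z) < 2 * r then (v (\<Phi> x) - v z)\<^sup>2 else 0)
        + 2 * ennreal (if norm (x - z) < 2 * r then (v x - v z)\<^sup>2 else 0)"
      proof (cases "norm (x - z) < r")
        case True
        have "0 \<le> norm (x - z)" by simp
        then have 1: "norm (x - z) < 2 * r" using True by linarith
        have 2: "norm (\<Phi> x - z) < 2 * r"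
          using disp[of x] True norm_triangle_ineq[of "\<Phi> x - x" "x - z"] by simp
        have "(v (\<Phi> x) - v x)\<^sup>2 \<le> 2 * (v (\<Phi> x) - v z)\<^sup>2 + 2 * (v x - v z)\<^sup>2"
          using power2_diff_le[of "v (\<Phi> x) - v z" "v x - v z"] by simp
        then have "ennreal ((v (\<Phi> x) - v x)\<^sup>2) \<le> ennreal (2 * (v (\<Phi> x) - v z)\<^sup>2 + 2 * (v x - v z)\<^sup>2)"
          by (rule ennreal_leI)
        then show ?thesis using 1 2 True by (simp add: ennreal_plus ennreal_mult dist_norm)
      qed (simp add: dist_norm)
    qed
    also have "\<dots> = 2 * H (\<Phi> x) + 2 * H x"
      unfolding H_def by (subst nn_integral_add) (auto simp: nn_integral_cmult)
    finally show ?thesis .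
  qed
  then have "(\<integral>\<^sup>+x. emeasure lborel (ball (0::'a) r) * ennreal ((v (\<Phi> x) - v x)\<^sup>2) \<partial>lborel)
     \<le> (\<integral>\<^sup>+x. 2 * H (\<Phi> x) + 2 * H x \<partial>lborel)"
    by (intro nn_integral_mono)
  also have "\<dots> = 2 * (\<integral>\<^sup>+x. H (\<Phi> x) \<partial>lborel) + 2 * (\<integral>\<^sup>+x. H x \<partial>lborel)"
    by (subst nn_integral_add) (auto simp: nn_integral_cmult)
  also have "(\<integral>\<^sup>+x. H (\<Phi> x) \<partial>lborel) \<le> ennreal (2 ^ DIM('a)) * (\<integral>\<^sup>+x. H x \<partial>lborel)"
    using exp by (intro nn_integral_comp_expanding[OF cont surj]) auto
  also have "2 * (ennreal (2 ^ DIM('a)) * (\<integral>\<^sup>+x. H x \<partial>lborel)) + 2 * (\<integral>\<^sup>+x. H x \<partial>lborel)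
     = ennreal (2 * 2 ^ DIM('a) + 2) * (\<integral>\<^sup>+x. H x \<partial>lborel)"
    by (simp add: distrib_right ennreal_mult mult.assoc)
  also have "(\<integral>\<^sup>+x. H x \<partial>lborel) = near_energy (2 * r) v"
    by (simp add: H_def near_energy_def)
  finally show ?thesis
    by (simp add: l2sq_def nn_integral_cmult mult_left_mono add_right_mono)
qed

section \<open>Variable shifts\<close>

text \<open>Bi-Lipschitz constants are kept on both sides because the kernel needs the upper one and the
  change of variables the lower one.\<close>

definition near_identity :: "real \<Rightarrow> real \<Rightarrow> ('a::euclidean_space \<Rightarrow> 'a) \<Rightarrow> bool" where
  "near_identity L r \<Phi> \<longleftrightarrow> 1 \<le> L \<and> surj \<Phi> \<and> (\<forall>x. norm (\<Phi> x - x) \<le> r) \<and>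
     (\<forall>x y. norm (x - y) \<le> L * norm (\<Phi> x - \<Phi> y) \<and> norm (\<Phi> x - \<Phi> y) \<le> L * norm (x - y))"

lemma near_identity_mono: "near_identity L r \<Phi> \<Longrightarrow> L \<le> L' \<Longrightarrow> near_identity L' r \<Phi>"
  unfolding near_identity_def by (meson mult_right_mono norm_ge_zero order_trans)

lemma near_identity_continuous:
  assumes "near_identity L r \<Phi>" shows "continuous_on UNIV \<Phi>"
proof -
  have "L-lipschitz_on UNIV \<Phi>"
    using assms by (auto simp: near_identity_def lipschitz_on_def dist_norm)
  then show ?thesis by (rule lipschitz_on_continuous_on)
qed

lemma near_identity_translation:
  fixes h :: "'a::euclidean_space"
  shows "near_identity 1 (norm h) (\<lambda>x. x + h)"
proof -
  have "surj (\<lambda>x. x + h)" by (rule surjI[of _ "\<lambda>x. x - h"]) simp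
  then show ?thesis by (simp add: near_identity_def)
qed

lemma ennreal_le_divide_of_mult_le:
  assumes "ennreal a * N \<le> ennreal b" "0 < a"
  shows "N \<le> ennreal (b / a)"
proof -
  have "N = ennreal (1 / a) * (ennreal a * N)"
    using assms(2) by (simp add: mult.assoc[symmetric] ennreal_mult[symmetric])
  also have "\<dots> \<le> ennreal (1 / a) * ennreal b" by (intro mult_left_mono assms) simp
  also have "\<dots> = ennreal (b / a)"
  proof (cases "0 \<le> b")
    case True
    then show ?thesis using assms(2) by (simp add: ennreal_mult[symmetric])
  next
    case False
    then show ?thesis using assms(2) by (simp add: ennreal_neg divide_nonpos_pos)
  qed
  finally show ?thesis .
qed

lemma variable_shift_le_near_energy:
  fixes v :: "'a::euclidean_space \<Rightarrow> real"
  assumes v: "v \<in> borel_measurable borel" and \<Phi>: "near_identity 2 r \<Phi>"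
    and E: "near_energy (2 * r) v \<le> ennreal E" "0 \<le> E" and r: "0 < r"
  shows "l2sq (\<lambda>x. v (\<Phi> x) - v x)
    \<le> ennreal ((2 * 2 ^ DIM('a) + 2) * E / (r ^ DIM('a) * measure lborel (ball (0::'a) 1)))"
proof (rule ennreal_le_divide_of_mult_le)
  have eq: "emeasure lborel (ball (0::'a) r) = ennreal (r ^ DIM('a) * measure lborel (ball (0::'a) 1))"
    using r content_ball_conv_unit_ball[of r "0::'a"] by (simp add: emeasure_lborel_ball_eq_content)
  have "emeasure lborel (ball (0::'a) r) * l2sq (\<lambda>x. v (\<Phi> x) - v x)
    \<le> ennreal (2 * 2 ^ DIM('a) + 2) * near_energy (2 * r) v"
    using \<Phi> by (intro l2sq_variable_shift[OF v near_identity_continuous[OF \<Phi>]])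
      (auto simp: near_identity_def)
  also have "\<dots> \<le> ennreal (2 * 2 ^ DIM('a) + 2) * ennreal E"
    by (intro mult_left_mono E) simp
  also have "\<dots> = ennreal ((2 * 2 ^ DIM('a) + 2) * E)"
    using E by (simp add: ennreal_mult)
  finally show "ennreal (r ^ DIM('a) * measure lborel (ball (0::'a) 1)) * l2sq (\<lambda>x. v (\<Phi> x) - v x)
    \<le> ennreal ((2 * 2 ^ DIM('a) + 2) * E)" by (simp add: eq)
  show "0 < r ^ DIM('a) * measure lborel (ball (0::'a) 1)"
    using r content_ball_pos[of 1 "0::'a"] by simp
qed

text \<open>One value that serves both for the bound by the Gagliardo seminorm and for the bound by translates;
  it depends on the dimension only.\<close>

definition shift_const :: "'a::euclidean_space itself \<Rightarrow> real" where
  "shift_const _ = (2 * 2 ^ DIM('a) + 2) * 2 powr (real DIM('a) + 2) * (1 + 1 / measure lborel (ball (0::'a) 1))"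

lemma shift_const_pos: "0 < shift_const TYPE('a::euclidean_space)"
  unfolding shift_const_def using content_ball_pos[of 1 "0::'a"] by (intro mult_pos_pos add_pos_pos) auto

lemma variable_shift_le_gag:
  fixes v :: "'a::euclidean_space \<Rightarrow> real"
  assumes v: "v \<in> borel_measurable borel" and s: "0 \<le> s" "s \<le> 1" and r: "0 < r"
    and G: "gag s v \<le> ennreal G" "0 \<le> G" and \<Phi>: "near_identity 2 r \<Phi>"
  shows "l2sq (\<lambda>x. v (\<Phi> x) - v x) \<le> ennreal (shift_const TYPE('a) * r powr (2 * s) * G)"
proof -
  let ?\<omega> = "measure lborel (ball (0::'a) 1)"
  let ?p = "real DIM('a) + 2 * s"
  have w: "0 < ?\<omega>" by (rule content_ball_pos) simp
  have "near_energy (2 * r) v \<le> ennreal ((2 * r) powr ?p) * gag s v"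
    by (rule near_energy_le_gag[OF v s(1)])
  also have "\<dots> \<le> ennreal ((2 * r) powr ?p) * ennreal G" by (intro mult_left_mono G) simp
  also have "\<dots> = ennreal ((2 * r) powr ?p * G)" using G by (simp add: ennreal_mult)
  finally have "l2sq (\<lambda>x. v (\<Phi> x) - v x)
    \<le> ennreal ((2 * 2 ^ DIM('a) + 2) * ((2 * r) powr ?p * G) / (r ^ DIM('a) * ?\<omega>))"
    using G r by (intro variable_shift_le_near_energy[OF v \<Phi>]) auto
  also have "(2 * 2 ^ DIM('a) + 2) * ((2 * r) powr ?p * G) / (r ^ DIM('a) * ?\<omega>)
     = (2 * 2 ^ DIM('a) + 2) * 2 powr ?p * (1 / ?\<omega>) * r powr (2 * s) * G"
    using r w by (simp add: powr_mult powr_add powr_realpow field_simps)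
  also have "\<dots> \<le> shift_const TYPE('a) * r powr (2 * s) * G"
    unfolding shift_const_def using s w G by (intro mult_right_mono mult_mono mult_left_mono powr_mono) auto
  finally show ?thesis by (simp add: ennreal_leI)
qed

lemma variable_shift_le_translates:
  fixes v :: "'a::euclidean_space \<Rightarrow> real"
  assumes v: "v \<in> borel_measurable borel" and r: "0 < r" and M: "0 \<le> M"
    and h: "\<And>h. norm h < 2 * r \<Longrightarrow> l2sq (fdiff h v) \<le> ennreal M" and \<Phi>: "near_identity 2 r \<Phi>"
  shows "l2sq (\<lambda>x. v (\<Phi> x) - v x) \<le> ennreal (shift_const TYPE('a) * M)"
proof -
  let ?\<omega> = "measure lborel (ball (0::'a) 1)"
  have w: "0 < ?\<omega>" by (rule content_ball_pos) simp
  have "near_energy (2 * r) v \<le> ennreal M * emeasure lborel (ball (0::'a) (2 * r))"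
    using h by (intro near_energy_le_translates[OF v]) auto
  also have "\<dots> = ennreal (M * ((2 * r) ^ DIM('a) * ?\<omega>))"
    using r M content_ball_conv_unit_ball[of "2 * r" "0::'a"]
    by (simp add: emeasure_lborel_ball_eq_content ennreal_mult)
  finally have "l2sq (\<lambda>x. v (\<Phi> x) - v x)
    \<le> ennreal ((2 * 2 ^ DIM('a) + 2) * (M * ((2 * r) ^ DIM('a) * ?\<omega>)) / (r ^ DIM('a) * ?\<omega>))"
    using M r w by (intro variable_shift_le_near_energy[OF v \<Phi>]) auto
  also have "(2 * 2 ^ DIM('a) + 2) * (M * ((2 * r) ^ DIM('a) * ?\<omega>)) / (r ^ DIM('a) * ?\<omega>)
     = (2 * 2 ^ DIM('a) + 2) * 2 powr (real DIM('a)) * 1 * M"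
    using r w by (simp add: power_mult_distrib powr_realpow field_simps)
  also have "\<dots> \<le> shift_const TYPE('a) * M"
    unfolding shift_const_def using w M by (intro mult_right_mono mult_mono mult_left_mono powr_mono) auto
  finally show ?thesis by (simp add: ennreal_leI)
qed

lemma fdiff_le_gag:
  fixes v :: "'a::euclidean_space \<Rightarrow> real"
  assumes "v \<in> borel_measurable borel" "0 \<le> s" "s \<le> 1" "gag s v \<le> ennreal G" "0 \<le> G"
  shows "l2sq (fdiff h v) \<le> ennreal (shift_const TYPE('a) * norm h powr (2 * s) * G)"
proof (cases "h = 0")
  case False
  then show ?thesis unfolding fdiff_def
    using assms near_identity_mono[OF near_identity_translation, of 2 h]
    by (intro variable_shift_le_gag) auto
qed (simp add: l2sq_def fdiff_def)

lemma l2sq_comp_near_identity: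
  fixes v :: "'a::euclidean_space \<Rightarrow> real"
  assumes v [measurable]: "v \<in> borel_measurable borel" and \<Phi>: "near_identity L r \<Phi>"
  shows "l2sq (\<lambda>x. v (\<Phi> x)) \<le> ennreal (L ^ DIM('a)) * l2sq v"
  unfolding l2sq_def using \<Phi>
  by (intro nn_integral_comp_expanding[OF near_identity_continuous[OF \<Phi>]]) (auto simp: near_identity_def)

text \<open>One factor \<open>L\<^sup>n\<close> comes from each of the two variables and \<open>L powr (n + 2 * s)\<close> from the
  kernel. For \<open>L = 1 + O(\<tau>)\<close> the energy therefore grows by a factor \<open>1 + O(\<tau>)\<close>.\<close>

lemma gag_comp_near_identity:
  fixes v :: "'a::euclidean_space \<Rightarrow> real"
  assumes v [measurable]: "v \<in> borel_measurable borel" and \<Phi>: "near_identity L r \<Phi>" and s: "0 \<le> s"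
  shows "gag s (\<lambda>x. v (\<Phi> x)) \<le> ennreal (L powr (3 * real DIM('a) + 2 * s)) * gag s v"
proof -
  let ?p = "real DIM('a) + 2 * s"
  have L: "1 \<le> L" and ex: "norm (x - y) \<le> L * norm (\<Phi> x - \<Phi> y)"
    and li: "norm (\<Phi> x - \<Phi> y) \<le> L * norm (x - y)" and surj: "surj \<Phi>" for x y
    using \<Phi> by (auto simp: near_identity_def)
  note cont = near_identity_continuous[OF \<Phi>]
  have \<Phi>m [measurable]: "\<Phi> \<in> borel_measurable borel"
    by (rule borel_measurable_continuous_onI[OF cont])
  define K where "K x y = ennreal ((v x - v y)\<^sup>2 / norm (x - y) powr ?p)" for x y
  define K' where "K' x = (\<integral>\<^sup>+y. K x y \<partial>lborel)" for x
  have K'm [measurable]: "K' \<in> borel_measurable borel" unfolding K'_def K_def by measurable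
  have Km [measurable]: "K x \<in> borel_measurable borel" for x unfolding K_def by measurable
  have pt: "ennreal ((v (\<Phi> x) - v (\<Phi> y))\<^sup>2 / norm (x - y) powr ?p)
      \<le> ennreal (L powr ?p) * K (\<Phi> x) (\<Phi> y)" for x y
  proof (cases "x = y")
    case False
    then have pos: "0 < norm (\<Phi> x - \<Phi> y)" using ex[of x y] by (cases "\<Phi> x = \<Phi> y") auto
    have "norm (\<Phi> x - \<Phi> y) powr ?p \<le> (L * norm (x - y)) powr ?p"
      using li[of x y] s by (intro powr_mono2) auto
    also have "\<dots> = L powr ?p * norm (x - y) powr ?p" using L by (simp add: powr_mult)
    finally have "1 / norm (x - y) powr ?p \<le> L powr ?p / norm (\<Phi> x - \<Phi> y) powr ?p"
      using pos False by (simp add: field_simps)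
    then have "(v (\<Phi> x) - v (\<Phi> y))\<^sup>2 * (1 / norm (x - y) powr ?p)
        \<le> (v (\<Phi> x) - v (\<Phi> y))\<^sup>2 * (L powr ?p / norm (\<Phi> x - \<Phi> y) powr ?p)"
      by (intro mult_left_mono) auto
    then show ?thesis unfolding K_def by (simp add: ennreal_mult[symmetric] mult.commute ennreal_leI)
  qed simp
  have "gag s (\<lambda>x. v (\<Phi> x)) \<le> (\<integral>\<^sup>+x. \<integral>\<^sup>+y. ennreal (L powr ?p) * K (\<Phi> x) (\<Phi> y) \<partial>lborel \<partial>lborel)"
    unfolding gag_def by (intro nn_integral_mono pt)
  also have "\<dots> = ennreal (L powr ?p) * (\<integral>\<^sup>+x. \<integral>\<^sup>+y. K (\<Phi> x) (\<Phi> y) \<partial>lborel \<partial>lborel)"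
    unfolding K_def by (simp add: nn_integral_cmult)
  also have "(\<integral>\<^sup>+x. \<integral>\<^sup>+y. K (\<Phi> x) (\<Phi> y) \<partial>lborel \<partial>lborel)
      \<le> (\<integral>\<^sup>+x. ennreal (L ^ DIM('a)) * K' (\<Phi> x) \<partial>lborel)"
    unfolding K'_def by (intro nn_integral_mono nn_integral_comp_expanding[OF cont surj L ex] Km)
  also have "\<dots> = ennreal (L ^ DIM('a)) * (\<integral>\<^sup>+x. K' (\<Phi> x) \<partial>lborel)"
    by (simp add: nn_integral_cmult)
  also have "(\<integral>\<^sup>+x. K' (\<Phi> x) \<partial>lborel) \<le> ennreal (L ^ DIM('a)) * (\<integral>\<^sup>+x. K' x \<partial>lborel)"
    by (intro nn_integral_comp_expanding[OF cont surj L ex] K'm)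
  also have "(\<integral>\<^sup>+x. K' x \<partial>lborel) = gag s v" by (simp add: K'_def K_def gag_def)
  also have "ennreal (L powr ?p) * (ennreal (L ^ DIM('a)) * (ennreal (L ^ DIM('a)) * gag s v))
     = ennreal (L powr (3 * real DIM('a) + 2 * s)) * gag s v"
  proof -
    have "L powr (3 * real DIM('a) + 2 * s) = L powr ?p * (L ^ DIM('a) * L ^ DIM('a))"
      using L by (simp add: powr_realpow[symmetric] powr_add[symmetric])
    then show ?thesis using L by (simp add: ennreal_mult mult.assoc)
  qed
  finally show ?thesis by (simp add: mult_left_mono)
qed

text \<open>Translation by \<open>h\<close> on the ball of radius \<open>\<rho>\<close> about \<open>p\<close>, identity outside the ball of
  twice that radius. A Lipschitz cutoff is enough for bi-Lipschitz bounds.\<close>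

definition bump_shift :: "'a::euclidean_space \<Rightarrow> real \<Rightarrow> 'a \<Rightarrow> 'a \<Rightarrow> 'a" where
  "bump_shift p \<rho> h x = x + (max 0 (min 1 (2 - norm (x - p) / \<rho>))) *\<^sub>R h"

text \<open>Surjectivity is the contraction principle for \<open>x \<mapsto> y - c x *\<^sub>R h\<close>, where \<open>c\<close> is the
  cutoff, whose Lipschitz constant is \<open>1 / \<rho>\<close>.\<close>

lemma near_identity_bump_shift:
  fixes h p :: "'a::euclidean_space"
  assumes \<rho>: "0 < \<rho>" and h: "norm h \<le> \<rho> / 2"
  shows "near_identity (1 + 2 * norm h / \<rho>) (norm h) (bump_shift p \<rho> h)"
proof -
  define c where "c x = max 0 (min 1 (2 - norm (x - p) / \<rho>))" for x
  define a where "a = norm h / \<rho>"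
  have a: "0 \<le> a" "a \<le> 1/2" using \<rho> h by (auto simp: a_def field_simps)
  have c: "0 \<le> c x" "c x \<le> 1" for x by (auto simp: c_def)
  have cl: "\<bar>c x - c y\<bar> \<le> norm (x - y) / \<rho>" for x y
  proof -
    have "\<bar>c x - c y\<bar> \<le> \<bar>norm (x - p) / \<rho> - norm (y - p) / \<rho>\<bar>" by (auto simp: c_def)
    also have "\<dots> = \<bar>norm (x - p) - norm (y - p)\<bar> / \<rho>"
      using \<rho> by (simp add: diff_divide_distrib[symmetric])
    also have "\<dots> \<le> norm (x - y) / \<rho>"
      using norm_triangle_ineq3[of "x - p" "y - p"] \<rho> by (intro divide_right_mono) auto
    finally show ?thesis .
  qed
  have ch: "norm (c x *\<^sub>R h - c y *\<^sub>R h) \<le> a * norm (x - y)" for x y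
  proof -
    have "norm (c x *\<^sub>R h - c y *\<^sub>R h) = \<bar>c x - c y\<bar> * norm h"
      by (simp add: scaleR_diff_left[symmetric])
    also have "\<dots> \<le> norm (x - y) / \<rho> * norm h" by (intro mult_right_mono cl) simp
    finally show ?thesis by (simp add: a_def mult.commute)
  qed
  have b: "bump_shift p \<rho> h x = x + c x *\<^sub>R h" for x by (simp add: bump_shift_def c_def)
  have "surj (bump_shift p \<rho> h)"
  proof (rule surjI)
    fix y
    have "\<exists>!x. y - c x *\<^sub>R h = x"
    proof (rule banach_fix_type[of "1/2"])
      have "dist (y - c x *\<^sub>R h) (y - c z *\<^sub>R h) \<le> 1/2 * dist x z" for x z
      proof -
        have "dist (y - c x *\<^sub>R h) (y - c z *\<^sub>R h) = norm (c x *\<^sub>R h - c z *\<^sub>R h)"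
          by (simp add: dist_norm norm_minus_commute)
        also have "\<dots> \<le> a * norm (x - z)" by (rule ch)
        also have "\<dots> \<le> 1/2 * norm (x - z)" using a by (intro mult_right_mono) auto
        finally show ?thesis by (simp add: dist_norm)
      qed
      then show "\<forall>x z. dist (y - c x *\<^sub>R h) (y - c z *\<^sub>R h) \<le> 1/2 * dist x z" by blast
    qed auto
    then have "\<exists>x. bump_shift p \<rho> h x = y" unfolding b by (metis diff_add_cancel)
    then show "bump_shift p \<rho> h (SOME x. bump_shift p \<rho> h x = y) = y" by (rule someI_ex)
  qed
  moreover have "norm (bump_shift p \<rho> h x - x) \<le> norm h" for x
    using c[of x] by (simp add: b mult_left_le_one_le)
  moreover have "norm (bump_shift p \<rho> h x - bump_shift p \<rho> h y) \<le> (1 + 2 * a) * norm (x - y)" for x y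
  proof -
    have "norm (bump_shift p \<rho> h x - bump_shift p \<rho> h y)
        \<le> norm (x - y) + norm (c x *\<^sub>R h - c y *\<^sub>R h)"
      unfolding b by (metis add_diff_add norm_triangle_ineq)
    also have "\<dots> \<le> norm (x - y) + a * norm (x - y)" using ch by simp
    also have "\<dots> \<le> (1 + 2 * a) * norm (x - y)"
      using a by (simp add: algebra_simps)
    finally show ?thesis .
  qed
  moreover have "norm (x - y) \<le> (1 + 2 * a) * norm (bump_shift p \<rho> h x - bump_shift p \<rho> h y)" for x y
  proof -
    have "norm (x - y) - norm (c x *\<^sub>R h - c y *\<^sub>R h) \<le> norm (bump_shift p \<rho> h x - bump_shift p \<rho> h y)"
      unfolding b by (metis add_diff_add norm_diff_ineq)
    then have "(1 - a) * norm (x - y) \<le> norm (bump_shift p \<rho> h x - bump_shift p \<rho> h y)"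
      using ch[of x y] by (simp add: algebra_simps)
    then have "(1 + 2 * a) * ((1 - a) * norm (x - y))
        \<le> (1 + 2 * a) * norm (bump_shift p \<rho> h x - bump_shift p \<rho> h y)"
      using a by (intro mult_left_mono) auto
    moreover have "1 \<le> (1 + 2 * a) * (1 - a)"
      using mult_nonneg_nonneg[of a "1 - 2 * a"] a by (simp add: algebra_simps)
    then have "1 * norm (x - y) \<le> (1 + 2 * a) * (1 - a) * norm (x - y)"
      by (rule mult_right_mono) simp
    ultimately show ?thesis by (simp add: mult.assoc)
  qed
  ultimately show ?thesis using a by (simp add: near_identity_def a_def)
qed

section \<open>Energy comparison with a deformed solution\<close>

text \<open>The normalised difference whose square integrates to the Gagliardo seminorm, so that the energy
  form becomes an \<open>L\<^sup>2\<close> inner product on the product space.\<close>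

definition dquot :: "real \<Rightarrow> ('a::euclidean_space \<Rightarrow> real) \<Rightarrow> 'a \<times> 'a \<Rightarrow> real" where
  "dquot s v z = (v (fst z) - v (snd z)) / norm (fst z - snd z) powr (real DIM('a) / 2 + s)"

definition gag_form :: "real \<Rightarrow> ('a::euclidean_space \<Rightarrow> real) \<Rightarrow> ('a \<Rightarrow> real) \<Rightarrow> real" where
  "gag_form s u v = (\<integral>z. dquot s u z * dquot s v z \<partial>(lborel \<Otimes>\<^sub>M lborel))"

text \<open>A Borel model of the space of the Dirichlet problem. Vanishing outside \<open>\<Omega>\<close> is required
  everywhere, so that composition with a map that preserves the complement stays in the class without a
  discussion of null sets.\<close>

definition energy_class :: "real \<Rightarrow> 'a::euclidean_space set \<Rightarrow> ('a \<Rightarrow> real) set" where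
  "energy_class s \<Omega> = {v \<in> borel_measurable borel. (\<forall>x. x \<notin> \<Omega> \<longrightarrow> v x = 0) \<and> l2sq v < \<infinity> \<and> gag s v < \<infinity>}"

text \<open>The equation as an estimate: the energy form tested with \<open>v\<close> is controlled by the
  \<open>L\<^sup>1\<close> norm of \<open>v\<close>. Up to the normalising constant, \<open>M\<close> is a bound for the modulus of the right-hand side. All estimates are homogeneous in \<open>M\<close>.\<close>

definition bounded_source :: "real \<Rightarrow> 'a::euclidean_space set \<Rightarrow> real \<Rightarrow> ('a \<Rightarrow> real) \<Rightarrow> bool" where
  "bounded_source s \<Omega> M u \<longleftrightarrow> u \<in> energy_class s \<Omega> \<and>
     (\<forall>v\<in>energy_class s \<Omega>. \<bar>gag_form s u v\<bar> \<le> M * (\<integral>x. \<bar>v x\<bar> \<partial>lborel))"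

lemma dquot_measurable [measurable]:
  fixes v :: "'a::euclidean_space \<Rightarrow> real"
  assumes [measurable]: "v \<in> borel_measurable borel"
  shows "dquot s v \<in> borel_measurable (lborel \<Otimes>\<^sub>M lborel)"
  unfolding dquot_def by measurable

lemma dquot_mult:
  fixes u :: "'a::euclidean_space \<Rightarrow> real"
  shows "dquot s u z * dquot s v z =
    (u (fst z) - u (snd z)) * (v (fst z) - v (snd z)) / norm (fst z - snd z) powr (real DIM('a) + 2 * s)"
proof -
  have "norm (fst z - snd z) powr (real DIM('a) / 2 + s) * norm (fst z - snd z) powr (real DIM('a) / 2 + s)
    = norm (fst z - snd z) powr (real DIM('a) + 2 * s)"
    by (simp add: powr_add[symmetric])
  then show ?thesis by (simp add: dquot_def)
qed

lemma gag_eq_dquot: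
  fixes v :: "'a::euclidean_space \<Rightarrow> real"
  assumes [measurable]: "v \<in> borel_measurable borel"
  shows "gag s v = (\<integral>\<^sup>+z. ennreal ((dquot s v z)\<^sup>2) \<partial>(lborel \<Otimes>\<^sub>M lborel))"
proof -
  have "(\<integral>\<^sup>+z. ennreal ((dquot s v z)\<^sup>2) \<partial>(lborel \<Otimes>\<^sub>M lborel))
     = (\<integral>\<^sup>+x. \<integral>\<^sup>+y. ennreal ((dquot s v (x, y))\<^sup>2) \<partial>lborel \<partial>lborel)"
    by (subst lborel.nn_integral_fst) auto
  then show ?thesis by (simp add: gag_def power2_eq_square dquot_mult)
qed

lemma integrable_dquot_square:
  fixes v :: "'a::euclidean_space \<Rightarrow> real"
  assumes v [measurable]: "v \<in> borel_measurable borel" and fin: "gag s v < \<infinity>"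
  shows "integrable (lborel \<Otimes>\<^sub>M lborel) (\<lambda>z. (dquot s v z)\<^sup>2)"
  by (rule integrableI_bounded) (use fin in \<open>auto simp: gag_eq_dquot[OF v]\<close>)

lemma integrable_dquot_mult:
  fixes v :: "'a::euclidean_space \<Rightarrow> real"
  assumes u [measurable]: "u \<in> borel_measurable borel" and fu: "gag s u < \<infinity>"
    and v [measurable]: "v \<in> borel_measurable borel" and fv: "gag s v < \<infinity>"
  shows "integrable (lborel \<Otimes>\<^sub>M lborel) (\<lambda>z. dquot s u z * dquot s v z)"
proof (rule Bochner_Integration.integrable_bound)
  show "integrable (lborel \<Otimes>\<^sub>M lborel) (\<lambda>z. (dquot s u z)\<^sup>2 + (dquot s v z)\<^sup>2)"
    by (intro Bochner_Integration.integrable_add integrable_dquot_square u v fu fv)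
  have "norm (a * b) \<le> norm (a\<^sup>2 + b\<^sup>2)" for a b :: real
  proof -
    have "2 * \<bar>a\<bar> * \<bar>b\<bar> \<le> \<bar>a\<bar>\<^sup>2 + \<bar>b\<bar>\<^sup>2" by (rule sum_squares_bound)
    moreover have "0 \<le> \<bar>a\<bar> * \<bar>b\<bar>" by simp
    ultimately show ?thesis unfolding real_norm_def abs_mult power2_abs by linarith
  qed
  then show "AE z in lborel \<Otimes>\<^sub>M lborel. norm (dquot s u z * dquot s v z)
      \<le> norm ((dquot s u z)\<^sup>2 + (dquot s v z)\<^sup>2)" by simp
qed measurable

lemma gag_eq_gag_form:
  fixes v :: "'a::euclidean_space \<Rightarrow> real"
  assumes v [measurable]: "v \<in> borel_measurable borel" and fin: "gag s v < \<infinity>"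
  shows "gag s v = ennreal (gag_form s v v)"
  unfolding gag_eq_dquot[OF v] gag_form_def power2_eq_square[symmetric]
  by (intro nn_integral_eq_integral integrable_dquot_square v fin) auto

lemma gag_form_self_nonneg: "0 \<le> gag_form s v v"
  unfolding gag_form_def by (intro integral_nonneg_AE) auto

lemma l2sq_diff_le: 
  fixes v :: "'a::euclidean_space \<Rightarrow> real"
  assumes [measurable]: "u \<in> borel_measurable borel" "v \<in> borel_measurable borel"
  shows "l2sq (\<lambda>x. v x - u x) \<le> 2 * l2sq v + 2 * l2sq u"
proof -
  have "l2sq (\<lambda>x. v x - u x) \<le> (\<integral>\<^sup>+x. 2 * ennreal ((v x)\<^sup>2) + 2 * ennreal ((u x)\<^sup>2) \<partial>lborel)"
    unfolding l2sq_def
  proof (rule nn_integral_mono)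
    fix x
    have "ennreal ((v x - u x)\<^sup>2) \<le> ennreal (2 * (v x)\<^sup>2 + 2 * (u x)\<^sup>2)"
      by (rule ennreal_leI[OF power2_diff_le])
    then show "ennreal ((v x - u x)\<^sup>2) \<le> 2 * ennreal ((v x)\<^sup>2) + 2 * ennreal ((u x)\<^sup>2)"
      by (simp add: ennreal_plus ennreal_mult)
  qed
  also have "\<dots> = 2 * l2sq v + 2 * l2sq u"
    unfolding l2sq_def by (subst nn_integral_add) (auto simp: nn_integral_cmult)
  finally show ?thesis .
qed

lemma gag_diff:
  fixes u v :: "'a::euclidean_space \<Rightarrow> real"
  assumes u [measurable]: "u \<in> borel_measurable borel" and fu: "gag s u < \<infinity>"
    and v [measurable]: "v \<in> borel_measurable borel" and fv: "gag s v < \<infinity>"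
  shows "gag s (\<lambda>x. v x - u x) < \<infinity>"
    and "gag_form s (\<lambda>x. v x - u x) (\<lambda>x. v x - u x) = gag_form s v v - gag_form s u u - 2 * gag_form s u (\<lambda>x. v x - u x)"
proof -
  let ?w = "\<lambda>x. v x - u x"
  have d: "dquot s ?w z = dquot s v z - dquot s u z" for z
    by (simp add: dquot_def diff_divide_distrib[symmetric] algebra_simps)
  have i: "integrable (lborel \<Otimes>\<^sub>M lborel) (\<lambda>z. dquot s v z * dquot s v z)"
    "integrable (lborel \<Otimes>\<^sub>M lborel) (\<lambda>z. dquot s u z * dquot s u z)"
    "integrable (lborel \<Otimes>\<^sub>M lborel) (\<lambda>z. dquot s u z * dquot s v z)"
    using assms by (auto intro: integrable_dquot_mult)
  have e: "(dquot s ?w z)\<^sup>2 = dquot s v z * dquot s v z - 2 * (dquot s u z * dquot s v z) + dquot s u z * dquot s u z"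
    for z unfolding d by (simp add: power2_eq_square algebra_simps)
  have iw: "integrable (lborel \<Otimes>\<^sub>M lborel) (\<lambda>z. (dquot s ?w z)\<^sup>2)"
    unfolding e using i by simp
  have wm: "?w \<in> borel_measurable borel" by measurable
  show fw: "gag s ?w < \<infinity>"
    unfolding gag_eq_dquot[OF wm] using integrableD(2)[OF iw] by (simp add: less_top)
  have iuw: "integrable (lborel \<Otimes>\<^sub>M lborel) (\<lambda>z. dquot s u z * dquot s ?w z)"
    by (rule integrable_dquot_mult[OF u fu wm fw])
  have "gag_form s ?w ?w = (\<integral>z. dquot s v z * dquot s v z - dquot s u z * dquot s u z
      - 2 * (dquot s u z * dquot s ?w z) \<partial>(lborel \<Otimes>\<^sub>M lborel))"
    unfolding gag_form_def by (rule Bochner_Integration.integral_cong) (auto simp: d algebra_simps)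
  also have "\<dots> = gag_form s v v - gag_form s u u - 2 * gag_form s u ?w"
    unfolding gag_form_def using i iuw by simp
  finally show "gag_form s ?w ?w = gag_form s v v - gag_form s u u - 2 * gag_form s u ?w" .
qed

text \<open>The free parameter \<open>\<alpha>\<close> stands in for the Cauchy--Schwarz inequality; it is chosen later so
  that both terms have the same size.\<close>

lemma l1_norm_le:
  fixes w :: "'a::euclidean_space \<Rightarrow> real"
  assumes w [measurable]: "w \<in> borel_measurable borel" and 0: "\<And>x. x \<notin> \<Omega> \<Longrightarrow> w x = 0"
    and \<Omega>: "open \<Omega>" "bounded \<Omega>" and N: "l2sq w \<le> ennreal N" "0 \<le> N" and \<alpha>: "0 < \<alpha>"
  shows "(\<integral>x. \<bar>w x\<bar> \<partial>lborel) \<le> (\<alpha> * measure lborel \<Omega> + N / \<alpha>) / 2"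
proof -
  have fin: "emeasure lborel \<Omega> < \<infinity>" using \<Omega>(2) by (rule emeasure_bounded_finite)
  have [measurable]: "\<Omega> \<in> sets borel" using \<Omega> by auto
  have i2: "integrable lborel (\<lambda>x. (w x)\<^sup>2)"
    by (rule integrableI_bounded) (use N in \<open>auto simp: l2sq_def intro: le_less_trans\<close>)
  have le2: "(\<integral>x. (w x)\<^sup>2 \<partial>lborel) \<le> N"
  proof -
    have "ennreal (\<integral>x. (w x)\<^sup>2 \<partial>lborel) = l2sq w"
      unfolding l2sq_def using i2 by (subst nn_integral_eq_integral) auto
    then have "ennreal (\<integral>x. (w x)\<^sup>2 \<partial>lborel) \<le> ennreal N" using N(1) by (simp only:)
    then show ?thesis using N(2) ennreal_le_iff by blast
  qed
  have pt: "\<bar>w x\<bar> \<le> (\<alpha> * indicator \<Omega> x + (w x)\<^sup>2 / \<alpha>) / 2" for x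
  proof (cases "x \<in> \<Omega>")
    case True
    have "2 * \<alpha> * \<bar>w x\<bar> \<le> \<alpha>\<^sup>2 + \<bar>w x\<bar>\<^sup>2" by (rule sum_squares_bound)
    then show ?thesis using True \<alpha> by (simp add: field_simps power2_eq_square)
  qed (use 0 in simp)
  have ii: "integrable lborel (\<lambda>x. (\<alpha> * indicator \<Omega> x + (w x)\<^sup>2 / \<alpha>) / 2)"
    using fin i2 by (intro integrable_divide Bochner_Integration.integrable_add integrable_mult_right) auto
  have "(\<integral>x. \<bar>w x\<bar> \<partial>lborel) \<le> (\<integral>x. (\<alpha> * indicator \<Omega> x + (w x)\<^sup>2 / \<alpha>) / 2 \<partial>lborel)"
  proof (rule integral_mono[OF _ ii pt])
    have "norm \<bar>w x\<bar> \<le> norm ((\<alpha> * indicator \<Omega> x + (w x)\<^sup>2 / \<alpha>) / 2)" for x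
      using pt[of x] unfolding real_norm_def abs_abs by (rule order_trans) (rule abs_ge_self)
    then show "integrable lborel (\<lambda>x. \<bar>w x\<bar>)"
      by (intro Bochner_Integration.integrable_bound[OF ii]) auto
  qed
  also have "\<dots> = (\<alpha> * measure lborel \<Omega> + (\<integral>x. (w x)\<^sup>2 \<partial>lborel) / \<alpha>) / 2"
    using fin i2 by simp
  also have "\<dots> \<le> (\<alpha> * measure lborel \<Omega> + N / \<alpha>) / 2"
    using le2 \<alpha> by (intro divide_right_mono add_left_mono) auto
  finally show ?thesis .
qed

lemma energy_class_diff:
  assumes "u \<in> energy_class s \<Omega>" "v \<in> energy_class s \<Omega>"
  shows "(\<lambda>x. v x - u x) \<in> energy_class s \<Omega>"
proof -
  have "l2sq (\<lambda>x. v x - u x) \<le> 2 * l2sq v + 2 * l2sq u"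
    using assms by (intro l2sq_diff_le) (auto simp: energy_class_def)
  also have "\<dots> < \<infinity>" using assms by (simp add: energy_class_def ennreal_mult_less_top)
  finally have "l2sq (\<lambda>x. v x - u x) < \<infinity>" .
  then show ?thesis using assms gag_diff(1)[of u s v] by (auto simp: energy_class_def)
qed

text \<open>The quadratic identity \<open>B(v - u) = B(v) - B(u) - 2 * B(u, v - u)\<close> together with the equation
  for \<open>u\<close> tested with \<open>v - u\<close>. It says that a competitor with nearly the same energy is close to
  \<open>u\<close> in the energy norm.\<close>

lemma energy_gap:
  assumes u: "bounded_source s \<Omega> M u" and v: "v \<in> energy_class s \<Omega>"
  shows "gag_form s (\<lambda>x. v x - u x) (\<lambda>x. v x - u x)
    \<le> gag_form s v v - gag_form s u u + 2 * M * (\<integral>x. \<bar>v x - u x\<bar> \<partial>lborel)"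
proof -
  have un: "u \<in> energy_class s \<Omega>" using u by (simp add: bounded_source_def)
  have "\<bar>gag_form s u (\<lambda>x. v x - u x)\<bar> \<le> M * (\<integral>x. \<bar>v x - u x\<bar> \<partial>lborel)"
    using u energy_class_diff[OF un v] by (simp add: bounded_source_def)
  then show ?thesis
    using gag_diff(2)[of u s v] un v by (simp add: energy_class_def)
qed

lemma power_one_plus_le: "0 \<le> \<tau> \<Longrightarrow> \<tau> \<le> 1 \<Longrightarrow> (1 + \<tau>) ^ m \<le> 1 + \<tau> * (2 ^ m - 1 :: real)"
proof (induction m)
  case (Suc m)
  have "(1 + \<tau>) ^ Suc m \<le> (1 + \<tau>) * (1 + \<tau> * (2 ^ m - 1))"
    using Suc by (simp add: mult_left_mono)
  also have "\<dots> = 1 + \<tau> * 2 ^ m + \<tau> * \<tau> * (2 ^ m - 1)" by (simp add: algebra_simps)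
  also have "\<tau> * \<tau> * (2 ^ m - 1) \<le> \<tau> * 1 * (2 ^ m - 1)"
    using Suc by (intro mult_right_mono mult_left_mono) auto
  finally show ?case by (simp add: algebra_simps)
qed simp

text \<open>The energy gap with the competitor \<open>u \<circ> \<Phi>\<close>, an inner variation of \<open>u\<close>: its energy
  exceeds that of \<open>u\<close> by \<open>O(\<tau>)\<close> only, hence, apart from the source term, the difference has
  energy of order \<open>\<tau>\<close>, while membership in the energy space alone would only make it bounded. This gain of half an order is the source of the exponent \<open>s + 1 / 2\<close>.\<close>

lemma comp_near_identity_energy:
  fixes u :: "'a::euclidean_space \<Rightarrow> real"
  assumes u: "bounded_source s \<Omega> M u" and s: "0 < s" "s \<le> 1"
    and \<Phi>: "near_identity (1 + \<tau>) r \<Phi>" and \<tau>: "\<tau> \<le> 1" and out: "\<And>x. x \<notin> \<Omega> \<Longrightarrow> \<Phi> x \<notin> \<Omega>"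
  shows "(\<lambda>x. u (\<Phi> x) - u x) \<in> energy_class s \<Omega>"
    and "gag s (\<lambda>x. u (\<Phi> x) - u x) \<le>
      ennreal (2 ^ (3 * DIM('a) + 2) * \<tau> * gag_form s u u + 2 * M * (\<integral>x. \<bar>u (\<Phi> x) - u x\<bar> \<partial>lborel))"
proof -
  have un: "u \<in> energy_class s \<Omega>" using u by (simp add: bounded_source_def)
  then have um [measurable]: "u \<in> borel_measurable borel" and ug: "gag s u < \<infinity>" by (auto simp: energy_class_def)
  have [measurable]: "\<Phi> \<in> borel_measurable borel"
    by (rule borel_measurable_continuous_onI[OF near_identity_continuous[OF \<Phi>]])
  have \<tau>0: "0 \<le> \<tau>" using \<Phi> by (simp add: near_identity_def)
  have g: "gag s (\<lambda>x. u (\<Phi> x)) \<le> ennreal ((1 + \<tau>) powr (3 * real DIM('a) + 2 * s)) * gag s u"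
    using s by (intro gag_comp_near_identity[OF um \<Phi>]) auto
  also have "\<dots> < \<infinity>" using ug by (simp add: ennreal_mult_less_top)
  finally have gf: "gag s (\<lambda>x. u (\<Phi> x)) < \<infinity>" .
  have "l2sq (\<lambda>x. u (\<Phi> x)) \<le> ennreal ((1 + \<tau>) ^ DIM('a)) * l2sq u"
    by (rule l2sq_comp_near_identity[OF um \<Phi>])
  also have "\<dots> < \<infinity>" using un by (simp add: ennreal_mult_less_top energy_class_def)
  finally have vn: "(\<lambda>x. u (\<Phi> x)) \<in> energy_class s \<Omega>"
    using un out gf by (auto simp: energy_class_def)
  show wn: "(\<lambda>x. u (\<Phi> x) - u x) \<in> energy_class s \<Omega>" by (rule energy_class_diff[OF un vn])
  have bu: "0 \<le> gag_form s u u" by (rule gag_form_self_nonneg)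
  have "ennreal (gag_form s (\<lambda>x. u (\<Phi> x)) (\<lambda>x. u (\<Phi> x)))
      \<le> ennreal ((1 + \<tau>) powr (3 * real DIM('a) + 2 * s) * gag_form s u u)"
    using g bu gf ug by (simp add: gag_eq_gag_form ennreal_mult)
  then have "gag_form s (\<lambda>x. u (\<Phi> x)) (\<lambda>x. u (\<Phi> x)) \<le> (1 + \<tau>) powr (3 * real DIM('a) + 2 * s) * gag_form s u u"
    using bu by (simp add: ennreal_le_iff)
  also have "\<dots> \<le> (1 + \<tau>) ^ (3 * DIM('a) + 2) * gag_form s u u"
  proof (intro mult_right_mono bu)
    have "(1 + \<tau>) powr (3 * real DIM('a) + 2 * s) \<le> (1 + \<tau>) powr (real (3 * DIM('a) + 2))"
      using s \<tau>0 by (intro powr_mono) auto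
    then show "(1 + \<tau>) powr (3 * real DIM('a) + 2 * s) \<le> (1 + \<tau>) ^ (3 * DIM('a) + 2)"
      using \<tau>0 by (subst (asm) powr_realpow) auto
  qed
  also have "\<dots> \<le> (1 + \<tau> * (2 ^ (3 * DIM('a) + 2) - 1)) * gag_form s u u"
    using \<tau> \<tau>0 by (intro mult_right_mono bu power_one_plus_le)
  also have "\<dots> \<le> (1 + \<tau> * 2 ^ (3 * DIM('a) + 2)) * gag_form s u u"
    using \<tau>0 by (intro mult_right_mono bu add_left_mono mult_left_mono) auto
  finally have "gag_form s (\<lambda>x. u (\<Phi> x) - u x) (\<lambda>x. u (\<Phi> x) - u x)
    \<le> 2 ^ (3 * DIM('a) + 2) * \<tau> * gag_form s u u + 2 * M * (\<integral>x. \<bar>u (\<Phi> x) - u x\<bar> \<partial>lborel)"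
    using energy_gap[OF u vn] by (simp add: algebra_simps)
  then show "gag s (\<lambda>x. u (\<Phi> x) - u x) \<le>
      ennreal (2 ^ (3 * DIM('a) + 2) * \<tau> * gag_form s u u + 2 * M * (\<integral>x. \<bar>u (\<Phi> x) - u x\<bar> \<partial>lborel))"
    using wn gag_eq_gag_form[of "\<lambda>x. u (\<Phi> x) - u x" s] by (simp add: energy_class_def ennreal_leI)
qed

text \<open>Translate by a vector longer than the diameter: then \<open>u\<close> and its translate have disjoint supports
  and the difference is at least as large as \<open>u\<close>.\<close>

lemma poincare:
  fixes \<Omega> :: "'a::euclidean_space set"
  assumes \<Omega>: "bounded \<Omega>" and s: "0 < s" "s \<le> 1"
  shows "\<exists>P>0. \<forall>u\<in>energy_class s \<Omega>. l2sq u \<le> ennreal (P * gag_form s u u)"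
proof -
  let ?C = "shift_const TYPE('a)"
  obtain R where R: "R > 0" "\<And>x. x \<in> \<Omega> \<Longrightarrow> norm x < R"
    using \<Omega> by (meson bounded_pos_less)
  obtain b :: 'a where b: "norm b = 1" using vector_choose_size[of 1] by auto
  \<comment> \<open>every point of \<open>\<Omega>\<close> is moved out of the ball of radius \<open>R\<close>\<close>
  define h where "h = (2 * R) *\<^sub>R b"
  have hn: "norm h = 2 * R" using R b by (simp add: h_def)
  have "l2sq u \<le> ennreal (?C * norm h powr (2 * s) * gag_form s u u)" if u: "u \<in> energy_class s \<Omega>" for u
  proof -
    have "l2sq u \<le> l2sq (fdiff h u)"
      unfolding l2sq_def
    proof (intro nn_integral_mono ennreal_leI)
      fix x
      show "(u x)\<^sup>2 \<le> (fdiff h u x)\<^sup>2"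
      proof (cases "x \<in> \<Omega>")
        case True
        then have "norm x < R" using R by auto
        moreover have "norm h \<le> norm (x + h) + norm x"
          using norm_triangle_ineq4[of "x + h" x] by simp
        ultimately have "\<not> norm (x + h) < R" using hn by linarith
        then have "x + h \<notin> \<Omega>" using R by auto
        then show ?thesis using u by (simp add: fdiff_def energy_class_def)
      qed (use u in \<open>simp add: energy_class_def\<close>)
    qed
    also have "\<dots> \<le> ennreal (?C * norm h powr (2 * s) * gag_form s u u)"
      using u s gag_eq_gag_form[of u s] by (intro fdiff_le_gag) (auto simp: energy_class_def gag_form_self_nonneg)
    finally show ?thesis .
  qed
  then show ?thesis using shift_const_pos[where 'a='a] hn R(1) by (intro exI[of _ "?C * norm h powr (2 * s)"]) auto
qed

text \<open>Test with \<open>u\<close> itself and absorb; the parameter in the \<open>L\<^sup>1\<close> bound is \<open>M * P\<close>, with the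
  Poincare constant \<open>P\<close>, which makes the absorbed term half of the left-hand side.\<close>

lemma a_priori_bounds:
  fixes \<Omega> :: "'a::euclidean_space set"
  assumes \<Omega>: "open \<Omega>" "bounded \<Omega>" and s: "0 < s" "s \<le> 1"
  shows "\<exists>C>0. \<forall>M>0. \<forall>u. bounded_source s \<Omega> M u \<longrightarrow> gag_form s u u \<le> C * M\<^sup>2 \<and> l2sq u \<le> ennreal (C * M\<^sup>2)"
proof -
  obtain P where P: "P > 0" "\<And>u. u \<in> energy_class s \<Omega> \<Longrightarrow> l2sq u \<le> ennreal (P * gag_form s u u)"
    using poincare[OF \<Omega>(2) s] by blast
  let ?m = "measure lborel \<Omega>"
  have b: "gag_form s u u \<le> P * ?m * M\<^sup>2" if M: "0 < M" and u: "bounded_source s \<Omega> M u" for M u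
  proof -
    have un: "u \<in> energy_class s \<Omega>" using u by (simp add: bounded_source_def)
    have b0: "0 \<le> gag_form s u u" by (rule gag_form_self_nonneg)
    have "gag_form s u u \<le> M * (\<integral>x. \<bar>u x\<bar> \<partial>lborel)"
      using u un by (fastforce simp: bounded_source_def)
    also have "\<dots> \<le> M * (((M * P) * ?m + P * gag_form s u u / (M * P)) / 2)"
      using M P(1) P(2)[OF un] b0 un
      by (intro mult_left_mono l1_norm_le[OF _ _ \<Omega>]) (auto simp: energy_class_def)
    also have "\<dots> = (P * ?m * M\<^sup>2 + gag_form s u u) / 2"
      using M P by (simp add: field_simps power2_eq_square)
    finally show ?thesis by simp
  qed
  let ?C = "P * ?m + P * (P * ?m) + 1"
  have m: "0 \<le> ?m" by simp
  have "gag_form s u u \<le> ?C * M\<^sup>2 \<and> l2sq u \<le> ennreal (?C * M\<^sup>2)" if M: "0 < M" and u: "bounded_source s \<Omega> M u" for M u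
  proof
    have "P * ?m * M\<^sup>2 \<le> ?C * M\<^sup>2" using P(1) m by (intro mult_right_mono) auto
    then show "gag_form s u u \<le> ?C * M\<^sup>2" using b[OF M u] by linarith
    have "l2sq u \<le> ennreal (P * gag_form s u u)" using u by (intro P(2)) (simp add: bounded_source_def)
    also have "P * gag_form s u u \<le> P * (P * ?m * M\<^sup>2)" using P(1) b[OF M u] by (intro mult_left_mono) auto
    also have "\<dots> = P * (P * ?m) * M\<^sup>2" by simp
    also have "\<dots> \<le> ?C * M\<^sup>2" using P(1) m by (intro mult_right_mono) auto
    finally show "l2sq u \<le> ennreal (?C * M\<^sup>2)" by (simp add: ennreal_leI)
  qed
  moreover have "0 < ?C" using P(1) m by (intro add_nonneg_pos add_nonneg_nonneg) auto
  ultimately show ?thesis by blast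
qed

section \<open>Localised translations in a Lipschitz domain\<close>

text \<open>The constants are required to be uniform over all solutions, which is what makes the final constant
  independent of the right-hand side.\<close>

definition translate_bound :: "real \<Rightarrow> 'a::euclidean_space set \<Rightarrow> real \<Rightarrow> real \<Rightarrow> real \<Rightarrow> bool" where
  "translate_bound s \<Omega> t A r \<longleftrightarrow> (\<forall>M>0. \<forall>u. bounded_source s \<Omega> M u \<longrightarrow>
     (\<forall>h. norm h \<le> r \<longrightarrow> l2sq (fdiff h u) \<le> ennreal (A * M\<^sup>2 * norm h powr (2 * t))))"

text \<open>The two increments play different roles: \<open>h\<close> comes from the energy comparison, \<open>k\<close> from the
  embedding of the energy space, and so they are given different exponents.\<close>

definition second_bound :: "real \<Rightarrow> 'a::euclidean_space set \<Rightarrow> real \<Rightarrow> real \<Rightarrow> real \<Rightarrow> bool" where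
  "second_bound s \<Omega> t B r \<longleftrightarrow> (\<forall>M>0. \<forall>u. bounded_source s \<Omega> M u \<longrightarrow>
     (\<forall>h k. norm h \<le> r \<longrightarrow> norm k \<le> r \<longrightarrow>
        l2sq (fdiff k (fdiff h u)) \<le> ennreal (B * M\<^sup>2 * norm k powr (2 * s) * norm h powr t)))"

text \<open>Below the graph of a Lipschitz function one may move downwards, and in a whole cone of directions
  around the vertical, without leaving the complement. At an interior point every direction is allowed on a
  ball inside \<open>\<Omega>\<close>.\<close>

lemma exterior_directions:
  fixes \<Omega> :: "'a::euclidean_space set"
  assumes \<Omega>: "lipschitz_domain \<Omega>" and p: "p \<in> closure \<Omega>"
  obtains R d \<kappa> where "0 < R" "norm d = 1" "0 < \<kappa>" "\<kappa> \<le> 1"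
    "\<And>x \<tau> k. x \<in> ball p R \<Longrightarrow> x \<notin> \<Omega> \<Longrightarrow> 0 \<le> \<tau> \<Longrightarrow> norm k \<le> \<kappa> * \<tau> \<Longrightarrow>
       x + \<tau> *\<^sub>R d + k \<in> ball p R \<Longrightarrow> x + \<tau> *\<^sub>R d + k \<notin> \<Omega>"
proof (cases "p \<in> \<Omega>")
  case True
  have "open \<Omega>" using \<Omega> by (simp add: lipschitz_domain_def)
  then obtain R where R: "0 < R" "ball p R \<subseteq> \<Omega>" using True by (meson openE)
  obtain d :: 'a where "norm d = 1" using vector_choose_size[of 1] by auto
  then show ?thesis using R by (intro that[of R d 1]) auto
next
  case False
  have "open \<Omega>" using \<Omega> by (simp add: lipschitz_domain_def)
  then have "p \<in> frontier \<Omega>" using p False by (simp add: frontier_def interior_open)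
  then obtain R e L \<phi> where R: "0 < R" and e: "norm e = 1"
    and \<phi>: "L-lipschitz_on {z. z \<bullet> e = 0} \<phi>"
    and ep: "\<forall>x\<in>ball p R. x \<in> \<Omega> \<longleftrightarrow> \<phi> (x - (x \<bullet> e) *\<^sub>R e) < x \<bullet> e"
    using \<Omega> unfolding lipschitz_domain_def by blast
  have L: "0 \<le> L" using \<phi> by (rule lipschitz_on_nonneg)
  have ee: "e \<bullet> e = 1" using e by (simp add: dot_square_norm)
  have key: "x + \<tau> *\<^sub>R (- e) + k \<notin> \<Omega>"
    if x: "x \<in> ball p R" "x \<notin> \<Omega>" and \<tau>: "0 \<le> \<tau>" and k: "norm k \<le> 1 / (1 + 2 * L) * \<tau>"
      and y: "x + \<tau> *\<^sub>R (- e) + k \<in> ball p R" for x \<tau> k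
  proof -
    define y where "y = x + \<tau> *\<^sub>R (- e) + k"
    have ye: "y \<bullet> e = x \<bullet> e - \<tau> + k \<bullet> e" by (simp add: y_def inner_left_distrib inner_diff_left ee)
    have ke: "\<bar>k \<bullet> e\<bar> \<le> norm k" using Cauchy_Schwarz_ineq2[of k e] e by simp
    have y': "y - (y \<bullet> e) *\<^sub>R e = (x - (x \<bullet> e) *\<^sub>R e) + (k - (k \<bullet> e) *\<^sub>R e)"
      unfolding ye unfolding y_def by (simp add: algebra_simps)
    have "norm (k - (k \<bullet> e) *\<^sub>R e) \<le> norm k + norm ((k \<bullet> e) *\<^sub>R e)" by (rule norm_triangle_ineq4)
    also have "\<dots> \<le> 2 * norm k" using ke e by simp
    finally have k2: "norm (k - (k \<bullet> e) *\<^sub>R e) \<le> 2 * norm k" .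
    have "dist (\<phi> (y - (y \<bullet> e) *\<^sub>R e)) (\<phi> (x - (x \<bullet> e) *\<^sub>R e))
        \<le> L * dist (y - (y \<bullet> e) *\<^sub>R e) (x - (x \<bullet> e) *\<^sub>R e)"
      by (rule lipschitz_onD[OF \<phi>]) (auto simp: inner_diff_left ee)
    also have "\<dots> \<le> L * (2 * norm k)"
      unfolding y' using k2 L by (intro mult_left_mono) (auto simp: dist_norm)
    finally have "\<phi> (x - (x \<bullet> e) *\<^sub>R e) - 2 * L * norm k \<le> \<phi> (y - (y \<bullet> e) *\<^sub>R e)"
      by (simp add: dist_real_def)
    moreover have "x \<bullet> e \<le> \<phi> (x - (x \<bullet> e) *\<^sub>R e)" using ep x by auto
    moreover have "(1 + 2 * L) * norm k \<le> \<tau>" using k L by (simp add: field_simps)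
    then have "norm k + 2 * L * norm k \<le> \<tau>" by (simp add: algebra_simps)
    ultimately have "y \<bullet> e \<le> \<phi> (y - (y \<bullet> e) *\<^sub>R e)" using ye ke by linarith
    then show ?thesis using ep y unfolding y_def by auto
  qed
  show ?thesis
    using L e R key by (intro that[of R "- e" "1 / (1 + 2 * L)"]) (auto simp: field_simps)
qed

text \<open>The cone of admissible directions is closed under multiplication by the cutoff.\<close>

lemma bump_shift_exterior:
  fixes \<Omega> :: "'a::euclidean_space set"
  assumes ext: "\<And>x \<tau> k. x \<in> ball p (4 * \<rho>) \<Longrightarrow> x \<notin> \<Omega> \<Longrightarrow> 0 \<le> \<tau> \<Longrightarrow> norm k \<le> \<kappa> * \<tau> \<Longrightarrow>
       x + \<tau> *\<^sub>R d + k \<in> ball p (4 * \<rho>) \<Longrightarrow> x + \<tau> *\<^sub>R d + k \<notin> \<Omega>"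
    and \<rho>: "0 < \<rho>" and \<tau>: "0 \<le> \<tau>" and k: "norm k \<le> \<kappa> * \<tau>" and h: "norm (\<tau> *\<^sub>R d + k) \<le> \<rho> / 2"
    and x: "x \<notin> \<Omega>"
  shows "bump_shift p \<rho> (\<tau> *\<^sub>R d + k) x \<notin> \<Omega>"
proof (cases "norm (x - p) < 2 * \<rho>")
  case False
  then have "2 - norm (x - p) / \<rho> \<le> 0" using \<rho> by (simp add: field_simps)
  then show ?thesis using x by (simp add: bump_shift_def)
next
  case True
  define c where "c = max 0 (min 1 (2 - norm (x - p) / \<rho>))"
  have c: "0 \<le> c" "c \<le> 1" by (auto simp: c_def)
  have b: "bump_shift p \<rho> (\<tau> *\<^sub>R d + k) x = x + (c * \<tau>) *\<^sub>R d + c *\<^sub>R k"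
    by (simp add: bump_shift_def c_def[symmetric] scaleR_add_right)
  have "norm (bump_shift p \<rho> (\<tau> *\<^sub>R d + k) x - x) \<le> norm (\<tau> *\<^sub>R d + k)"
    using near_identity_bump_shift[OF \<rho> h, of p] by (simp add: near_identity_def)
  moreover have "norm (bump_shift p \<rho> (\<tau> *\<^sub>R d + k) x - p)
      \<le> norm (bump_shift p \<rho> (\<tau> *\<^sub>R d + k) x - x) + norm (x - p)"
    using norm_triangle_ineq[of "bump_shift p \<rho> (\<tau> *\<^sub>R d + k) x - x" "x - p"] by simp
  ultimately have "bump_shift p \<rho> (\<tau> *\<^sub>R d + k) x \<in> ball p (4 * \<rho>)"
    using True h \<rho> by (simp add: dist_norm norm_minus_commute)
  moreover have "x \<in> ball p (4 * \<rho>)" using True \<rho> by (simp add: dist_norm norm_minus_commute)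
  moreover have "norm (c *\<^sub>R k) \<le> \<kappa> * (c * \<tau>)"
  proof -
    have "norm (c *\<^sub>R k) = c * norm k" using c by simp
    also have "\<dots> \<le> c * (\<kappa> * \<tau>)" using c k by (intro mult_left_mono)
    finally show ?thesis by (simp add: algebra_simps)
  qed
  ultimately show ?thesis unfolding b using c \<tau> x by (intro ext) auto
qed

lemma le_powr_of_le_one:
  fixes a :: real
  assumes "0 \<le> a" "a \<le> 1" "t \<le> 1" "0 \<le> t"
  shows "a \<le> a powr t"
proof (cases "a = 0")
  case False
  then have "a powr 1 \<le> a powr t" using assms by (intro powr_mono') auto
  then show ?thesis using assms False by simp
qed (use assms in simp)

text \<open>Apply the energy comparison with a localised translation along an admissible direction; near
  \<open>p\<close> the localised translation is an honest one. The source term is controlled by the translation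
  modulus assumed for \<open>u\<close>, and this is how regularity is fed back in the bootstrap.\<close>

lemma second_difference_near_point_cone:
  fixes \<Omega> :: "'a::euclidean_space set"
  assumes \<Omega>: "open \<Omega>" "bounded \<Omega>" and s: "0 < s" "s \<le> 1" and t: "0 \<le> t" "t \<le> 1"
    and T: "translate_bound s \<Omega> t A r" "0 \<le> A" "0 < r" "r \<le> 1" and \<rho>: "0 < \<rho>"
  shows "\<exists>E>0. \<forall>M>0. \<forall>u. bounded_source s \<Omega> M u \<longrightarrow> (\<forall>h. norm h \<le> min (\<rho> / 2) (r / 4) \<longrightarrow>
      (\<forall>x. x \<notin> \<Omega> \<longrightarrow> bump_shift p \<rho> h x \<notin> \<Omega>) \<longrightarrow> (\<forall>k. norm k \<le> \<rho> / 2 \<longrightarrow>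
      (\<integral>\<^sup>+x. ennreal ((fdiff k (fdiff h u) x)\<^sup>2) * indicator (ball p (\<rho> / 2)) x \<partial>lborel)
        \<le> ennreal (E * M\<^sup>2 * norm k powr (2 * s) * norm h powr t)))"
proof -
  define C1 where "C1 = shift_const TYPE('a)"
  have C1: "0 < C1" unfolding C1_def by (rule shift_const_pos)
  obtain C3 where C3: "C3 > 0" "\<And>M u. 0 < M \<Longrightarrow> bounded_source s \<Omega> M u \<Longrightarrow> gag_form s u u \<le> C3 * M\<^sup>2"
    using a_priori_bounds[OF \<Omega> s] by blast
  define m where "m = measure lborel \<Omega>"
  define E where "E = 2 ^ (3 * DIM('a) + 2) * (2 / \<rho>) * C3 + (m + C1 * (A * 4))"
  have m: "0 \<le> m" by (simp add: m_def)
  have E: "0 < E"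
    unfolding E_def using C1 C3 \<rho> m T(2) by (intro add_pos_nonneg mult_pos_pos add_nonneg_nonneg) auto
  have main: "(\<integral>\<^sup>+x. ennreal ((fdiff k (fdiff h u) x)\<^sup>2) * indicator (ball p (\<rho> / 2)) x \<partial>lborel)
        \<le> ennreal (C1 * E * M\<^sup>2 * norm k powr (2 * s) * norm h powr t)"
    if M: "0 < M" and u: "bounded_source s \<Omega> M u" and h: "norm h \<le> min (\<rho> / 2) (r / 4)"
      and out: "\<And>x. x \<notin> \<Omega> \<Longrightarrow> bump_shift p \<rho> h x \<notin> \<Omega>" and k: "norm k \<le> \<rho> / 2" for M u h k
  proof (cases "h = 0")
    case True
    then show ?thesis by (simp add: fdiff_def)
  next
    case False
    define \<Phi> where "\<Phi> = bump_shift p \<rho> h"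
    have h1: "norm h \<le> 1" using h T by auto
    have hp: "0 < norm h powr t" using False by simp
    have un: "u \<in> energy_class s \<Omega>" using u by (simp add: bounded_source_def)
    then have um [measurable]: "u \<in> borel_measurable borel" by (simp add: energy_class_def)
    have ni: "near_identity (1 + 2 * norm h / \<rho>) (norm h) \<Phi>"
      unfolding \<Phi>_def using h \<rho> by (intro near_identity_bump_shift) auto
    have \<tau>1: "2 * norm h / \<rho> \<le> 1" using h \<rho> by (simp add: field_simps)
    define w where "w x = u (\<Phi> x) - u x" for x
    have wn: "w \<in> energy_class s \<Omega>"
      and wg: "gag s w \<le> ennreal (2 ^ (3 * DIM('a) + 2) * (2 * norm h / \<rho>) * gag_form s u u
        + 2 * M * (\<integral>x. \<bar>w x\<bar> \<partial>lborel))"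
      unfolding w_def
      using comp_near_identity_energy[OF u s ni \<tau>1] out by (auto simp: \<Phi>_def)
    have wm [measurable]: "w \<in> borel_measurable borel" using wn by (simp add: energy_class_def)
    let ?N = "C1 * (A * M\<^sup>2 * (2 * norm h) powr (2 * t))"
    have "l2sq w \<le> ennreal ?N"
      unfolding w_def C1_def
    proof ( rule variable_shift_le_translates[OF um])
      show "near_identity 2 (norm h) \<Phi>" using \<tau>1 by (intro near_identity_mono[OF ni]) simp
      fix \<eta> :: 'a assume \<eta>: "norm \<eta> < 2 * norm h"
      have "norm \<eta> \<le> r" using \<eta> h T by auto
      then have "l2sq (fdiff \<eta> u) \<le> ennreal (A * M\<^sup>2 * norm \<eta> powr (2 * t))"
        using T(1) M u by (auto simp: translate_bound_def)
      also have "\<dots> \<le> ennreal (A * M\<^sup>2 * (2 * norm h) powr (2 * t))"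
        using \<eta> T t by (intro ennreal_leI mult_left_mono powr_mono2) auto
      finally show "l2sq (fdiff \<eta> u) \<le> ennreal (A * M\<^sup>2 * (2 * norm h) powr (2 * t))" .
    qed (use False T in auto)
    \<comment> \<open>\<open>\<alpha> = M * norm h powr t\<close> balances the two terms: the norm of \<open>w\<close> is of this size\<close>
    then have "(\<integral>x. \<bar>w x\<bar> \<partial>lborel) \<le> ((M * norm h powr t) * m + ?N / (M * norm h powr t)) / 2"
      unfolding m_def using M hp wn C1 T
      by (intro l1_norm_le[OF wm _ \<Omega>]) (auto simp: energy_class_def)
    moreover have "?N / (M * norm h powr t) \<le> C1 * (A * 4) * (M * norm h powr t)"
    proof -
      have "(2 * norm h) powr (2 * t) = 2 powr (2 * t) * (norm h powr t * norm h powr t)"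
        by (simp add: powr_mult powr_add[symmetric])
      then have "?N / (M * norm h powr t) = C1 * (A * 2 powr (2 * t)) * (M * norm h powr t)"
        using M hp by (simp add: field_simps power2_eq_square)
      moreover have "2 powr (2 * t) \<le> (2::real) powr 2" using t by (intro powr_mono) auto
      then have "C1 * (A * 2 powr (2 * t)) * (M * norm h powr t) \<le> C1 * (A * 4) * (M * norm h powr t)"
        using C1 T M by (intro mult_right_mono mult_left_mono) auto
      ultimately show ?thesis by simp
    qed
    ultimately have "2 * (\<integral>x. \<bar>w x\<bar> \<partial>lborel) \<le> (m + C1 * (A * 4)) * (M * norm h powr t)"
      by (simp add: algebra_simps)
    then have "M * (2 * (\<integral>x. \<bar>w x\<bar> \<partial>lborel)) \<le> M * ((m + C1 * (A * 4)) * (M * norm h powr t))"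
      using M by (intro mult_left_mono) auto
    then have w1: "2 * M * (\<integral>x. \<bar>w x\<bar> \<partial>lborel) \<le> (m + C1 * (A * 4)) * M\<^sup>2 * norm h powr t"
      by (simp add: algebra_simps power2_eq_square)
    have "2 ^ (3 * DIM('a) + 2) * (2 * norm h / \<rho>) * gag_form s u u
        \<le> 2 ^ (3 * DIM('a) + 2) * (2 * norm h powr t / \<rho>) * (C3 * M\<^sup>2)"
      using C3(2)[OF M u] gag_form_self_nonneg[of s u] \<rho> le_powr_of_le_one[OF _ h1 t(2,1)] C3(1)
      by (intro mult_mono mult_left_mono divide_right_mono) auto
    then have "2 ^ (3 * DIM('a) + 2) * (2 * norm h / \<rho>) * gag_form s u u + 2 * M * (\<integral>x. \<bar>w x\<bar> \<partial>lborel)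
        \<le> E * M\<^sup>2 * norm h powr t"
      using w1 by (simp add: E_def algebra_simps)
    with wg have wg': "gag s w \<le> ennreal (E * M\<^sup>2 * norm h powr t)"
      by (meson ennreal_leI order_trans)
    have "l2sq (fdiff k w) \<le> ennreal (C1 * norm k powr (2 * s) * (E * M\<^sup>2 * norm h powr t))"
      using s E unfolding C1_def by (intro fdiff_le_gag[OF wm _ _ wg']) auto
    moreover have "(\<integral>\<^sup>+x. ennreal ((fdiff k (fdiff h u) x)\<^sup>2) * indicator (ball p (\<rho> / 2)) x \<partial>lborel)
        \<le> l2sq (fdiff k w)"
      unfolding l2sq_def
    proof (rule nn_integral_mono)
      fix x
      show "ennreal ((fdiff k (fdiff h u) x)\<^sup>2) * indicator (ball p (\<rho> / 2)) x \<le> ennreal ((fdiff k w x)\<^sup>2)"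
      proof (cases "x \<in> ball p (\<rho> / 2)")
        case True
        then have x: "norm (x - p) \<le> \<rho> / 2" by (simp add: dist_norm norm_minus_commute)
        have one: "\<Phi> y = y + h" if "norm (y - p) \<le> \<rho>" for y
        proof -
          have "norm (y - p) / \<rho> \<le> 1" using that \<rho> by simp
          then show ?thesis by (simp add: \<Phi>_def bump_shift_def)
        qed
        have "norm (x + k - p) \<le> \<rho>"
          using norm_triangle_ineq[of "x - p" k] x k by (simp add: algebra_simps)
        then have "\<Phi> (x + k) = x + k + h" by (rule one)
        moreover have "\<Phi> x = x + h" using x \<rho> by (intro one) auto
        ultimately show ?thesis using True by (simp add: w_def fdiff_def)
      qed simp
    qed
    ultimately show ?thesis by (simp add: mult_ac order_trans)
  qed
  show ?thesis
    by (rule exI[of _ "C1 * E"]) (use main C1 E in auto)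
qed

text \<open>Every small vector is the difference of two vectors of comparable length in the cone, and
  differences of \<open>u\<close> telescope accordingly: \<open>u (x + h) - u x\<close> is the difference of the
  increments along the two cone vectors, both started at \<open>x\<close> minus the second one.\<close>

lemma second_difference_near_point:
  fixes \<Omega> :: "'a::euclidean_space set"
  assumes \<Omega>: "lipschitz_domain \<Omega>" "bounded \<Omega>" and s: "0 < s" "s \<le> 1" and t: "0 \<le> t" "t \<le> 1"
    and T: "translate_bound s \<Omega> t A r" "0 \<le> A" "0 < r" "r \<le> 1" and p: "p \<in> closure \<Omega>"
  shows "\<exists>q>0. \<exists>B>0. \<forall>M>0. \<forall>u. bounded_source s \<Omega> M u \<longrightarrow> (\<forall>h k. norm h \<le> q \<longrightarrow> norm k \<le> q \<longrightarrow>
      (\<integral>\<^sup>+x. ennreal ((fdiff k (fdiff h u) x)\<^sup>2) * indicator (ball p q) x \<partial>lborel)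
        \<le> ennreal (B * M\<^sup>2 * norm k powr (2 * s) * norm h powr t))"
proof -
  obtain R d \<kappa> where R: "0 < R" and d: "norm d = 1" and \<kappa>: "0 < \<kappa>" "\<kappa> \<le> 1"
    and ext: "\<And>x \<tau> k. x \<in> ball p R \<Longrightarrow> x \<notin> \<Omega> \<Longrightarrow> 0 \<le> \<tau> \<Longrightarrow> norm k \<le> \<kappa> * \<tau> \<Longrightarrow>
       x + \<tau> *\<^sub>R d + k \<in> ball p R \<Longrightarrow> x + \<tau> *\<^sub>R d + k \<notin> \<Omega>"
    by (rule exterior_directions[OF \<Omega>(1) p]) (rule that)
  define \<rho> where "\<rho> = R / 4"
  have \<rho>: "0 < \<rho>" "4 * \<rho> = R" using R by (auto simp: \<rho>_def)
  have op: "open \<Omega>" using \<Omega>(1) by (simp add: lipschitz_domain_def)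
  obtain E where E: "0 < E" "\<And>M u h k. 0 < M \<Longrightarrow> bounded_source s \<Omega> M u \<Longrightarrow> norm h \<le> min (\<rho> / 2) (r / 4) \<Longrightarrow>
      (\<And>x. x \<notin> \<Omega> \<Longrightarrow> bump_shift p \<rho> h x \<notin> \<Omega>) \<Longrightarrow> norm k \<le> \<rho> / 2 \<Longrightarrow>
      (\<integral>\<^sup>+x. ennreal ((fdiff k (fdiff h u) x)\<^sup>2) * indicator (ball p (\<rho> / 2)) x \<partial>lborel)
        \<le> ennreal (E * M\<^sup>2 * norm k powr (2 * s) * norm h powr t)"
    using second_difference_near_point_cone[OF op \<Omega>(2) s t T \<rho>(1), of p] by blast
  define q0 where "q0 = min (\<rho> / 2) (r / 4)"
  \<comment> \<open>cone vectors for an increment of length \<open>q\<close> have length at most \<open>(2 / \<kappa>) * q = q0\<close>\<close>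
  define q where "q = \<kappa> * q0 / 2"
  have q0: "0 < q0" using \<rho> T by (simp add: q0_def)
  then have q: "0 < q" using \<kappa> by (simp add: q_def)
  have qq0: "q \<le> q0 / 2" using \<kappa> q0 by (simp add: q_def)
  have q0\<rho>: "q0 \<le> \<rho> / 2" by (simp add: q0_def)
  have cone: "(\<integral>\<^sup>+x. ennreal ((fdiff k (fdiff (\<tau> *\<^sub>R d + l) u) x)\<^sup>2) * indicator (ball p (\<rho> / 2)) x \<partial>lborel)
        \<le> ennreal (E * (2 / \<kappa>) * M\<^sup>2 * norm k powr (2 * s) * norm h powr t)"
    if M: "0 < M" and u: "bounded_source s \<Omega> M u" and h: "norm h \<le> q" and k: "norm k \<le> q"
      and \<tau>: "\<tau> = norm h / \<kappa>" and l: "norm l \<le> norm h" for M u h k \<tau> l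
  proof -
    have "norm (\<tau> *\<^sub>R d + l) \<le> norm h / \<kappa> + norm h"
      using norm_triangle_ineq[of "\<tau> *\<^sub>R d" l] l d \<kappa> by (simp add: \<tau>)
    also have "\<dots> \<le> 2 / \<kappa> * norm h" using \<kappa> by (simp add: field_simps mult_left_le_one_le)
    finally have n: "norm (\<tau> *\<^sub>R d + l) \<le> 2 / \<kappa> * norm h" .
    also have "\<dots> \<le> 2 / \<kappa> * q" using h \<kappa> by (intro mult_left_mono) auto
    also have "\<dots> = q0" using \<kappa> by (simp add: q_def)
    finally have n0: "norm (\<tau> *\<^sub>R d + l) \<le> q0" .
    have "(\<integral>\<^sup>+x. ennreal ((fdiff k (fdiff (\<tau> *\<^sub>R d + l) u) x)\<^sup>2) * indicator (ball p (\<rho> / 2)) x \<partial>lborel)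
        \<le> ennreal (E * M\<^sup>2 * norm k powr (2 * s) * norm (\<tau> *\<^sub>R d + l) powr t)"
    proof (rule E(2)[OF M u])
      show "norm (\<tau> *\<^sub>R d + l) \<le> min (\<rho> / 2) (r / 4)" using n0 by (simp add: q0_def)
      show "norm k \<le> \<rho> / 2" using k qq0 q0\<rho> q0 by linarith
      fix x assume "x \<notin> \<Omega>"
      then show "bump_shift p \<rho> (\<tau> *\<^sub>R d + l) x \<notin> \<Omega>"
        using n0 q0\<rho> \<kappa> l ext \<rho> by (intro bump_shift_exterior[of p \<rho> \<Omega> \<kappa>]) (auto simp: \<tau>)
    qed
    also have "norm (\<tau> *\<^sub>R d + l) powr t \<le> (2 / \<kappa> * norm h) powr t"
      using n t by (intro powr_mono2) auto
    also have "\<dots> = (2 / \<kappa>) powr t * norm h powr t"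
      using \<kappa> by (intro powr_mult)
    also have "(2 / \<kappa>) powr t \<le> (2 / \<kappa>) powr 1" using \<kappa> t by (intro powr_mono) auto
    also have "(2 / \<kappa>) powr 1 = 2 / \<kappa>" using \<kappa> by simp
    finally show ?thesis
      using E(1) \<kappa> M by (simp add: mult_ac mult_left_mono mult_right_mono ennreal_leI)
  qed
  have main: "(\<integral>\<^sup>+x. ennreal ((fdiff k (fdiff h u) x)\<^sup>2) * indicator (ball p q) x \<partial>lborel)
        \<le> ennreal (4 * (E * (2 / \<kappa>)) * M\<^sup>2 * norm k powr (2 * s) * norm h powr t)"
    if M: "0 < M" and u: "bounded_source s \<Omega> M u" and h: "norm h \<le> q" and k: "norm k \<le> q" for M u h k
  proof -
    have um [measurable]: "u \<in> borel_measurable borel" using u by (simp add: bounded_source_def energy_class_def)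
    \<comment> \<open>\<open>h = h1 - h2\<close> with both vectors in the cone; the zero keeps the shape of the cone statement\<close>
    define h2 where "h2 = (norm h / \<kappa>) *\<^sub>R d + 0"
    define h1 where "h1 = (norm h / \<kappa>) *\<^sub>R d + h"
    have h2n: "norm h2 \<le> \<rho> / 4"
    proof -
      have "norm h2 = norm h / \<kappa>" using d \<kappa> by (simp add: h2_def)
      also have "\<dots> \<le> q / \<kappa>" using h \<kappa> by (intro divide_right_mono) auto
      also have "\<dots> = q0 / 2" using \<kappa> by (simp add: q_def)
      finally show ?thesis using q0\<rho> by linarith
    qed
    define f1 where "f1 = fdiff k (fdiff h1 u)"
    define f2 where "f2 = fdiff k (fdiff h2 u)"
    have [measurable]: "f1 \<in> borel_measurable borel" "f2 \<in> borel_measurable borel"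
      unfolding f1_def f2_def by measurable
    have [measurable]: "ball p (\<rho> / 2) \<in> sets borel" by simp
    define F where "F y = 2 * (ennreal ((f1 y)\<^sup>2) * indicator (ball p (\<rho> / 2)) y)
        + 2 * (ennreal ((f2 y)\<^sup>2) * indicator (ball p (\<rho> / 2)) y)" for y
    have Fm: "F \<in> borel_measurable borel" unfolding F_def by measurable
    have pt: "ennreal ((fdiff k (fdiff h u) x)\<^sup>2) * indicator (ball p q) x \<le> F (x + (- h2))" for x
    proof (cases "x \<in> ball p q")
      case True
      have "norm (x - p) < \<rho> / 4"
        using True qq0 q0\<rho> by (simp add: dist_norm norm_minus_commute)
      then have "norm (x - h2 - p) < \<rho> / 2"
        using norm_triangle_ineq4[of "x - p" h2] h2n by (simp add: algebra_simps)
      then have i: "x + - h2 \<in> ball p (\<rho> / 2)" by (simp add: dist_norm norm_minus_commute)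
      have "fdiff k (fdiff h u) x = f1 (x + - h2) - f2 (x + - h2)"
        by (simp add: f1_def f2_def fdiff_def h1_def h2_def algebra_simps)
      then have "(fdiff k (fdiff h u) x)\<^sup>2 \<le> 2 * (f1 (x + - h2))\<^sup>2 + 2 * (f2 (x + - h2))\<^sup>2"
        by (simp only: power2_diff_le)
      then have "ennreal ((fdiff k (fdiff h u) x)\<^sup>2) \<le> ennreal (2 * (f1 (x + - h2))\<^sup>2 + 2 * (f2 (x + - h2))\<^sup>2)"
        by (rule ennreal_leI)
      then show ?thesis using True i by (simp add: F_def ennreal_plus ennreal_mult)
    qed simp
    have "(\<integral>\<^sup>+x. ennreal ((fdiff k (fdiff h u) x)\<^sup>2) * indicator (ball p q) x \<partial>lborel)
        \<le> (\<integral>\<^sup>+x. F (x + (- h2)) \<partial>lborel)" by (intro nn_integral_mono pt)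
    also have "\<dots> = (\<integral>\<^sup>+x. F x \<partial>lborel)" by (rule nn_integral_translate[OF Fm])
    also have "\<dots> = 2 * (\<integral>\<^sup>+y. ennreal ((f1 y)\<^sup>2) * indicator (ball p (\<rho> / 2)) y \<partial>lborel)
        + 2 * (\<integral>\<^sup>+y. ennreal ((f2 y)\<^sup>2) * indicator (ball p (\<rho> / 2)) y \<partial>lborel)"
      unfolding F_def by (subst nn_integral_add) (auto simp: nn_integral_cmult)
    also have "\<dots> \<le> 2 * ennreal (E * (2 / \<kappa>) * M\<^sup>2 * norm k powr (2 * s) * norm h powr t)
        + 2 * ennreal (E * (2 / \<kappa>) * M\<^sup>2 * norm k powr (2 * s) * norm h powr t)"
      unfolding f1_def f2_def h1_def h2_def
      by (intro add_mono mult_left_mono cone[OF M u h k refl]) auto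
    also have "\<dots> = ennreal (4 * (E * (2 / \<kappa>)) * M\<^sup>2 * norm k powr (2 * s) * norm h powr t)"
    proof -
      have "2 * ennreal a + 2 * ennreal a = ennreal (4 * a)" if "0 \<le> a" for a
        using that by (simp add: ennreal_mult distrib_right[symmetric])
      from this[of "E * (2 / \<kappa>) * M\<^sup>2 * norm k powr (2 * s) * norm h powr t"] show ?thesis
        using E(1) \<kappa> by (simp add: mult_ac)
    qed
    finally show ?thesis .
  qed
  have "0 < 4 * (E * (2 / \<kappa>))" using E(1) \<kappa> by simp
  then show ?thesis
    by (intro exI[of _ q] conjI q exI[of _ "4 * (E * (2 / \<kappa>))"] allI impI main)
qed

text \<open>A finite subcover of the compact closure; for small increments the second difference is supported in
  the union of the balls, since \<open>u\<close> vanishes outside \<open>\<Omega>\<close>.\<close>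

lemma second_difference_bound:
  fixes \<Omega> :: "'a::euclidean_space set"
  assumes \<Omega>: "lipschitz_domain \<Omega>" "bounded \<Omega>" and s: "0 < s" "s \<le> 1" and t: "0 \<le> t" "t \<le> 1"
    and T: "translate_bound s \<Omega> t A r" "0 \<le> A" "0 < r" "r \<le> 1"
  shows "\<exists>B>0. \<exists>q>0. q \<le> 1 \<and> second_bound s \<Omega> t B q"
proof -
  define Q where "Q p z \<longleftrightarrow> 0 < fst z \<and> 0 < snd z \<and> (\<forall>M>0. \<forall>u. bounded_source s \<Omega> M u \<longrightarrow>
      (\<forall>h k. norm h \<le> fst z \<longrightarrow> norm k \<le> fst z \<longrightarrow>
      (\<integral>\<^sup>+x. ennreal ((fdiff k (fdiff h u) x)\<^sup>2) * indicator (ball p (fst z)) x \<partial>lborel)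
        \<le> ennreal (snd z * M\<^sup>2 * norm k powr (2 * s) * norm h powr t)))" for p :: 'a and z :: "real \<times> real"
  have "\<forall>p\<in>closure \<Omega>. \<exists>z. Q p z"
  proof
    fix p assume p: "p \<in> closure \<Omega>"
    show "\<exists>z. Q p z"
      using second_difference_near_point[OF \<Omega> s t T p]
      unfolding Q_def split_paired_Ex fst_conv snd_conv by (elim exE conjE) (intro exI conjI)
  qed
  from bchoice[OF this] obtain z where z: "\<And>p. p \<in> closure \<Omega> \<Longrightarrow> Q p (z p)" by (elim exE) (rule that, rule bspec)
  define q where "q p = fst (z p)" for p
  define B where "B p = snd (z p)" for p
  have qB: "0 < q p" "0 < B p" if "p \<in> closure \<Omega>" for p
    using z[OF that] by (auto simp: Q_def q_def B_def)
  have bd: "(\<integral>\<^sup>+x. ennreal ((fdiff k (fdiff h u) x)\<^sup>2) * indicator (ball p (q p)) x \<partial>lborel)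
        \<le> ennreal (B p * M\<^sup>2 * norm k powr (2 * s) * norm h powr t)"
    if p: "p \<in> closure \<Omega>" and M: "0 < M" and u: "bounded_source s \<Omega> M u" and h: "norm h \<le> q p" and k: "norm k \<le> q p"
    for p M u h k
    using z[OF p] M u h k unfolding Q_def q_def B_def by simp
  have "compact (closure \<Omega>)" using \<Omega>(2) by (simp add: compact_closure)
  then obtain P where P: "P \<subseteq> closure \<Omega>" "finite P" "closure \<Omega> \<subseteq> (\<Union>p\<in>P. ball p (q p / 2))"
  proof (rule compactE_image[of "closure \<Omega>" "closure \<Omega>" "\<lambda>p. ball p (q p / 2)"])
    show "closure \<Omega> \<subseteq> (\<Union>p\<in>closure \<Omega>. ball p (q p / 2))" using qB(1) by force
  qed auto
  define q0 where "q0 = Min (insert 1 ((\<lambda>p. q p / 4) ` P))"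
  have q0: "0 < q0" "q0 \<le> 1"
    unfolding q0_def using P qB(1) by (auto intro!: Min_gr_iff[THEN iffD2])
  have q0P: "q0 \<le> q p / 4" if "p \<in> P" for p
    unfolding q0_def using P(2) that by (intro Min_le) auto
  define B0 where "B0 = 1 + (\<Sum>p\<in>P. B p)"
  have BP: "0 \<le> (\<Sum>p\<in>P. B p)" using qB(2) P by (intro sum_nonneg) (auto simp: less_imp_le)
  have "l2sq (fdiff k (fdiff h u)) \<le> ennreal (B0 * M\<^sup>2 * norm k powr (2 * s) * norm h powr t)"
    if M: "0 < M" and u: "bounded_source s \<Omega> M u" and h: "norm h \<le> q0" and k: "norm k \<le> q0" for M u h k
  proof -
    have um [measurable]: "u \<in> borel_measurable borel" using u by (simp add: bounded_source_def energy_class_def)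
    have u0: "u x = 0" if "x \<notin> \<Omega>" for x using u that by (simp add: bounded_source_def energy_class_def)
    have [measurable]: "ball p (q p) \<in> sets borel" for p by simp
    let ?f = "fdiff k (fdiff h u)"
    have pt: "ennreal ((?f x)\<^sup>2) \<le> (\<Sum>p\<in>P. ennreal ((?f x)\<^sup>2) * indicator (ball p (q p)) x)" for x
    proof (cases "?f x = 0")
      case False
      have "x \<in> \<Omega> \<or> x + h \<in> \<Omega> \<or> x + k \<in> \<Omega> \<or> x + k + h \<in> \<Omega>"
      proof (rule ccontr)
        assume "\<not> ?thesis"
        then show False using u0 False by (simp add: fdiff_def)
      qed
      moreover have "norm (k + h) \<le> 2 * q0" using norm_triangle_ineq[of k h] h k by linarith
      ultimately obtain y where y: "y \<in> \<Omega>" "dist x y \<le> 2 * q0"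
        using h k q0(1) by (auto simp: dist_norm norm_minus_commute add.assoc)
      then have "y \<in> closure \<Omega>" using closure_subset by blast
      then obtain p where p: "p \<in> P" "y \<in> ball p (q p / 2)" using P(3) by blast
      have "dist p x < q p"
        using dist_triangle[of p x y] p y(2) q0P[OF p(1)] by (simp add: dist_commute)
      then have "ennreal ((?f x)\<^sup>2) = ennreal ((?f x)\<^sup>2) * indicator (ball p (q p)) x" by simp
      also have "\<dots> \<le> (\<Sum>p\<in>P. ennreal ((?f x)\<^sup>2) * indicator (ball p (q p)) x)"
        using P(2) p(1) by (intro member_le_sum) auto
      finally show ?thesis .
    qed simp
    have "l2sq ?f \<le> (\<integral>\<^sup>+x. (\<Sum>p\<in>P. ennreal ((?f x)\<^sup>2) * indicator (ball p (q p)) x) \<partial>lborel)"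
      unfolding l2sq_def by (intro nn_integral_mono pt)
    also have "\<dots> = (\<Sum>p\<in>P. \<integral>\<^sup>+x. ennreal ((?f x)\<^sup>2) * indicator (ball p (q p)) x \<partial>lborel)"
      by (intro nn_integral_sum) measurable
    also have "\<dots> \<le> (\<Sum>p\<in>P. ennreal (B p * M\<^sup>2 * norm k powr (2 * s) * norm h powr t))"
    proof (rule sum_mono)
      fix p assume p: "p \<in> P"
      then have "p \<in> closure \<Omega>" using P by auto
      moreover have "norm h \<le> q p" "norm k \<le> q p" using q0P[OF p] q0(1) h k by linarith+
      ultimately show "(\<integral>\<^sup>+x. ennreal ((?f x)\<^sup>2) * indicator (ball p (q p)) x \<partial>lborel)
        \<le> ennreal (B p * M\<^sup>2 * norm k powr (2 * s) * norm h powr t)"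
        using M u by (intro bd) auto
    qed
    also have "\<dots> = ennreal (\<Sum>p\<in>P. B p * M\<^sup>2 * norm k powr (2 * s) * norm h powr t)"
      using P qB(2) by (intro sum_ennreal) (auto intro!: mult_nonneg_nonneg less_imp_le[OF qB(2)])
    also have "(\<Sum>p\<in>P. B p * M\<^sup>2 * norm k powr (2 * s) * norm h powr t)
        = (\<Sum>p\<in>P. B p) * M\<^sup>2 * norm k powr (2 * s) * norm h powr t"
      by (simp add: sum_distrib_right)
    also have "\<dots> \<le> B0 * M\<^sup>2 * norm k powr (2 * s) * norm h powr t"
      by (intro mult_right_mono) (auto simp: B0_def)
    finally show ?thesis by (simp add: ennreal_leI)
  qed
  moreover have "0 < B0" using BP by (simp add: B0_def)
  ultimately show ?thesis using q0 unfolding second_bound_def by blast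
qed

section \<open>Bootstrap of the translation modulus\<close>

lemma l2sq_cmult:
  fixes f :: "'a::euclidean_space \<Rightarrow> real"
  assumes [measurable]: "f \<in> borel_measurable borel"
  shows "l2sq (\<lambda>x. c * f x) = ennreal (c\<^sup>2) * l2sq f"
  unfolding l2sq_def by (simp add: power_mult_distrib ennreal_mult nn_integral_cmult)

text \<open>The triangle inequality with constant one. The constant matters in the halving argument that follows,
  where the factor \<open>1 / 2\<close> must not be lost.\<close>

lemma l2sq_minkowski:
  fixes f g :: "'a::euclidean_space \<Rightarrow> real"
  assumes [measurable]: "f \<in> borel_measurable borel" "g \<in> borel_measurable borel"
    and f: "l2sq f \<le> ennreal (a\<^sup>2)" "0 \<le> a" and g: "l2sq g \<le> ennreal (b\<^sup>2)" "0 \<le> b"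
  shows "l2sq (\<lambda>x. f x + g x) \<le> ennreal ((a + b)\<^sup>2)"
proof -
  \<comment> \<open>strictly larger bounds are positive and may be used as divisors; they are decreased to \<open>a\<close> and \<open>b\<close> afterwards\<close>
  have pos: "l2sq (\<lambda>x. f x + g x) \<le> ennreal ((\<alpha> + \<beta>)\<^sup>2)" if "a < \<alpha>" "b < \<beta>" for \<alpha> \<beta>
  proof -
    have p: "0 < \<alpha>" "0 < \<beta>" using that f(2) g(2) by auto
    \<comment> \<open>the weights for which \<open>(a + b)\<^sup>2 \<le> c * a\<^sup>2 + d * b\<^sup>2\<close> is an equality at \<open>a / b = \<alpha> / \<beta>\<close>\<close>
    define c where "c = 1 + \<beta> / \<alpha>"
    define d where "d = 1 + \<alpha> / \<beta>"
    have cd: "0 < c" "0 < d" unfolding c_def d_def using p by (auto intro!: add_pos_pos)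
    have "l2sq (\<lambda>x. f x + g x) \<le> (\<integral>\<^sup>+x. ennreal c * ennreal ((f x)\<^sup>2) + ennreal d * ennreal ((g x)\<^sup>2) \<partial>lborel)"
      unfolding l2sq_def
    proof (rule nn_integral_mono)
      fix x
      have "0 \<le> (\<beta> * f x - \<alpha> * g x)\<^sup>2 / (\<alpha> * \<beta>)" using p by simp
      also have "\<dots> = c * (f x)\<^sup>2 + d * (g x)\<^sup>2 - (f x + g x)\<^sup>2"
        using p by (simp add: c_def d_def field_simps power2_eq_square)
      finally have "(f x + g x)\<^sup>2 \<le> c * (f x)\<^sup>2 + d * (g x)\<^sup>2" by simp
      then have "ennreal ((f x + g x)\<^sup>2) \<le> ennreal (c * (f x)\<^sup>2 + d * (g x)\<^sup>2)" by (rule ennreal_leI)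
      then show "ennreal ((f x + g x)\<^sup>2) \<le> ennreal c * ennreal ((f x)\<^sup>2) + ennreal d * ennreal ((g x)\<^sup>2)"
        using cd by (simp add: ennreal_plus ennreal_mult)
    qed
    also have "\<dots> = ennreal c * l2sq f + ennreal d * l2sq g"
      unfolding l2sq_def by (subst nn_integral_add) (auto simp: nn_integral_cmult)
    also have "\<dots> \<le> ennreal c * ennreal (\<alpha>\<^sup>2) + ennreal d * ennreal (\<beta>\<^sup>2)"
    proof (intro add_mono mult_left_mono)
      have "ennreal (a\<^sup>2) \<le> ennreal (\<alpha>\<^sup>2)" "ennreal (b\<^sup>2) \<le> ennreal (\<beta>\<^sup>2)"
        using that f(2) g(2) by (auto intro!: ennreal_leI power_mono)
      then show "l2sq f \<le> ennreal (\<alpha>\<^sup>2)" "l2sq g \<le> ennreal (\<beta>\<^sup>2)"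
        using f(1) g(1) by (meson order_trans)+
    qed auto
    also have "\<dots> = ennreal (c * \<alpha>\<^sup>2 + d * \<beta>\<^sup>2)" using cd by (simp add: ennreal_mult ennreal_plus)
    also have "c * \<alpha>\<^sup>2 + d * \<beta>\<^sup>2 = (\<alpha> + \<beta>)\<^sup>2"
      using p by (simp add: c_def d_def field_simps power2_eq_square)
    finally show ?thesis .
  qed
  have "((\<lambda>e. ennreal (((a + e) + (b + e))\<^sup>2)) \<longlongrightarrow> ennreal (((a + 0) + (b + 0))\<^sup>2)) (at_right 0)"
    by (intro tendsto_ennrealI tendsto_intros)
  moreover have "eventually (\<lambda>e. l2sq (\<lambda>x. f x + g x) \<le> ennreal (((a + e) + (b + e))\<^sup>2)) (at_right 0)"
    unfolding eventually_at_right_field by (intro exI[of _ 1] conjI allI impI pos) auto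
  ultimately have "l2sq (\<lambda>x. f x + g x) \<le> ennreal (((a + 0) + (b + 0))\<^sup>2)"
    by (intro tendsto_lowerbound[of _ _ "at_right 0"]) auto
  then show ?thesis by simp
qed

lemma l2sq_fdiff_le:
  fixes u :: "'a::euclidean_space \<Rightarrow> real"
  assumes u [measurable]: "u \<in> borel_measurable borel" and a: "l2sq u \<le> ennreal a" "0 \<le> a"
  shows "l2sq (fdiff h u) \<le> ennreal (4 * a)"
proof -
  have "l2sq (fdiff h u) \<le> 2 * l2sq (\<lambda>x. u (x + h)) + 2 * l2sq u"
    unfolding fdiff_def by (intro l2sq_diff_le) auto
  also have "l2sq (\<lambda>x. u (x + h)) = l2sq u"
    unfolding l2sq_def by (rule nn_integral_translate[where F="\<lambda>x. ennreal ((u x)\<^sup>2)"]) measurable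
  also have "2 * l2sq u + 2 * l2sq u = 4 * l2sq u" by (simp add: distrib_right[symmetric])
  also have "\<dots> \<le> 4 * ennreal a" by (intro mult_left_mono a) simp
  also have "\<dots> = ennreal (4 * a)" using a by (simp add: ennreal_mult)
  finally show ?thesis .
qed

text \<open>First differences from second ones, by
  \<open>fdiff h u = (fdiff (2 * h) u - fdiff h (fdiff h u)) / 2\<close>, iterated upwards until \<open>2\<^sup>k * h\<close>
  reaches unit size. The comparison function \<open>X\<close> is any supersolution of the resulting recursion.\<close>

lemma marchaud:
  fixes u :: "'a::euclidean_space \<Rightarrow> real"
  assumes u [measurable]: "u \<in> borel_measurable borel" and r: "0 < r"
    and K: "\<And>h. l2sq (fdiff h u) \<le> ennreal (K\<^sup>2)" "0 \<le> K"
    and Y: "\<And>h. norm h \<le> r \<Longrightarrow> l2sq (fdiff h (fdiff h u)) \<le> ennreal ((Y (norm h))\<^sup>2)"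
      "\<And>\<rho>. 0 < \<rho> \<Longrightarrow> 0 \<le> Y \<rho>"
    and X: "\<And>\<rho>. r / 2 < \<rho> \<Longrightarrow> \<rho> \<le> r \<Longrightarrow> K \<le> X \<rho>"
      "\<And>\<rho>. 0 < \<rho> \<Longrightarrow> \<rho> \<le> r \<Longrightarrow> 0 \<le> X \<rho>"
      "\<And>\<rho>. 0 < \<rho> \<Longrightarrow> \<rho> \<le> r / 2 \<Longrightarrow> (X (2 * \<rho>) + Y \<rho>) / 2 \<le> X \<rho>"
    and h: "h \<noteq> 0" "norm h \<le> r"
  shows "l2sq (fdiff h u) \<le> ennreal ((X (norm h))\<^sup>2)"
proof -
  have "l2sq (fdiff h u) \<le> ennreal ((X (norm h))\<^sup>2)" if "h \<noteq> 0" "norm h \<le> r" "r / 2 ^ n < norm h" for n h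
    using that
  proof (induction n arbitrary: h)
    case (Suc n)
    have hp: "0 < norm h" using Suc.prems by simp
    show ?case
    proof (cases "r / 2 < norm h")
      case True
      have "K\<^sup>2 \<le> (X (norm h))\<^sup>2" using True K(2) Suc.prems by (intro power_mono X(1)) auto
      then show ?thesis using K(1)[of h] by (meson ennreal_leI order_trans)
    next
      case False
      have n2: "norm (2 *\<^sub>R h) = 2 * norm h" by simp
      have "l2sq (fdiff (2 *\<^sub>R h) u) \<le> ennreal ((X (norm (2 *\<^sub>R h)))\<^sup>2)"
        using Suc.prems False n2 by (intro Suc.IH) (auto simp: field_simps)
      then have 1: "l2sq (\<lambda>x. 1/2 * fdiff (2 *\<^sub>R h) u x) \<le> ennreal ((X (2 * norm h) / 2)\<^sup>2)"
        unfolding l2sq_cmult[OF fdiff_measurable[OF u]] n2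
        by (simp add: power_divide mult_left_mono ennreal_mult[symmetric] divide_ennreal_def
            order_trans[OF mult_left_mono])
      have "l2sq (fdiff h (fdiff h u)) \<le> ennreal ((Y (norm h))\<^sup>2)" using Suc.prems by (intro Y)
      then have "ennreal ((-1/2)\<^sup>2) * l2sq (fdiff h (fdiff h u)) \<le> ennreal ((-1/2)\<^sup>2) * ennreal ((Y (norm h))\<^sup>2)"
        by (intro mult_left_mono) auto
      then have 2: "l2sq (\<lambda>x. -1/2 * fdiff h (fdiff h u) x) \<le> ennreal ((Y (norm h) / 2)\<^sup>2)"
        by (subst l2sq_cmult) (auto simp: power_divide ennreal_mult[symmetric])
      have "fdiff h u = (\<lambda>x. 1/2 * fdiff (2 *\<^sub>R h) u x + -1/2 * fdiff h (fdiff h u) x)"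
        by (rule ext) (simp add: fdiff_def scaleR_2 add.assoc field_simps)
      then have "l2sq (fdiff h u) = l2sq (\<lambda>x. 1/2 * fdiff (2 *\<^sub>R h) u x + -1/2 * fdiff h (fdiff h u) x)"
        by (rule arg_cong)
      also have "\<dots> \<le> ennreal ((X (2 * norm h) / 2 + Y (norm h) / 2)\<^sup>2)"
        using False hp X(2)[of "2 * norm h"] Y(2)[OF hp] by (intro l2sq_minkowski 1 2) auto
      also have "\<dots> \<le> ennreal ((X (norm h))\<^sup>2)"
        using False hp X(2)[of "2 * norm h"] Y(2)[OF hp] X(3)[of "norm h"]
        by (intro ennreal_leI power_mono) (auto simp: add_divide_distrib)
      finally show ?thesis .
    qed
  qed simp
  moreover obtain n where "r / norm h < 2 ^ n" using real_arch_pow[of 2 "r / norm h"] by auto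
  then have "r / 2 ^ n < norm h" using h by (simp add: field_simps)
  ultimately show ?thesis using h by blast
qed

text \<open>For an exponent below one the supersolution in the Marchaud inequality is a multiple of the power
  itself. For an exponent \<open>\<theta> > 1\<close> of the second difference it is \<open>Q * \<rho> - D * \<rho> powr \<theta>\<close>,
  where the negative term absorbs the inhomogeneity, and first differences are of order one.\<close>

lemma bootstrap_step:
  fixes \<Omega> :: "'a::euclidean_space set"
  assumes \<Omega>: "lipschitz_domain \<Omega>" "bounded \<Omega>" and s: "0 < s" "s \<le> 1" and t: "0 \<le> t" "t \<le> 1"
    and T: "translate_bound s \<Omega> t A r" "0 \<le> A" "0 < r" "r \<le> 1"
    and t': "0 \<le> t'" "t' \<le> s + t / 2 \<and> t' < 1 \<or> 1 < s + t / 2 \<and> t' = 1"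
  shows "\<exists>A>0. \<exists>r>0. r \<le> 1 \<and> translate_bound s \<Omega> t' A r"
proof -
  have op: "open \<Omega>" using \<Omega>(1) by (simp add: lipschitz_domain_def)
  obtain C where C: "C > 0" "\<And>M u. 0 < M \<Longrightarrow> bounded_source s \<Omega> M u \<Longrightarrow> l2sq u \<le> ennreal (C * M\<^sup>2)"
    using a_priori_bounds[OF op \<Omega>(2) s] by blast
  obtain B q where B: "0 < B" and q: "0 < q" "q \<le> 1" and S: "second_bound s \<Omega> t B q"
    using second_difference_bound[OF \<Omega> s t T] by blast
  define \<theta> where "\<theta> = s + t / 2"
  define b where "b = sqrt B"
  define k where "k = 2 * sqrt C"
  have b: "0 < b" and k: "0 < k" using B C by (auto simp: b_def k_def)
  obtain X Z :: "real \<Rightarrow> real" and Q :: real where Q: "0 < Q"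
    and X1: "\<And>\<rho>. q / 2 < \<rho> \<Longrightarrow> \<rho> \<le> q \<Longrightarrow> k \<le> X \<rho>"
    and X2: "\<And>\<rho>. 0 < \<rho> \<Longrightarrow> \<rho> \<le> q \<Longrightarrow> 0 \<le> X \<rho>"
    and X3: "\<And>\<rho>. 0 < \<rho> \<Longrightarrow> \<rho> \<le> q / 2 \<Longrightarrow> (X (2 * \<rho>) + b * \<rho> powr \<theta>) / 2 \<le> X \<rho>"
    and X4: "\<And>\<rho>. 0 < \<rho> \<Longrightarrow> \<rho> \<le> q \<Longrightarrow> X \<rho> \<le> Q * \<rho> powr t'"
  proof (cases "1 < \<theta> \<and> t' = 1")
    case True
    then have \<theta>: "1 < \<theta>" by simp
    define e where "e = 2 powr (\<theta> - 1) - (1::real)"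
    have e: "0 < e" using \<theta> by (simp add: e_def)
    \<comment> \<open>the smallest \<open>D\<close> for which the negative term absorbs \<open>b * \<rho> powr \<theta>\<close>\<close>
    define D where "D = b / (2 * e)"
    define Q where "Q = 2 * (k + D) / q"
    have D: "0 < D" using b e by (simp add: D_def)
    have Q0: "0 < Q" using k D q by (simp add: Q_def)
    have "D + D \<le> Q * 1"
    proof -
      have "(2 * (k + D)) * 1 \<le> (2 * (k + D)) * (1 / q)" using q k D by (intro mult_left_mono) auto
      then show ?thesis using k by (simp add: Q_def)
    qed
    then have QD: "2 * D \<le> Q" by simp
    have le: "\<rho> powr \<theta> \<le> \<rho>" if "0 < \<rho>" "\<rho> \<le> 1" for \<rho> :: real
    proof -
      have "\<rho> powr \<theta> \<le> \<rho> powr 1" using that \<theta> by (intro powr_mono') auto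
      then show ?thesis using that by simp
    qed
    show ?thesis
    proof (rule that[of Q "\<lambda>\<rho>. Q * \<rho> - D * \<rho> powr \<theta>"])
      show "0 < Q" by (rule Q0)
      fix \<rho> :: real
      { assume \<rho>: "q / 2 < \<rho>" "\<rho> \<le> q"
        have "k + D = Q * (q / 2)" using q by (simp add: Q_def)
        also have "\<dots> \<le> Q * \<rho>" using \<rho> Q0 by (intro mult_left_mono) auto
        finally have "k + D \<le> Q * \<rho>" .
        moreover have "\<rho> powr \<theta> \<le> 1" using le[of \<rho>] \<rho> q by linarith
        then have "D * \<rho> powr \<theta> \<le> D * 1" using D by (intro mult_left_mono) auto
        ultimately show "k \<le> Q * \<rho> - D * \<rho> powr \<theta>" by simp }
      { assume \<rho>: "0 < \<rho>" "\<rho> \<le> q"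
        have "D * \<rho> powr \<theta> \<le> Q * \<rho>" using le[of \<rho>] \<rho> q D QD by (intro mult_mono) auto
        then show "0 \<le> Q * \<rho> - D * \<rho> powr \<theta>" by simp
        show "Q * \<rho> - D * \<rho> powr \<theta> \<le> Q * \<rho> powr t'" using True \<rho> D by simp }
      { assume \<rho>: "0 < \<rho>" "\<rho> \<le> q / 2"
        have "(2 * \<rho>) powr \<theta> = 2 * (1 + e) * \<rho> powr \<theta>"
          using \<rho> by (simp add: powr_mult e_def powr_diff)
        then show "(Q * (2 * \<rho>) - D * (2 * \<rho>) powr \<theta> + b * \<rho> powr \<theta>) / 2 \<le> Q * \<rho> - D * \<rho> powr \<theta>"
          using e by (simp add: D_def field_simps) }
    qed
  next
    case False
    then have t'': "t' < 1" "t' \<le> \<theta>" using t' by (auto simp: \<theta>_def)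
    define e where "e = 1 - 2 powr (t' - 1 :: real)"
    have e: "0 < e" using t'' powr_less_mono[of "t' - 1" 0 2] by (simp add: e_def)
    define Q where "Q = b / (2 * e) + k / (q / 2) powr t'"
    have qp: "0 < (q / 2) powr t'" using q by simp
    have Q0: "0 < Q" unfolding Q_def using b e k qp by (intro add_pos_pos) auto
    show ?thesis
    proof (rule that[of Q "\<lambda>\<rho>. Q * \<rho> powr t'"])
      show "0 < Q" by (rule Q0)
      fix \<rho> :: real
      { assume \<rho>: "q / 2 < \<rho>" "\<rho> \<le> q"
        have "k = k / (q / 2) powr t' * (q / 2) powr t'" using qp by simp
        also have "\<dots> \<le> Q * \<rho> powr t'"
          using \<rho> q t' k b e Q0 by (intro mult_mono powr_mono2) (auto simp: Q_def)
        finally show "k \<le> Q * \<rho> powr t'" . }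
      { assume \<rho>: "0 < \<rho>" "\<rho> \<le> q"
        show "0 \<le> Q * \<rho> powr t'" using Q0 by simp
        show "Q * \<rho> powr t' \<le> Q * \<rho> powr t'" by simp }
      { assume \<rho>: "0 < \<rho>" "\<rho> \<le> q / 2"
        have 1: "(2 * \<rho>) powr t' = 2 * (1 - e) * \<rho> powr t'"
          using \<rho> by (simp add: powr_mult e_def powr_diff)
        have "\<rho> powr \<theta> \<le> \<rho> powr t'" using \<rho> q t'' by (intro powr_mono') auto
        then have "b * \<rho> powr \<theta> \<le> b * \<rho> powr t'" using b by (intro mult_left_mono) auto
        also have "b * \<rho> powr t' = b / (2 * e) * (2 * e) * \<rho> powr t'" using e by simp
        also have "b / (2 * e) * (2 * e) * \<rho> powr t' \<le> Q * (2 * e) * \<rho> powr t'"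
          using e k qp by (intro mult_right_mono) (auto simp: Q_def)
        finally show "(Q * (2 * \<rho>) powr t' + b * \<rho> powr \<theta>) / 2 \<le> Q * \<rho> powr t'"
          unfolding 1 by (simp add: algebra_simps) }
    qed
  qed
  have "translate_bound s \<Omega> t' (Q\<^sup>2) q"
    unfolding translate_bound_def
  proof (intro allI impI)
    fix M u and h :: 'a assume M: "(0::real) < M" and u: "bounded_source s \<Omega> M u" and h: "norm h \<le> q"
    have um [measurable]: "u \<in> borel_measurable borel" using u by (simp add: bounded_source_def energy_class_def)
    show "l2sq (fdiff h u) \<le> ennreal (Q\<^sup>2 * M\<^sup>2 * norm h powr (2 * t'))"
    proof (cases "h = 0")
      case True
      then show ?thesis by (simp add: fdiff_def l2sq_def)
    next
      case False
      have "l2sq (fdiff h u) \<le> ennreal ((M * X (norm h))\<^sup>2)"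
      proof (rule marchaud[OF um q(1), where X="\<lambda>\<rho>. M * X \<rho>" and Y="\<lambda>\<rho>. M * (b * \<rho> powr \<theta>)" and K="M * k"])
        fix h :: 'a
        have "l2sq (fdiff h u) \<le> ennreal (4 * (C * M\<^sup>2))"
          using C M u by (intro l2sq_fdiff_le[OF um]) auto
        then show "l2sq (fdiff h u) \<le> ennreal ((M * k)\<^sup>2)"
          using C by (simp add: k_def power_mult_distrib mult_ac)
        assume "norm h \<le> q"
        then have "l2sq (fdiff h (fdiff h u)) \<le> ennreal (B * M\<^sup>2 * norm h powr (2 * s) * norm h powr t)"
          using S M u by (simp add: second_bound_def)
        also have "B * M\<^sup>2 * norm h powr (2 * s) * norm h powr t = (M * (b * norm h powr \<theta>))\<^sup>2"
        proof -
          have "norm h powr \<theta> * norm h powr \<theta> = norm h powr (2 * s) * norm h powr t"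
            by (simp add: powr_add[symmetric] \<theta>_def algebra_simps)
          moreover have "b * b = B" using B by (simp add: b_def)
          ultimately show ?thesis by (simp add: power2_eq_square mult_ac)
        qed
        finally show "l2sq (fdiff h (fdiff h u)) \<le> ennreal ((M * (b * norm h powr \<theta>))\<^sup>2)" .
      next
        fix \<rho> :: real assume "0 < \<rho>" "\<rho> \<le> q / 2"
        then have "M * ((X (2 * \<rho>) + b * \<rho> powr \<theta>) / 2) \<le> M * X \<rho>"
          using M by (intro mult_left_mono X3) auto
        then show "(M * X (2 * \<rho>) + M * (b * \<rho> powr \<theta>)) / 2 \<le> M * X \<rho>"
          by (simp add: algebra_simps)
      qed (use M k b X1 X2 False h in auto)
      also have "\<dots> \<le> ennreal ((M * (Q * norm h powr t'))\<^sup>2)"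
        using M X2[of "norm h"] X4[of "norm h"] False h
        by (intro ennreal_leI power_mono mult_left_mono mult_nonneg_nonneg) auto
      also have "(M * (Q * norm h powr t'))\<^sup>2 = Q\<^sup>2 * M\<^sup>2 * norm h powr (2 * t')"
        using powr_add[of "norm h" t' t'] by (simp add: power2_eq_square mult_ac)
      finally show ?thesis .
    qed
  qed
  then show ?thesis using q Q by (intro exI[of _ "Q\<^sup>2"] conjI exI[of _ q]) auto
qed

lemma translate_bound_initial:
  fixes \<Omega> :: "'a::euclidean_space set"
  assumes \<Omega>: "lipschitz_domain \<Omega>" "bounded \<Omega>" and s: "0 < s" "s \<le> 1"
  shows "\<exists>A>0. \<exists>r>0. r \<le> 1 \<and> translate_bound s \<Omega> s A r"
proof -
  have op: "open \<Omega>" using \<Omega>(1) by (simp add: lipschitz_domain_def)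
  obtain C where C: "C > 0" "\<And>M u. 0 < M \<Longrightarrow> bounded_source s \<Omega> M u \<Longrightarrow> gag_form s u u \<le> C * M\<^sup>2"
    using a_priori_bounds[OF op \<Omega>(2) s] by blast
  define C2 where "C2 = shift_const TYPE('a)"
  have C2: "0 < C2" unfolding C2_def by (rule shift_const_pos)
  have "l2sq (fdiff h u) \<le> ennreal (C2 * C * M\<^sup>2 * norm h powr (2 * s))"
    if M: "0 < M" and u: "bounded_source s \<Omega> M u" for M u h
  proof -
    have un: "u \<in> energy_class s \<Omega>" using u by (simp add: bounded_source_def)
    have "gag s u \<le> ennreal (C * M\<^sup>2)"
      using un C(2)[OF M u] gag_eq_gag_form[of u s] by (simp add: energy_class_def ennreal_leI)
    then have "l2sq (fdiff h u) \<le> ennreal (C2 * norm h powr (2 * s) * (C * M\<^sup>2))"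
      unfolding C2_def using un s C(1) by (intro fdiff_le_gag) (auto simp: energy_class_def)
    then show ?thesis by (simp add: mult_ac)
  qed
  then have "translate_bound s \<Omega> s (C2 * C) 1" by (simp add: translate_bound_def)
  then show ?thesis using C(1) C2 by (intro exI[of _ "C2 * C"] conjI exI[of _ 1]) auto
qed

lemma translate_bound_mono:
  fixes \<Omega> :: "'a::euclidean_space set"
  assumes T: "translate_bound s \<Omega> t A r" and "r \<le> 1" "0 \<le> A" "0 \<le> t'" "t' \<le> t"
  shows "translate_bound s \<Omega> t' A r"
  unfolding translate_bound_def
proof (intro allI impI)
  fix M u and h :: 'a assume M: "(0::real) < M" and u: "bounded_source s \<Omega> M u" and h: "norm h \<le> r"
  have "l2sq (fdiff h u) \<le> ennreal (A * M\<^sup>2 * norm h powr (2 * t))"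
    using T M u h by (simp add: translate_bound_def)
  also have "norm h powr (2 * t) \<le> norm h powr (2 * t')"
    using assms h by (intro powr_mono') auto
  finally show "l2sq (fdiff h u) \<le> ennreal (A * M\<^sup>2 * norm h powr (2 * t'))"
    using assms(3) by (simp add: mult_left_mono ennreal_leI)
qed

text \<open>The map \<open>t \<mapsto> s + t / 2\<close> has the fixed point \<open>2 * s > 1\<close>. As long as
  \<open>t \<le> 2 - 2 * s\<close>, one step gains at least \<open>2 * s - 1\<close>, and half of this is enough for finitely
  many steps to cross \<open>2 - 2 * s\<close> while the exponents remain strictly below one; beyond
  that point a last step reaches the exponent one. This is where \<open>s > 1 / 2\<close> is needed.\<close>

lemma translate_bound_one:
  fixes \<Omega> :: "'a::euclidean_space set"
  assumes \<Omega>: "lipschitz_domain \<Omega>" "bounded \<Omega>" and s: "1 / 2 < s" "s < 1"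
  shows "\<exists>A>0. \<exists>r>0. r \<le> 1 \<and> translate_bound s \<Omega> 1 A r"
proof -
  define P where "P t \<longleftrightarrow> (\<exists>A>0. \<exists>r>0. r \<le> 1 \<and> translate_bound s \<Omega> t A r)" for t
  have s0: "0 < s" "s \<le> 1" using s by auto
  define g where "g = (2 * s - 1) / 2"
  have g: "0 < g" using s by (simp add: g_def)
  have mono: "P t'" if "P t" "0 \<le> t'" "t' \<le> t" for t t'
    using that translate_bound_mono[of s \<Omega> t] unfolding P_def by (meson less_imp_le)
  have step: "P t'" if "P t" "0 \<le> t" "t \<le> 1" "0 \<le> t'" "t' \<le> s + t / 2 \<and> t' < 1 \<or> 1 < s + t / 2 \<and> t' = 1" for t t'
  proof -
    obtain A r where "0 < A" "0 < r" "r \<le> 1" "translate_bound s \<Omega> t A r"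
      using \<open>P t\<close> unfolding P_def by blast
    then show ?thesis unfolding P_def
      using bootstrap_step[OF \<Omega> s0 that(2,3) _ _ _ _ that(4,5)] by auto
  qed
  have Ps: "P s" unfolding P_def by (rule translate_bound_initial[OF \<Omega> s0])
  have iter: "P (s + real n * g) \<or> P 1" for n
  proof (induction n)
    case (Suc n)
    show ?case
    proof (cases "P 1")
      case False
      then have Pn: "P (s + real n * g)" using Suc by simp
      have nn: "0 \<le> real n * g" using g by simp
      have le: "s + real n * g \<le> 2 - 2 * s"
      proof (rule ccontr)
        assume c: "\<not> ?thesis"
        define t where "t = min 1 (s + real n * g)"
        have t: "0 \<le> t" "t \<le> 1" using nn s by (auto simp: t_def)
        have "P t" by (rule mono[OF Pn t(1)]) (simp add: t_def)
        moreover have "2 - 2 * s < t" using c s by (simp add: t_def)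
        then have "1 < s + t / 2" by simp
        ultimately have "P 1" using t by (intro step[of t 1]) auto
        then show False using False by simp
      qed
      have "s + real (Suc n) * g = (s + real n * g) + (s - 1 / 2)"
        by (simp add: g_def field_simps)
      moreover have "P ((s + real n * g) + (s - 1 / 2))"
      proof (rule step[OF Pn])
        show "0 \<le> s + real n * g" "s + real n * g \<le> 1" "0 \<le> s + real n * g + (s - 1 / 2)"
          using le nn s by linarith+
        have "y + (s - 1 / 2) \<le> s + y / 2" "y + (s - 1 / 2) < 1" if "y \<le> 2 - 2 * s" for y
          using that s by (auto simp: field_simps)
        from this[OF le] have "s + real n * g + (s - 1 / 2) \<le> s + (s + real n * g) / 2"
          "s + real n * g + (s - 1 / 2) < 1" .
        then show "s + real n * g + (s - 1 / 2) \<le> s + (s + real n * g) / 2 \<and> s + real n * g + (s - 1 / 2) < 1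
          \<or> 1 < s + (s + real n * g) / 2 \<and> s + real n * g + (s - 1 / 2) = 1" by blast
      qed
      ultimately show ?thesis by simp
    qed simp
  qed (use Ps in simp)
  obtain n where n: "1 < real n * g" using reals_Archimedean3[OF g] by blast
  have "P 1" using iter[of n]
  proof
    assume "P (s + real n * g)"
    then show "P 1" by (rule mono) (use n s in auto)
  qed
  then show ?thesis by (simp add: P_def)
qed

lemma regularity_estimates:
  fixes \<Omega> :: "'a::euclidean_space set"
  assumes \<Omega>: "lipschitz_domain \<Omega>" "bounded \<Omega>" and s: "1 / 2 < s" "s < 1"
  shows "\<exists>C>0. \<exists>r>0. r \<le> 1 \<and> translate_bound s \<Omega> 1 C r \<and> second_bound s \<Omega> 1 C r \<and>
    (\<forall>M>0. \<forall>u. bounded_source s \<Omega> M u \<longrightarrow> l2sq u \<le> ennreal (C * M\<^sup>2))"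
proof -
  have s0: "0 < s" "s \<le> 1" using s by auto
  have op: "open \<Omega>" using \<Omega>(1) by (simp add: lipschitz_domain_def)
  obtain A r where A: "0 < A" "0 < r" "r \<le> 1" "translate_bound s \<Omega> 1 A r"
    using translate_bound_one[OF \<Omega> s] by blast
  obtain B q where B: "0 < B" "0 < q" "q \<le> 1" "second_bound s \<Omega> 1 B q"
    using second_difference_bound[OF \<Omega> s0 _ _ A(4)] A by auto
  obtain D where D: "D > 0" "\<And>M u. 0 < M \<Longrightarrow> bounded_source s \<Omega> M u \<Longrightarrow> l2sq u \<le> ennreal (D * M\<^sup>2)"
    using a_priori_bounds[OF op \<Omega>(2) s0] by blast
  define C where "C = A + B + D"
  have C: "A \<le> C" "B \<le> C" "D \<le> C" "0 < C" using A B D by (auto simp: C_def)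
  have "translate_bound s \<Omega> 1 C (min r q)"
    unfolding translate_bound_def
  proof (intro allI impI)
    fix M u and h :: 'a assume "(0::real) < M" "bounded_source s \<Omega> M u" "norm h \<le> min r q"
    then have "l2sq (fdiff h u) \<le> ennreal (A * M\<^sup>2 * norm h powr (2 * 1))"
      using A(4) by (simp add: translate_bound_def)
    also have "\<dots> \<le> ennreal (C * M\<^sup>2 * norm h powr (2 * 1))"
      using C by (intro ennreal_leI mult_right_mono) auto
    finally show "l2sq (fdiff h u) \<le> ennreal (C * M\<^sup>2 * norm h powr (2 * 1))" .
  qed
  moreover have "second_bound s \<Omega> 1 C (min r q)"
    unfolding second_bound_def
  proof (intro allI impI)
    fix M u and h k :: 'a assume "(0::real) < M" "bounded_source s \<Omega> M u" "norm h \<le> min r q" "norm k \<le> min r q"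
    then have "l2sq (fdiff k (fdiff h u)) \<le> ennreal (B * M\<^sup>2 * norm k powr (2 * s) * norm h powr 1)"
      using B(4) by (simp add: second_bound_def)
    also have "\<dots> \<le> ennreal (C * M\<^sup>2 * norm k powr (2 * s) * norm h powr 1)"
      using C by (intro ennreal_leI mult_right_mono) auto
    finally show "l2sq (fdiff k (fdiff h u)) \<le> ennreal (C * M\<^sup>2 * norm k powr (2 * s) * norm h powr 1)" .
  qed
  moreover have "l2sq u \<le> ennreal (C * M\<^sup>2)" if "0 < M" "bounded_source s \<Omega> M u" for M u
  proof -
    have "ennreal (D * M\<^sup>2) \<le> ennreal (C * M\<^sup>2)" using C by (intro ennreal_leI mult_right_mono) auto
    then show ?thesis using D(2)[OF that] by (rule order_trans[rotated])
  qed
  moreover have "0 < min r q" "min r q \<le> 1" using A B by auto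
  ultimately show ?thesis using C(4) by blast
qed

section \<open>From translation moduli to Gagliardo seminorms\<close>

lemma inverse_one_minus_powr_le:
  fixes a :: real
  assumes "0 < a"
  shows "1 / (1 - 2 powr (- a)) \<le> 1 + 2 / a"
proof -
  have "1 + a / 2 \<le> exp (a * ln 2)"
  proof -
    have "1 / 2 \<le> ln (2::real)" using ln2_ge_two_thirds by simp
    then have "a / 2 \<le> a * ln 2" using assms mult_left_mono[of "1/2" "ln 2" a] by simp
    then show ?thesis using exp_ge_add_one_self[of "a * ln 2"] by linarith
  qed
  then have "1 + a / 2 \<le> 2 powr a" by (simp add: powr_def mult.commute)
  then have "1 / (2 powr a) \<le> 1 / (1 + a / 2)" using assms by (intro divide_left_mono) auto
  then have "2 powr (- a) \<le> 1 / (1 + a / 2)" by (simp add: powr_minus inverse_eq_divide)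
  then have "1 - 1 / (1 + a / 2) \<le> 1 - 2 powr (- a)" by simp
  moreover have "1 - 1 / (1 + a / 2) = a / (2 + a)" using assms by (simp add: field_simps)
  moreover have "0 < a / (2 + a)" using assms by simp
  ultimately have "1 / (1 - 2 powr (- a)) \<le> 1 / (a / (2 + a))" by (intro divide_left_mono mult_pos_pos) auto
  also have "\<dots> = 1 + 2 / a" using assms by (simp add: field_simps)
  finally show ?thesis .
qed

text \<open>Polar coordinates are replaced by dyadic shells, which lose only a dimensional constant. The
  essential point is the growth \<open>1 / a\<close> of the geometric series as \<open>a\<close> tends to zero.\<close>

lemma dyadic_ball_sum:
  fixes F :: "'a::euclidean_space \<Rightarrow> ennreal" and R :: "nat \<Rightarrow> real"
  assumes a: "0 < a" and c: "0 \<le> c" and R: "\<And>k. 0 < R k"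
    and m: "\<And>k. m k \<ge> 0" "\<And>k. R k ^ DIM('a) * m k = c * (2 powr (- a)) ^ k"
    and F: "\<And>h. F h \<le> (\<Sum>k. ennreal (m k) * indicator (ball 0 (R k)) h)"
  shows "(\<integral>\<^sup>+h. F h \<partial>lborel) \<le> ennreal (measure lborel (ball (0::'a) 1) * c * (1 + 2 / a))"
proof -
  let ?\<omega> = "measure lborel (ball (0::'a) 1)"
  have q: "0 < 2 powr (- a)" "2 powr (- a) < (1::real)" using a powr_less_mono[of "-a" 0 2] by auto
  have "(\<integral>\<^sup>+h. F h \<partial>lborel) \<le> (\<integral>\<^sup>+h. (\<Sum>k. ennreal (m k) * indicator (ball 0 (R k)) h) \<partial>(lborel :: 'a measure))"
    by (intro nn_integral_mono F)
  also have "\<dots> = (\<Sum>k. \<integral>\<^sup>+h. ennreal (m k) * indicator (ball 0 (R k)) h \<partial>(lborel :: 'a measure))"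
  proof (rule nn_integral_suminf)
    fix k
    have [measurable]: "ball (0::'a) (R k) \<in> sets borel" by simp
    show "(\<lambda>h. ennreal (m k) * indicator (ball 0 (R k)) h) \<in> borel_measurable (lborel :: 'a measure)"
      by measurable
  qed
  also have "\<dots> = (\<Sum>k. ennreal (?\<omega> * c * (2 powr (- a)) ^ k))"
  proof (rule arg_cong[where f=suminf], rule ext)
    fix k
    have "(\<integral>\<^sup>+h. ennreal (m k) * indicator (ball 0 (R k)) h \<partial>(lborel :: 'a measure))
        = ennreal (m k) * emeasure lborel (ball (0::'a) (R k))"
      by (intro nn_integral_cmult_indicator) simp
    also have "\<dots> = ennreal (m k * (R k ^ DIM('a) * ?\<omega>))"
      using content_ball_conv_unit_ball[of "R k" "0::'a"] R[of k] m(1)[of k]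
      by (simp add: emeasure_lborel_ball_eq_content ennreal_mult less_imp_le)
    also have "m k * (R k ^ DIM('a) * ?\<omega>) = ?\<omega> * (R k ^ DIM('a) * m k)" by simp
    also have "\<dots> = ?\<omega> * c * (2 powr (- a)) ^ k" by (simp add: m(2))
    finally show "(\<integral>\<^sup>+h. ennreal (m k) * indicator (ball 0 (R k)) h \<partial>(lborel :: 'a measure))
      = ennreal (?\<omega> * c * (2 powr (- a)) ^ k)" .
  qed
  also have "\<dots> = ennreal (?\<omega> * c * (1 / (1 - 2 powr (- a))))"
  proof -
    have "(\<lambda>k. ?\<omega> * c * (2 powr (- a)) ^ k) sums (?\<omega> * c * (1 / (1 - 2 powr (- a))))"
      using q by (intro sums_mult geometric_sums) auto
    then show ?thesis using c q
      by (intro suminf_ennreal_eq) auto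
  qed
  also have "\<dots> \<le> ennreal (?\<omega> * c * (1 + 2 / a))"
    using c inverse_one_minus_powr_le[OF a] by (intro ennreal_leI mult_left_mono) auto
  finally show ?thesis .
qed

lemma ennreal_term_le_suminf: "f k \<le> (\<Sum>k. f k :: ennreal)"
  using sum_le_suminf[of f "{k}"] by simp

lemma two_power_powr: "((2::real) ^ k) powr a = (2 powr a) ^ k"
  by (simp add: powr_realpow[symmetric] powr_powr mult.commute)

lemma two_powr_minus_power: "(2 powr (- a)) ^ k = 1 / (2 powr a :: real) ^ k"
  by (simp add: powr_minus_divide power_one_over)

lemma radial_integral_near_zero:
  assumes a: "0 < a" and r: "0 < r"
  shows "(\<integral>\<^sup>+h. ennreal (norm h powr (a - real DIM('a))) * indicator (ball 0 r) h \<partial>(lborel :: 'a::euclidean_space measure))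
    \<le> ennreal (measure lborel (ball (0::'a) 1) * (2 ^ DIM('a) * r powr a) * (1 + 2 / a))"
proof (rule dyadic_ball_sum[where R="\<lambda>k. r / 2 ^ k"
      and m="\<lambda>k. (r / 2 ^ k) powr a / (r / 2 ^ Suc k) ^ DIM('a)"])
  let ?n = "DIM('a)"
  show "0 < a" "0 \<le> 2 ^ DIM('a) * r powr a" "\<And>k. 0 < r / 2 ^ k"
    "\<And>k. (r / 2 ^ k) powr a / (r / 2 ^ Suc k) ^ DIM('a) \<ge> 0" using a r by auto
  show "(r / 2 ^ k) ^ ?n * ((r / 2 ^ k) powr a / (r / 2 ^ Suc k) ^ ?n)
      = 2 ^ ?n * r powr a * (2 powr (- a)) ^ k" for k
  proof -
    have 1: "(r / 2 ^ k) powr a = r powr a * (2 powr (- a)) ^ k"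
      unfolding two_powr_minus_power two_power_powr[symmetric]
      using r by (simp add: powr_divide powr_minus_divide)
    have "(r / 2 ^ k) ^ ?n = (2 * (r / 2 ^ Suc k)) ^ ?n" by simp
    also have "\<dots> = 2 ^ ?n * (r / 2 ^ Suc k) ^ ?n" by (rule power_mult_distrib)
    finally have 2: "(r / 2 ^ k) ^ ?n = 2 ^ ?n * (r / 2 ^ Suc k) ^ ?n" .
    have "(r / 2 ^ Suc k) ^ ?n \<noteq> 0" using r by simp
    then have "x * (r / 2 ^ Suc k) ^ ?n * (y / (r / 2 ^ Suc k) ^ ?n) = x * y" for x y by simp
    then show ?thesis unfolding 1 2 by (simp only: mult.assoc)
  qed
  fix h :: 'a
  show "ennreal (norm h powr (a - real ?n)) * indicator (ball 0 r) h
    \<le> (\<Sum>k. ennreal ((r / 2 ^ k) powr a / (r / 2 ^ Suc k) ^ ?n) * indicator (ball 0 (r / 2 ^ k)) h)"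
  proof (cases "h \<noteq> 0 \<and> norm h < r")
    case True
    obtain j where "r / norm h < 2 ^ j" using real_arch_pow[of 2 "r / norm h"] by auto
    then have ex: "r / 2 ^ j \<le> norm h" using True by (simp add: field_simps)
    define i where "i = (LEAST j. r / 2 ^ j \<le> norm h)"
    have i: "r / 2 ^ i \<le> norm h" unfolding i_def by (rule LeastI[of _ j]) (rule ex)
    have "i \<noteq> 0" using i True by (cases i) auto
    then obtain k where k: "i = Suc k" using not0_implies_Suc by blast
    have k1: "norm h < r / 2 ^ k" using not_less_Least[of k "\<lambda>j. r / 2 ^ j \<le> norm h"] k
      by (auto simp: i_def[symmetric])
    have k2: "r / 2 ^ Suc k \<le> norm h" using i k by simp
    have "norm h powr (a - real ?n) = norm h powr a / norm h ^ ?n"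
      using True by (simp add: powr_diff powr_realpow)
    also have "\<dots> \<le> (r / 2 ^ k) powr a / (r / 2 ^ Suc k) ^ ?n"
    proof (rule frac_le)
      show "norm h powr a \<le> (r / 2 ^ k) powr a" using k1 a by (intro powr_mono2) auto
      show "(r / 2 ^ Suc k) ^ ?n \<le> norm h ^ ?n" using k2 r by (intro power_mono) auto
    qed (use r in auto)
    finally have le: "ennreal (norm h powr (a - real ?n)) \<le> ennreal ((r / 2 ^ k) powr a / (r / 2 ^ Suc k) ^ ?n)"
      by (rule ennreal_leI)
    have "ennreal (norm h powr (a - real ?n)) * indicator (ball 0 r) h
        \<le> ennreal ((r / 2 ^ k) powr a / (r / 2 ^ Suc k) ^ ?n) * indicator (ball 0 (r / 2 ^ k)) h"
      using le True k1 by simp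
    then show ?thesis by (rule order_trans[OF _ ennreal_term_le_suminf[where k=k]])
  qed auto
qed

lemma radial_integral_far:
  assumes a: "0 < a" and r: "0 < r"
  shows "(\<integral>\<^sup>+h. ennreal (1 / norm h powr (real DIM('a) + a)) * indicator (- ball 0 r) h \<partial>(lborel :: 'a::euclidean_space measure))
    \<le> ennreal (measure lborel (ball (0::'a) 1) * (2 ^ DIM('a) / r powr a) * (1 + 2 / a))"
proof (rule dyadic_ball_sum[where R="\<lambda>k. r * 2 ^ Suc k"
      and m="\<lambda>k. 1 / (r * 2 ^ k) powr (real DIM('a) + a)"])
  let ?n = "DIM('a)"
  show "0 < a" "0 \<le> 2 ^ DIM('a) / r powr a" "\<And>k. 0 < r * 2 ^ Suc k"
    "\<And>k. 1 / (r * 2 ^ k) powr (real DIM('a) + a) \<ge> 0" using a r by auto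
  show "(r * 2 ^ Suc k) ^ ?n * (1 / (r * 2 ^ k) powr (real ?n + a))
      = 2 ^ ?n / r powr a * (2 powr (- a)) ^ k" for k
  proof -
    have 1: "(r * 2 ^ k) powr a = r powr a * (2 powr a) ^ k"
      unfolding two_power_powr[symmetric] using r by (simp add: powr_mult)
    have 2: "(r * 2 ^ k) powr (real ?n + a) = (r * 2 ^ k) ^ ?n * (r powr a * (2 powr a) ^ k)"
      unfolding powr_add 1[symmetric] using r by (simp add: powr_realpow)
    have 3: "(r * 2 ^ Suc k) ^ ?n = 2 ^ ?n * (r * 2 ^ k) ^ ?n"
      by (simp add: power_mult_distrib[symmetric] mult_ac)
    have "(r * 2 ^ k) ^ ?n \<noteq> 0" using r by simp
    then have "x * (r * 2 ^ k) ^ ?n * (1 / ((r * 2 ^ k) ^ ?n * y)) = x / y" for x y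
      by (cases "y = 0") (simp_all del: power_eq_0_iff)
    then show ?thesis unfolding 2 3 two_powr_minus_power by simp
  qed
  fix h :: 'a
  show "ennreal (1 / norm h powr (real ?n + a)) * indicator (- ball 0 r) h
    \<le> (\<Sum>k. ennreal (1 / (r * 2 ^ k) powr (real ?n + a)) * indicator (ball 0 (r * 2 ^ Suc k)) h)"
  proof (cases "r \<le> norm h")
    case True
    obtain j where "norm h / r < 2 ^ j" using real_arch_pow[of 2 "norm h / r"] by auto
    then have ex: "norm h < r * 2 ^ j" using r by (simp add: field_simps)
    define i where "i = (LEAST j. norm h < r * 2 ^ j)"
    have i: "norm h < r * 2 ^ i" unfolding i_def by (rule LeastI[of _ j]) (rule ex)
    have "i \<noteq> 0" using i True by (cases i) auto
    then obtain k where k: "i = Suc k" using not0_implies_Suc by blast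
    have k1: "r * 2 ^ k \<le> norm h" using not_less_Least[of k "\<lambda>j. norm h < r * 2 ^ j"] k
      by (auto simp: i_def[symmetric])
    have k2: "norm h < r * 2 ^ Suc k" using i k by simp
    have "1 / norm h powr (real ?n + a) \<le> 1 / (r * 2 ^ k) powr (real ?n + a)"
      using k1 a r True by (intro divide_left_mono powr_mono2 mult_pos_pos) auto
    then have "ennreal (1 / norm h powr (real ?n + a)) * indicator (- ball 0 r) h
      \<le> ennreal (1 / (r * 2 ^ k) powr (real ?n + a)) * indicator (ball 0 (r * 2 ^ Suc k)) h"
      using True k2 by (simp add: ennreal_leI)
    then show ?thesis by (rule order_trans[OF _ ennreal_term_le_suminf[where k=k]])
  qed simp
qed

definition radial_const :: "'a::euclidean_space itself \<Rightarrow> real" where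
  "radial_const _ = 4 * (measure lborel (ball (0::'a) 1) * 2 ^ DIM('a))"

lemma radial_const_pos: "0 < radial_const TYPE('a::euclidean_space)"
  unfolding radial_const_def using content_ball_pos[of 1 "0::'a"] by simp

text \<open>The blow-up \<open>1 / (\<tau> - \<sigma>)\<close> at the critical order is the origin of the factor
  \<open>1 / sqrt \<epsilon>\<close> in the theorem.\<close>

lemma gag_le_of_translates:
  fixes v :: "'a::euclidean_space \<Rightarrow> real"
  assumes v [measurable]: "v \<in> borel_measurable borel" and \<sigma>: "0 < \<sigma>" "\<sigma> < \<tau>" "\<sigma> \<le> 1"
    and r: "0 < r" "r \<le> 1" and N: "0 \<le> N" and D: "0 \<le> D" and vN: "l2sq v \<le> ennreal N"
    and vD: "\<And>h. norm h < r \<Longrightarrow> l2sq (fdiff h v) \<le> ennreal (D * norm h powr (2 * \<tau>))"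
  shows "gag \<sigma> v \<le> ennreal (radial_const TYPE('a) * (D * (1 + 1 / (\<tau> - \<sigma>)) + N / r\<^sup>2 * (1 + 1 / \<sigma>)))"
proof -
  let ?\<omega> = "measure lborel (ball (0::'a) 1)"
  let ?n = "DIM('a)"
  let ?C = "4 * (?\<omega> * 2 ^ ?n)"
  have w: "0 < ?\<omega>" by (rule content_ball_pos) simp
  have [measurable]: "ball (0::'a) r \<in> sets borel" "- ball (0::'a) r \<in> sets borel" by auto
  define I1 where "I1 = (\<lambda>h::'a. ennreal (norm h powr (2 * (\<tau> - \<sigma>) - real ?n)) * indicator (ball 0 r) h)"
  define I2 where "I2 = (\<lambda>h::'a. ennreal (1 / norm h powr (real ?n + 2 * \<sigma>)) * indicator (- ball 0 r) h)"
  have [measurable]: "I1 \<in> borel_measurable borel" "I2 \<in> borel_measurable borel"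
    unfolding I1_def I2_def by measurable
  have "gag \<sigma> v = (\<integral>\<^sup>+h. l2sq (fdiff h v) * ennreal (1 / norm h powr (real ?n + 2 * \<sigma>)) \<partial>lborel)"
    by (rule gag_eq_fdiff[OF v])
  also have "\<dots> \<le> (\<integral>\<^sup>+h. ennreal D * I1 h + ennreal (4 * N) * I2 h \<partial>lborel)"
  proof (rule nn_integral_mono)
    fix h :: 'a
    show "l2sq (fdiff h v) * ennreal (1 / norm h powr (real ?n + 2 * \<sigma>)) \<le> ennreal D * I1 h + ennreal (4 * N) * I2 h"
    proof (cases "norm h < r")
      case True
      show ?thesis
      proof (cases "h = 0")
        case False
        have "l2sq (fdiff h v) * ennreal (1 / norm h powr (real ?n + 2 * \<sigma>))
          \<le> ennreal (D * norm h powr (2 * \<tau>)) * ennreal (1 / norm h powr (real ?n + 2 * \<sigma>))"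
          using vD True by (intro mult_right_mono) auto
        also have "\<dots> = ennreal (D * (norm h powr (2 * \<tau>) / norm h powr (real ?n + 2 * \<sigma>)))"
          using D by (simp add: ennreal_mult[symmetric])
        also have "norm h powr (2 * \<tau>) / norm h powr (real ?n + 2 * \<sigma>) = norm h powr (2 * (\<tau> - \<sigma>) - real ?n)"
          using False by (simp add: powr_diff[symmetric] algebra_simps)
        finally show ?thesis using True D by (simp add: I1_def I2_def ennreal_mult)
      qed simp
    next
      case False
      have "l2sq (fdiff h v) * ennreal (1 / norm h powr (real ?n + 2 * \<sigma>))
          \<le> ennreal (4 * N) * ennreal (1 / norm h powr (real ?n + 2 * \<sigma>))"
        by (intro mult_right_mono l2sq_fdiff_le v vN N) auto
      then show ?thesis using False by (simp add: I1_def I2_def)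
    qed
  qed
  also have "\<dots> = ennreal D * (\<integral>\<^sup>+h. I1 h \<partial>lborel) + ennreal (4 * N) * (\<integral>\<^sup>+h. I2 h \<partial>lborel)"
    by (subst nn_integral_add) (auto simp: nn_integral_cmult)
  also have "\<dots> \<le> ennreal D * ennreal (?\<omega> * (2 ^ ?n * r powr (2 * (\<tau> - \<sigma>))) * (1 + 2 / (2 * (\<tau> - \<sigma>))))
      + ennreal (4 * N) * ennreal (?\<omega> * (2 ^ ?n / r powr (2 * \<sigma>)) * (1 + 2 / (2 * \<sigma>)))"
    unfolding I1_def I2_def using \<sigma> r
    by (intro add_mono mult_left_mono radial_integral_near_zero radial_integral_far) auto
  also have "\<dots> \<le> ennreal D * ennreal (?C * (1 + 1 / (\<tau> - \<sigma>)))
      + ennreal N * ennreal (?C * (1 / r\<^sup>2 * (1 + 1 / \<sigma>)))"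
  proof (intro add_mono mult_left_mono)
    have "?\<omega> * (2 ^ ?n * r powr (2 * (\<tau> - \<sigma>))) * (1 + 2 / (2 * (\<tau> - \<sigma>))) \<le> ?\<omega> * (2 ^ ?n * 1) * (1 + 1 / (\<tau> - \<sigma>))"
    proof (intro mult_mono mult_left_mono)
      show "1 + 2 / (2 * (\<tau> - \<sigma>)) \<le> 1 + 1 / (\<tau> - \<sigma>)" by (simp add: mult_divide_mult_cancel_left[of 2 1, simplified] del: right_diff_distrib_numeral)
    qed (use \<sigma> r w powr_le1[of "2 * (\<tau> - \<sigma>)" r] in auto)
    also have "\<dots> \<le> ?C * (1 + 1 / (\<tau> - \<sigma>))" using \<sigma> w by (intro mult_right_mono) auto
    finally show "ennreal (?\<omega> * (2 ^ ?n * r powr (2 * (\<tau> - \<sigma>))) * (1 + 2 / (2 * (\<tau> - \<sigma>)))) \<le> ennreal (?C * (1 + 1 / (\<tau> - \<sigma>)))"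
      by (rule ennreal_leI)
    have "r powr 2 \<le> r powr (2 * \<sigma>)" using \<sigma> r by (intro powr_mono') auto
    then have "1 / r powr (2 * \<sigma>) \<le> 1 / r\<^sup>2" using r by (intro divide_left_mono) auto
    then have "(4 * ?\<omega> * 2 ^ ?n * (1 + 1 / \<sigma>)) * (1 / r powr (2 * \<sigma>)) \<le> (4 * ?\<omega> * 2 ^ ?n * (1 + 1 / \<sigma>)) * (1 / r\<^sup>2)"
      using \<sigma> w by (intro mult_left_mono) auto
    then have *: "4 * (?\<omega> * (2 ^ ?n / r powr (2 * \<sigma>)) * (1 + 2 / (2 * \<sigma>))) \<le> ?C * (1 / r\<^sup>2 * (1 + 1 / \<sigma>))"
      by (simp add: mult_ac)
    have "ennreal (4 * N) * ennreal (?\<omega> * (2 ^ ?n / r powr (2 * \<sigma>)) * (1 + 2 / (2 * \<sigma>)))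
        = ennreal N * ennreal (4 * (?\<omega> * (2 ^ ?n / r powr (2 * \<sigma>)) * (1 + 2 / (2 * \<sigma>))))"
      using N \<sigma> w by (simp add: ennreal_mult[symmetric] mult_ac)
    also have "\<dots> \<le> ennreal N * ennreal (?C * (1 / r\<^sup>2 * (1 + 1 / \<sigma>)))"
      using * by (intro mult_left_mono ennreal_leI) auto
    finally show "ennreal (4 * N) * ennreal (?\<omega> * (2 ^ ?n / r powr (2 * \<sigma>)) * (1 + 2 / (2 * \<sigma>)))
      \<le> ennreal N * ennreal (?C * (1 / r\<^sup>2 * (1 + 1 / \<sigma>)))" .
  qed auto
  also have "\<dots> = ennreal (D * (?C * (1 + 1 / (\<tau> - \<sigma>))) + N * (?C * (1 / r\<^sup>2 * (1 + 1 / \<sigma>))))"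
  proof -
    have "ennreal D * ennreal x + ennreal N * ennreal y = ennreal (D * x + N * y)" if "0 \<le> x" "0 \<le> y" for x y
      using D N that by (simp add: ennreal_mult ennreal_plus)
    then show ?thesis using \<sigma> w by simp
  qed
  also have "D * (?C * (1 + 1 / (\<tau> - \<sigma>))) + N * (?C * (1 / r\<^sup>2 * (1 + 1 / \<sigma>)))
      = ?C * (D * (1 + 1 / (\<tau> - \<sigma>)) + N / r\<^sup>2 * (1 + 1 / \<sigma>))"
    by (simp add: algebra_simps)
  finally show ?thesis unfolding radial_const_def .
qed

section \<open>Weak derivatives as limits of difference quotients\<close>

lemma l2sq_uminus: "l2sq (\<lambda>x. f x - g x) = l2sq (\<lambda>x. g x - f x)"
  by (simp add: l2sq_def power2_commute)

text \<open>Pointwise convergence follows from the finiteness of the integral of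
  \<open>\<Sum>k. (w (Suc k) - w k)\<^sup>2 / q ^ k\<close>, which makes the increments decay geometrically almost
  everywhere; the norm estimate is then Fatou's lemma.\<close>

lemma l2_limit_of_geometric:
  fixes w :: "nat \<Rightarrow> 'a::euclidean_space \<Rightarrow> real"
  assumes w [measurable]: "\<And>k. w k \<in> borel_measurable borel"
    and q: "0 < q" "q < 1" and D: "0 \<le> D"
    and step: "\<And>k. l2sq (\<lambda>x. w (Suc k) x - w k x) \<le> ennreal ((D * q ^ k)\<^sup>2)"
  shows "\<exists>g\<in>borel_measurable borel. \<forall>k. l2sq (\<lambda>x. g x - w k x) \<le> ennreal ((D * q ^ k / (1 - q))\<^sup>2)"
proof -
  define g where "g x = lim (\<lambda>k. w k x)" for x
  have gm [measurable]: "g \<in> borel_measurable borel"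
    unfolding g_def using w by (rule borel_measurable_lim_metric)
  have far: "l2sq (\<lambda>x. w (k + m) x - w k x) \<le> ennreal ((\<Sum>j<m. D * q ^ (k + j))\<^sup>2)" for k m
  proof (induction m)
    case 0
    then show ?case by (simp add: l2sq_def)
  next
    case (Suc m)
    have "l2sq (\<lambda>x. (w (k + m) x - w k x) + (w (Suc (k + m)) x - w (k + m) x))
        \<le> ennreal (((\<Sum>j<m. D * q ^ (k + j)) + D * q ^ (k + m))\<^sup>2)"
      using q D by (intro l2sq_minkowski Suc.IH step sum_nonneg) auto
    then show ?case by simp
  qed
  have geo: "(\<Sum>j<m. D * q ^ (k + j)) \<le> D * q ^ k / (1 - q)" for k m
  proof -
    have "(\<Sum>j<m. D * q ^ (k + j)) = D * q ^ k * (\<Sum>j<m. q ^ j)"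
      by (simp add: sum_distrib_left power_add mult_ac)
    also have "(\<Sum>j<m. q ^ j) \<le> 1 / (1 - q)"
      using q by (simp add: sum_gp_strict divide_right_mono)
    finally show ?thesis using D q by (simp add: mult_left_mono)
  qed
  have far': "l2sq (\<lambda>x. w (k + m) x - w k x) \<le> ennreal ((D * q ^ k / (1 - q))\<^sup>2)" for k m
    using far[of k m] geo[of k m] q D
    by (elim order_trans) (intro ennreal_leI power_mono sum_nonneg, auto)
  have conv: "AE x in lborel. convergent (\<lambda>k. w k x)"
  proof -
    define S where "S x = (\<Sum>k. ennreal ((w (Suc k) x - w k x)\<^sup>2 / q ^ k))" for x
    have [measurable]: "S \<in> borel_measurable borel" unfolding S_def by measurable
    have "(\<integral>\<^sup>+x. S x \<partial>lborel) = (\<Sum>k. \<integral>\<^sup>+x. ennreal ((w (Suc k) x - w k x)\<^sup>2 / q ^ k) \<partial>lborel)"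
      unfolding S_def by (rule nn_integral_suminf) measurable
    also have "\<dots> \<le> (\<Sum>k. ennreal (D\<^sup>2 * q ^ k))"
    proof (rule suminf_le)
      fix k
      have "(\<integral>\<^sup>+x. ennreal ((w (Suc k) x - w k x)\<^sup>2 / q ^ k) \<partial>lborel)
          = (\<integral>\<^sup>+x. ennreal (1 / q ^ k) * ennreal ((w (Suc k) x - w k x)\<^sup>2) \<partial>lborel)"
        using q by (simp add: ennreal_mult[symmetric])
      also have "\<dots> = ennreal (1 / q ^ k) * l2sq (\<lambda>x. w (Suc k) x - w k x)"
        unfolding l2sq_def by (rule nn_integral_cmult) measurable
      also have "\<dots> \<le> ennreal (1 / q ^ k) * ennreal ((D * q ^ k)\<^sup>2)"
        by (intro mult_left_mono step) simp
      also have "\<dots> = ennreal (D\<^sup>2 * q ^ k)"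
      proof -
        have "1 / q ^ k * (D * q ^ k)\<^sup>2 = D\<^sup>2 * q ^ k"
          using q by (simp add: field_simps power2_eq_square)
        then show ?thesis using q by (subst ennreal_mult[symmetric]) auto
      qed
      finally show "(\<integral>\<^sup>+x. ennreal ((w (Suc k) x - w k x)\<^sup>2 / q ^ k) \<partial>lborel) \<le> ennreal (D\<^sup>2 * q ^ k)" .
    qed auto
    also have "\<dots> < \<infinity>"
    proof -
      have "(\<lambda>k. D\<^sup>2 * q ^ k) sums (D\<^sup>2 * (1 / (1 - q)))" using q by (intro sums_mult geometric_sums) auto
      then have "(\<Sum>k. ennreal (D\<^sup>2 * q ^ k)) = ennreal (D\<^sup>2 * (1 / (1 - q)))"
        using q by (intro suminf_ennreal_eq) auto
      then show ?thesis by simp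
    qed
    finally have "AE x in lborel. S x \<noteq> \<infinity>" by (intro nn_integral_PInf_AE) auto
    then show ?thesis
    proof eventually_elim
      case (elim x)
      then obtain c where c: "S x = ennreal c" "0 \<le> c" by (cases "S x") auto
      have b: "\<bar>w (Suc k) x - w k x\<bar> \<le> sqrt c * sqrt q ^ k" for k
      proof -
        have "ennreal ((w (Suc k) x - w k x)\<^sup>2 / q ^ k)
            = sum (\<lambda>k. ennreal ((w (Suc k) x - w k x)\<^sup>2 / q ^ k)) {k}" by simp
        also have "\<dots> \<le> S x" unfolding S_def by (intro sum_le_suminf) auto
        finally have "(w (Suc k) x - w k x)\<^sup>2 / q ^ k \<le> c" using c by (simp add: ennreal_le_iff)
        then have "(w (Suc k) x - w k x)\<^sup>2 \<le> c * q ^ k" using q by (simp add: field_simps)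
        then have "sqrt ((w (Suc k) x - w k x)\<^sup>2) \<le> sqrt (c * q ^ k)" by (rule real_sqrt_le_mono)
        then show ?thesis unfolding real_sqrt_abs unfolding real_sqrt_mult real_sqrt_power .
      qed
      have "summable (\<lambda>k. w (Suc k) x - w k x)"
      proof (rule summable_comparison_test')
        show "summable (\<lambda>k. sqrt c * sqrt q ^ k)"
          using q by (intro summable_mult summable_geometric) auto
        show "norm (w (Suc k) x - w k x) \<le> sqrt c * sqrt q ^ k" if "0 \<le> k" for k using b by simp
      qed
      then have "convergent (\<lambda>n. \<Sum>k<n. w (Suc k) x - w k x)" by (simp add: summable_iff_convergent)
      then have "convergent (\<lambda>n. (\<Sum>k<n. w (Suc k) x - w k x) + w 0 x)"
        by (intro convergent_add convergent_const)
      moreover have "(\<Sum>k<n. w (Suc k) x - w k x) + w 0 x = w n x" for n by (induction n) auto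
      ultimately show ?case by simp
    qed
  qed
  have "l2sq (\<lambda>x. g x - w k x) \<le> ennreal ((D * q ^ k / (1 - q))\<^sup>2)" for k
  proof -
    have "AE x in lborel. ennreal ((g x - w k x)\<^sup>2) = liminf (\<lambda>m. ennreal ((w (k + m) x - w k x)\<^sup>2))"
      using conv
    proof eventually_elim
      case (elim x)
      then have "(\<lambda>m. w m x) \<longlonglongrightarrow> g x" unfolding g_def by (simp add: convergent_LIMSEQ_iff)
      then have "(\<lambda>m. w (m + k) x) \<longlonglongrightarrow> g x" by (rule LIMSEQ_ignore_initial_segment)
      then have "(\<lambda>m. ennreal ((w (k + m) x - w k x)\<^sup>2)) \<longlonglongrightarrow> ennreal ((g x - w k x)\<^sup>2)"
        by (intro tendsto_ennrealI tendsto_intros) (simp add: add.commute)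
      then show ?case by (rule lim_imp_Liminf[symmetric, rotated]) simp
    qed
    then have "l2sq (\<lambda>x. g x - w k x) = (\<integral>\<^sup>+x. liminf (\<lambda>m. ennreal ((w (k + m) x - w k x)\<^sup>2)) \<partial>lborel)"
      unfolding l2sq_def by (rule nn_integral_cong_AE)
    also have "\<dots> \<le> liminf (\<lambda>m. \<integral>\<^sup>+x. ennreal ((w (k + m) x - w k x)\<^sup>2) \<partial>lborel)"
      by (rule nn_integral_liminf) measurable
    also have "\<dots> \<le> ennreal ((D * q ^ k / (1 - q))\<^sup>2)"
      using far'[of k] unfolding l2sq_def
      by (intro Liminf_le always_eventually) auto
    finally show ?thesis .
  qed
  then show ?thesis using gm by blast
qed

lemma test_function_facts:
  fixes \<phi> :: "'a::euclidean_space \<Rightarrow> real"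
  assumes \<phi>: "\<phi> \<in> test_functions G" and b: "b \<in> Basis"
  shows "\<And>x. (\<phi> has_derivative frechet_derivative \<phi> (at x)) (at x)"
    and "continuous_on UNIV \<phi>" and "continuous_on UNIV (pderivs [b] \<phi>)"
    and "\<exists>K B. compact K \<and> 0 < B \<and> (\<forall>x. x \<notin> K \<longrightarrow> \<phi> x = 0) \<and> (\<forall>x. \<bar>\<phi> x\<bar> \<le> B) \<and> (\<forall>x. \<bar>pderivs [b] \<phi> x\<bar> \<le> B)"
proof -
  have sm: "smooth \<phi>" using \<phi> by (simp add: test_functions_def)
  have "pderivs [] \<phi> differentiable_on UNIV"
    using sm unfolding smooth_def multi_indices_def by fastforce
  then have d0: "\<phi> differentiable at x" for x by (simp add: differentiable_on_def)
  have d1: "pderivs [b] \<phi> differentiable_on UNIV"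
    using sm[unfolded smooth_def, rule_format, of "[b]" 1] b by (simp add: multi_indices_def)
  show hd: "(\<phi> has_derivative frechet_derivative \<phi> (at x)) (at x)" for x
    using d0 by (simp add: frechet_derivative_works)
  show c0: "continuous_on UNIV \<phi>"
    using d0 by (intro differentiable_imp_continuous_on) (simp add: differentiable_on_def)
  show c1: "continuous_on UNIV (pderivs [b] \<phi>)" using d1 by (rule differentiable_imp_continuous_on)
  obtain K where K: "compact K" "\<And>x. x \<notin> K \<Longrightarrow> \<phi> x = 0" using \<phi> by (auto simp: test_functions_def)
  have p0: "pderivs [b] \<phi> x = 0" if "x \<notin> K" for x
  proof -
    have "frechet_derivative \<phi> (at x) = frechet_derivative (\<lambda>_. 0) (at x)"
      using K that by (intro frechet_derivative_transform_within_open[of _ _ "- K"] d0)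
        (auto simp: compact_imp_closed open_Compl)
    then show ?thesis by simp
  qed
  have bd: "\<exists>B. \<forall>x\<in>K. \<bar>f x\<bar> \<le> B" if "continuous_on UNIV f" for f :: "'a \<Rightarrow> real"
  proof -
    have "compact (f ` K)" using continuous_on_subset[OF that] K(1) by (intro compact_continuous_image) auto
    then have "bounded (f ` K)" by (rule compact_imp_bounded)
    then show ?thesis by (auto simp: bounded_iff)
  qed
  obtain B0 B1 where B0: "\<forall>x\<in>K. \<bar>\<phi> x\<bar> \<le> B0" and B1: "\<forall>x\<in>K. \<bar>pderivs [b] \<phi> x\<bar> \<le> B1"
    using bd[OF c0] bd[OF c1] by blast
  define B where "B = \<bar>B0\<bar> + \<bar>B1\<bar> + 1"
  have "\<bar>\<phi> x\<bar> \<le> B \<and> \<bar>pderivs [b] \<phi> x\<bar> \<le> B" for x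
  proof (cases "x \<in> K")
    case True
    then have "\<bar>\<phi> x\<bar> \<le> B0" "\<bar>pderivs [b] \<phi> x\<bar> \<le> B1" using B0 B1 by auto
    then show ?thesis unfolding B_def by linarith
  next
    case False
    have "0 \<le> B" by (simp add: B_def)
    then show ?thesis using K(2)[OF False] p0[OF False] by simp
  qed
  moreover have "0 < B" by (simp add: B_def)
  ultimately show "\<exists>K B. compact K \<and> 0 < B \<and> (\<forall>x. x \<notin> K \<longrightarrow> \<phi> x = 0) \<and> (\<forall>x. \<bar>\<phi> x\<bar> \<le> B)
      \<and> (\<forall>x. \<bar>pderivs [b] \<phi> x\<bar> \<le> B)"
    using K by blast
qed

lemma l2_pairing_bound:
  fixes f \<phi> :: "'a::euclidean_space \<Rightarrow> real"
  assumes f [measurable]: "f \<in> borel_measurable borel" and \<phi> [measurable]: "\<phi> \<in> borel_measurable borel"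
    and F: "l2sq f \<le> ennreal F" "0 \<le> F" and P: "l2sq \<phi> \<le> ennreal P" "0 \<le> P" and \<alpha>: "0 < \<alpha>"
  shows "integrable lborel (\<lambda>x. f x * \<phi> x)"
    and "\<bar>\<integral>x. f x * \<phi> x \<partial>lborel\<bar> \<le> (\<alpha> * P + F / \<alpha>) / 2"
proof -
  have i: "integrable lborel (\<lambda>x. (f x)\<^sup>2)" "integrable lborel (\<lambda>x. (\<phi> x)\<^sup>2)"
    by (rule integrableI_bounded; use F P in \<open>auto simp: l2sq_def intro: le_less_trans\<close>)+
  have le: "(\<integral>x. (f x)\<^sup>2 \<partial>lborel) \<le> F" "(\<integral>x. (\<phi> x)\<^sup>2 \<partial>lborel) \<le> P"
  proof -
    have "ennreal (\<integral>x. (f x)\<^sup>2 \<partial>lborel) = l2sq f" "ennreal (\<integral>x. (\<phi> x)\<^sup>2 \<partial>lborel) = l2sq \<phi>"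
      unfolding l2sq_def using i by (simp_all add: nn_integral_eq_integral)
    then have "ennreal (\<integral>x. (f x)\<^sup>2 \<partial>lborel) \<le> ennreal F" "ennreal (\<integral>x. (\<phi> x)\<^sup>2 \<partial>lborel) \<le> ennreal P"
      using F(1) P(1) by (simp_all only:)
    then show "(\<integral>x. (f x)\<^sup>2 \<partial>lborel) \<le> F" "(\<integral>x. (\<phi> x)\<^sup>2 \<partial>lborel) \<le> P"
      using F(2) P(2) ennreal_le_iff by blast+
  qed
  have pt: "norm (f x * \<phi> x) \<le> (\<alpha> * (\<phi> x)\<^sup>2 + (f x)\<^sup>2 / \<alpha>) / 2" for x
  proof -
    have "2 * (\<alpha> * \<bar>\<phi> x\<bar>) * \<bar>f x\<bar> \<le> (\<alpha> * \<bar>\<phi> x\<bar>)\<^sup>2 + \<bar>f x\<bar>\<^sup>2" by (rule sum_squares_bound)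
    then show ?thesis using \<alpha> by (simp add: abs_mult field_simps power2_eq_square)
  qed
  have ii: "integrable lborel (\<lambda>x. (\<alpha> * (\<phi> x)\<^sup>2 + (f x)\<^sup>2 / \<alpha>) / 2)"
    using i by (intro integrable_divide Bochner_Integration.integrable_add integrable_mult_right) auto
  show ip: "integrable lborel (\<lambda>x. f x * \<phi> x)"
  proof (rule Bochner_Integration.integrable_bound[OF ii])
    have "norm (f x * \<phi> x) \<le> norm ((\<alpha> * (\<phi> x)\<^sup>2 + (f x)\<^sup>2 / \<alpha>) / 2)" for x
      using pt[of x] unfolding real_norm_def by (rule order_trans) (rule abs_ge_self)
    then show "AE x in lborel. norm (f x * \<phi> x) \<le> norm ((\<alpha> * (\<phi> x)\<^sup>2 + (f x)\<^sup>2 / \<alpha>) / 2)" by simp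
  qed measurable
  have "\<bar>\<integral>x. f x * \<phi> x \<partial>lborel\<bar> \<le> (\<integral>x. norm (f x * \<phi> x) \<partial>lborel)"
    using integral_norm_bound[of lborel "\<lambda>x. f x * \<phi> x"] by simp
  also have "\<dots> \<le> (\<integral>x. (\<alpha> * (\<phi> x)\<^sup>2 + (f x)\<^sup>2 / \<alpha>) / 2 \<partial>lborel)"
    by (rule integral_mono[OF _ ii pt]) (use ip in auto)
  also have "\<dots> = (\<alpha> * (\<integral>x. (\<phi> x)\<^sup>2 \<partial>lborel) + (\<integral>x. (f x)\<^sup>2 \<partial>lborel) / \<alpha>) / 2"
    using i by simp
  also have "\<dots> \<le> (\<alpha> * P + F / \<alpha>) / 2"
    using le \<alpha> by (intro divide_right_mono add_mono mult_left_mono) auto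
  finally show "\<bar>\<integral>x. f x * \<phi> x \<partial>lborel\<bar> \<le> (\<alpha> * P + F / \<alpha>) / 2" .
qed

lemma l2sq_bounded_compact_support:
  fixes \<phi> :: "'a::euclidean_space \<Rightarrow> real"
  assumes K: "compact K" and 0: "\<And>x. x \<notin> K \<Longrightarrow> \<phi> x = 0" and B: "\<And>x. \<bar>\<phi> x\<bar> \<le> B"
  shows "\<exists>P\<ge>0. l2sq \<phi> \<le> ennreal P"
proof (intro exI conjI)
  have Km: "K \<in> sets borel" using K by (simp add: compact_imp_closed borel_closed)
  have fin: "emeasure lborel K < \<infinity>" using K by (intro emeasure_bounded_finite compact_imp_bounded)
  have "l2sq \<phi> \<le> (\<integral>\<^sup>+x. ennreal (B\<^sup>2) * indicator K x \<partial>lborel)"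
    unfolding l2sq_def
  proof (rule nn_integral_mono)
    fix x
    have "(\<phi> x)\<^sup>2 \<le> B\<^sup>2" using B[of x] by (simp add: abs_le_square_iff[symmetric])
    then show "ennreal ((\<phi> x)\<^sup>2) \<le> ennreal (B\<^sup>2) * indicator K x"
      using 0[of x] by (cases "x \<in> K") (auto intro: ennreal_leI)
  qed
  also have "\<dots> = ennreal (B\<^sup>2) * emeasure lborel K" using Km by (intro nn_integral_cmult_indicator) simp
  also have "\<dots> = ennreal (B\<^sup>2 * measure lborel K)"
    using fin by (simp add: emeasure_eq_ennreal_measure ennreal_mult less_top)
  finally show "l2sq \<phi> \<le> ennreal (B\<^sup>2 * measure lborel K)" .
qed simp

lemma integral_lebesgue_on_UNIV_eq:
  fixes f :: "'a::euclidean_space \<Rightarrow> real"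
  assumes "f \<in> borel_measurable borel"
  shows "(\<integral>x. f x \<partial>lebesgue_on UNIV) = (\<integral>x. f x \<partial>lborel)"
  using assms by (simp add: lebesgue_on_UNIV_eq integral_completion)

text \<open>Discrete integration by parts moves the difference quotient to the test function, where it converges
  boundedly to the derivative.\<close>

lemma weak_pderiv_of_difference_limit:
  fixes u g :: "'a::euclidean_space \<Rightarrow> real" and t e :: "nat \<Rightarrow> real"
  assumes u [measurable]: "u \<in> borel_measurable borel" and ui: "integrable lborel u"
    and g [measurable]: "g \<in> borel_measurable borel" and gG: "l2sq g \<le> ennreal G" "0 \<le> G" and b: "b \<in> Basis"
    and t: "\<And>k. 0 < t k" "t \<longlonglongrightarrow> 0" and e: "\<And>k. 0 < e k" "e \<longlonglongrightarrow> 0"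
    and lim: "\<And>k. l2sq (\<lambda>x. g x - fdiff (t k *\<^sub>R b) u x / t k) \<le> ennreal ((e k)\<^sup>2)"
  shows "is_weak_pderiv UNIV b u g"
  unfolding is_weak_pderiv_def
proof
  fix \<phi> :: "'a \<Rightarrow> real" assume \<phi>: "\<phi> \<in> test_functions UNIV"
  define \<psi> where "\<psi> = pderivs [b] \<phi>"
  note tf = test_function_facts[OF \<phi> b]
  obtain K B where K: "compact K" and B: "0 < B" and \<phi>0: "\<And>x. x \<notin> K \<Longrightarrow> \<phi> x = 0"
    and \<phi>B: "\<And>x. \<bar>\<phi> x\<bar> \<le> B" and \<psi>B: "\<And>x. \<bar>\<psi> x\<bar> \<le> B"
    using tf(4) by (auto simp: \<psi>_def)
  have [measurable]: "\<phi> \<in> borel_measurable borel" "\<psi> \<in> borel_measurable borel"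
    using tf(2,3) unfolding \<psi>_def by (auto intro: borel_measurable_continuous_onI)
  have "\<exists>P\<ge>0. l2sq \<phi> \<le> ennreal P"
    using \<phi>0 \<phi>B by (rule l2sq_bounded_compact_support[OF K])
  then obtain P where P: "0 \<le> P" "l2sq \<phi> \<le> ennreal P" by (elim exE conjE) (rule that)
  define w where "w k x = fdiff (t k *\<^sub>R b) u x / t k" for k x
  have [measurable]: "w k \<in> borel_measurable borel" for k unfolding w_def by measurable
  define D where "D k x = (\<phi> (x - t k *\<^sub>R b) - \<phi> x) / t k" for k x
  have [measurable]: "D k \<in> borel_measurable borel" for k unfolding D_def by measurable
  have der: "((\<lambda>r. \<phi> (x - r *\<^sub>R b)) has_derivative (\<lambda>d. - d * \<psi> (x - r *\<^sub>R b))) (at r)" for x r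
  proof -
    have "((\<lambda>r. \<phi> (x - r *\<^sub>R b)) has_derivative (\<lambda>d. frechet_derivative \<phi> (at (x - r *\<^sub>R b)) (- (d *\<^sub>R b)))) (at r)"
      by (rule has_derivative_compose[OF _ tf(1)]) (auto intro!: derivative_eq_intros)
    moreover have "frechet_derivative \<phi> (at (x - r *\<^sub>R b)) (- (d *\<^sub>R b)) = - d * \<psi> (x - r *\<^sub>R b)" for d
      using linear_cmul[OF has_derivative_linear[OF tf(1)], of "x - r *\<^sub>R b" "- d" b] by (simp add: \<psi>_def)
    ultimately show ?thesis by simp
  qed
  have Db: "\<bar>D k x\<bar> \<le> B" for k x
  proof -
    have "\<exists>r\<in>{0<..<t k}. \<phi> (x - t k *\<^sub>R b) - \<phi> (x - 0 *\<^sub>R b) = - (t k - 0) * \<psi> (x - r *\<^sub>R b)"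
      using t(1)[of k] der by (intro mvt_simple) (auto intro: has_derivative_at_withinI)
    then obtain r where "\<phi> (x - t k *\<^sub>R b) - \<phi> x = - t k * \<psi> (x - r *\<^sub>R b)" by auto
    then have "D k x = - \<psi> (x - r *\<^sub>R b)" using t(1)[of k] by (simp add: D_def field_simps)
    then show ?thesis using \<psi>B by simp
  qed
  have Dlim: "(\<lambda>k. D k x) \<longlonglongrightarrow> - \<psi> x" for x
  proof -
    have "(\<lambda>d. - d * \<psi> x) = (*) (- \<psi> x)" by (auto simp: fun_eq_iff)
    then have "((\<lambda>r. \<phi> (x - r *\<^sub>R b)) has_field_derivative - \<psi> x) (at 0)"
      using der[of x 0] by (simp add: has_field_derivative_def)
    then have "((\<lambda>h. (\<phi> (x - h *\<^sub>R b) - \<phi> x) / h) \<longlongrightarrow> - \<psi> x) (at 0)"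
      by (simp add: DERIV_def)
    moreover have "filterlim t (at 0) sequentially"
      using t by (intro filterlim_atI) (auto intro!: always_eventually simp: less_imp_neq[symmetric])
    ultimately show ?thesis unfolding D_def by (rule filterlim_compose)
  qed
  have A: "(\<integral>x. w k x * \<phi> x \<partial>lborel) = (\<integral>x. u x * D k x \<partial>lborel)" for k
  proof -
    let ?h = "t k *\<^sub>R b"
    have i0: "integrable lborel (\<lambda>x. u x * f x)"
      if [measurable]: "f \<in> borel_measurable borel" and f: "\<And>x. \<bar>f x\<bar> \<le> B" for f
    proof (rule Bochner_Integration.integrable_bound[of _ "\<lambda>x. u x * B"])
      show "integrable lborel (\<lambda>x. u x * B)" using ui by simp
      have "norm (u x * f x) \<le> norm (u x * B)" for x
        using f[of x] B by (simp add: abs_mult mult_left_mono)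
      then show "AE x in lborel. norm (u x * f x) \<le> norm (u x * B)" by simp
    qed measurable
    have i1: "integrable lborel (\<lambda>x. u x * \<phi> x)" using \<phi>B by (intro i0) auto
    have i2: "integrable lborel (\<lambda>x. u x * \<phi> (x - ?h))" using \<phi>B by (intro i0) auto
    have tr: "(\<integral>x. u (x + ?h) * \<phi> x \<partial>lborel) = (\<integral>x. u x * \<phi> (x - ?h) \<partial>lborel)"
      "integrable lborel (\<lambda>x. u (x + ?h) * \<phi> x)"
    proof -
      have "(\<integral>x. u x * \<phi> (x - ?h) \<partial>lborel) = (\<integral>x. u x * \<phi> (x - ?h) \<partial>distr lborel borel ((+) ?h))"
        by (simp add: lborel_distr_plus)
      also have "\<dots> = (\<integral>x. u (x + ?h) * \<phi> x \<partial>lborel)"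
        by (subst integral_distr) (auto simp: add.commute)
      finally show "(\<integral>x. u (x + ?h) * \<phi> x \<partial>lborel) = (\<integral>x. u x * \<phi> (x - ?h) \<partial>lborel)" by simp
      have "integrable (distr lborel borel ((+) ?h)) (\<lambda>x. u x * \<phi> (x - ?h))"
        using i2 by (simp add: lborel_distr_plus)
      then show "integrable lborel (\<lambda>x. u (x + ?h) * \<phi> x)"
        by (subst (asm) integrable_distr_eq) (auto simp: add.commute)
    qed
    have "(\<integral>x. w k x * \<phi> x \<partial>lborel) = (\<integral>x. (u (x + ?h) * \<phi> x - u x * \<phi> x) / t k \<partial>lborel)"
      by (rule Bochner_Integration.integral_cong) (auto simp: w_def fdiff_def algebra_simps diff_divide_distrib)
    also have "\<dots> = ((\<integral>x. u x * \<phi> (x - ?h) \<partial>lborel) - (\<integral>x. u x * \<phi> x \<partial>lborel)) / t k"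
      using tr i1 by simp
    also have "\<dots> = (\<integral>x. (u x * \<phi> (x - ?h) - u x * \<phi> x) / t k \<partial>lborel)"
      using i1 i2 by simp
    also have "\<dots> = (\<integral>x. u x * D k x \<partial>lborel)"
      by (rule Bochner_Integration.integral_cong) (auto simp: D_def algebra_simps diff_divide_distrib)
    finally show ?thesis .
  qed
  have "(\<lambda>k. \<integral>x. u x * D k x \<partial>lborel) \<longlonglongrightarrow> (\<integral>x. u x * - \<psi> x \<partial>lborel)"
  proof (rule integral_dominated_convergence[where w="\<lambda>x. \<bar>u x\<bar> * B"])
    show "integrable lborel (\<lambda>x. \<bar>u x\<bar> * B)" using ui by simp
    show "AE x in lborel. (\<lambda>k. u x * D k x) \<longlonglongrightarrow> u x * - \<psi> x"
      by (intro always_eventually allI tendsto_mult tendsto_const Dlim)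
    have "norm (u x * D k x) \<le> \<bar>u x\<bar> * B" for k x
      using Db[of k x] by (simp add: abs_mult mult_left_mono)
    then show "AE x in lborel. norm (u x * D k x) \<le> \<bar>u x\<bar> * B" for k by simp
  qed auto
  then have L1: "(\<lambda>k. \<integral>x. w k x * \<phi> x \<partial>lborel) \<longlonglongrightarrow> - (\<integral>x. u x * \<psi> x \<partial>lborel)"
    unfolding A by simp
  have L2: "(\<lambda>k. \<integral>x. w k x * \<phi> x \<partial>lborel) \<longlonglongrightarrow> (\<integral>x. g x * \<phi> x \<partial>lborel)"
  proof -
    have gi: "integrable lborel (\<lambda>x. g x * \<phi> x)"
      by (rule l2_pairing_bound(1)[OF g _ gG P(2,1), of 1]) auto
    have lim': "l2sq (\<lambda>x. g x - w k x) \<le> ennreal ((e k)\<^sup>2)" for k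
      unfolding w_def by (rule lim)
    have di: "integrable lborel (\<lambda>x. (g x - w k x) * \<phi> x)"
      and db: "\<bar>\<integral>x. (g x - w k x) * \<phi> x \<partial>lborel\<bar> \<le> (e k * P + (e k)\<^sup>2 / e k) / 2" for k
      using l2_pairing_bound[OF _ _ lim' _ P(2,1) e(1)[of k], of k] by auto
    have eq: "(\<integral>x. w k x * \<phi> x \<partial>lborel) - (\<integral>x. g x * \<phi> x \<partial>lborel) = - (\<integral>x. (g x - w k x) * \<phi> x \<partial>lborel)" for k
    proof -
      have "(\<integral>x. w k x * \<phi> x \<partial>lborel) = (\<integral>x. g x * \<phi> x - (g x - w k x) * \<phi> x \<partial>lborel)"
        by (rule Bochner_Integration.integral_cong) (auto simp: algebra_simps)
      then show ?thesis using gi di[of k] by simp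
    qed
    have "(\<lambda>k. (\<integral>x. w k x * \<phi> x \<partial>lborel) - (\<integral>x. g x * \<phi> x \<partial>lborel)) \<longlonglongrightarrow> 0"
    proof (rule Lim_null_comparison)
      show "(\<lambda>k. (e k * P + e k) / 2) \<longlonglongrightarrow> 0"
        using e(2) by (auto intro!: tendsto_eq_intros)
      have "norm ((\<integral>x. w k x * \<phi> x \<partial>lborel) - (\<integral>x. g x * \<phi> x \<partial>lborel)) \<le> (e k * P + e k) / 2" for k
        using db[of k] e(1)[of k] unfolding eq by (simp add: power2_eq_square)
      then show "\<forall>\<^sub>F k in sequentially. norm ((\<integral>x. w k x * \<phi> x \<partial>lborel) - (\<integral>x. g x * \<phi> x \<partial>lborel))
        \<le> (e k * P + e k) / 2" by (intro always_eventually allI)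
    qed
    then show ?thesis by (rule LIM_zero_cancel)
  qed
  have "(\<integral>x. u x * \<psi> x \<partial>lborel) = - (\<integral>x. g x * \<phi> x \<partial>lborel)"
    using LIMSEQ_unique[OF L1 L2] by simp
  then show "(\<integral>x. u x * pderivs [b] \<phi> x \<partial>lebesgue_on UNIV) = - (\<integral>x. g x * \<phi> x \<partial>lebesgue_on UNIV)"
    unfolding \<psi>_def[symmetric] by (subst (1 2) integral_lebesgue_on_UNIV_eq) auto
qed

lemma integrable_of_l2_bounded_support:
  fixes u :: "'a::euclidean_space \<Rightarrow> real"
  assumes u [measurable]: "u \<in> borel_measurable borel" and 0: "\<And>x. x \<notin> \<Omega> \<Longrightarrow> u x = 0"
    and \<Omega>: "open \<Omega>" "bounded \<Omega>" and N: "l2sq u < \<infinity>"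
  shows "integrable lborel u"
proof (rule Bochner_Integration.integrable_bound)
  have fin: "emeasure lborel \<Omega> < \<infinity>" using \<Omega>(2) by (rule emeasure_bounded_finite)
  have [measurable]: "\<Omega> \<in> sets borel" using \<Omega> by auto
  have "integrable lborel (\<lambda>x. (u x)\<^sup>2)"
    by (rule integrableI_bounded) (use N in \<open>auto simp: l2sq_def\<close>)
  then show "integrable lborel (\<lambda>x. indicator \<Omega> x + (u x)\<^sup>2)"
    using fin by (intro Bochner_Integration.integrable_add) auto
  have "norm (u x) \<le> norm (indicator \<Omega> x + (u x)\<^sup>2)" for x
  proof (cases "x \<in> \<Omega>")
    case True
    have "2 * 1 * \<bar>u x\<bar> \<le> 1\<^sup>2 + \<bar>u x\<bar>\<^sup>2" by (rule sum_squares_bound)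
    then show ?thesis using True by simp
  qed (use 0 in simp)
  then show "AE x in lborel. norm (u x) \<le> norm (indicator \<Omega> x + (u x)\<^sup>2)" by simp
qed measurable

lemma l2sq_diff_le_real:
  fixes f g :: "'a::euclidean_space \<Rightarrow> real"
  assumes [measurable]: "f \<in> borel_measurable borel" "g \<in> borel_measurable borel"
    and f: "l2sq f \<le> ennreal a" "0 \<le> a" and g: "l2sq g \<le> ennreal b" "0 \<le> b"
  shows "l2sq (\<lambda>x. f x - g x) \<le> ennreal (2 * a + 2 * b)"
proof -
  have "l2sq (\<lambda>x. f x - g x) \<le> 2 * l2sq f + 2 * l2sq g" by (rule l2sq_diff_le) measurable
  also have "\<dots> \<le> 2 * ennreal a + 2 * ennreal b" by (intro add_mono mult_left_mono f g) auto
  also have "\<dots> = ennreal (2 * a + 2 * b)" using f g by (simp add: ennreal_mult ennreal_plus)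
  finally show ?thesis .
qed

lemma l2sq_cmult_le:
  fixes f :: "'a::euclidean_space \<Rightarrow> real"
  assumes "f \<in> borel_measurable borel" "l2sq f \<le> ennreal a" "0 \<le> a"
  shows "l2sq (\<lambda>x. c * f x) \<le> ennreal (c\<^sup>2 * a)"
proof -
  have "l2sq (\<lambda>x. c * f x) = ennreal (c\<^sup>2) * l2sq f" by (rule l2sq_cmult) fact
  also have "\<dots> \<le> ennreal (c\<^sup>2) * ennreal a" by (intro mult_left_mono assms) simp
  also have "\<dots> = ennreal (c\<^sup>2 * a)" using assms by (simp add: ennreal_mult)
  finally show ?thesis .
qed

text \<open>Consecutive dyadic difference quotients differ by a second difference divided by the step,
  \<open>2\<^sup>k * (2\<^sup>-\<^sup>k) powr (s + 1 / 2)\<close> in size, so they converge geometrically with ratio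
  \<open>2 powr (1 / 2 - s)\<close>. For the modulus of the limit, \<open>g\<close> is compared with the quotient whose step
  is comparable to \<open>norm h\<close>.\<close>

lemma weak_derivative_estimates:
  fixes \<Omega> :: "'a::euclidean_space set"
  assumes \<Omega>: "open \<Omega>" "bounded \<Omega>" and s: "1 / 2 < s" "s < 1"
    and C: "0 < C" and r: "0 < r" and S: "second_bound s \<Omega> 1 C r"
    and N: "\<And>M u. 0 < M \<Longrightarrow> bounded_source s \<Omega> M u \<Longrightarrow> l2sq u \<le> ennreal (C * M\<^sup>2)"
  shows "\<exists>C'>0. \<exists>\<rho>>0. \<rho> \<le> 1 \<and> (\<forall>M>0. \<forall>u. bounded_source s \<Omega> M u \<longrightarrow> (\<forall>b\<in>Basis. \<exists>g\<in>borel_measurable borel.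
      is_weak_pderiv UNIV b u g \<and> l2sq g \<le> ennreal (C' * M\<^sup>2) \<and>
      (\<forall>h. norm h < \<rho> \<longrightarrow> l2sq (fdiff h g) \<le> ennreal (C' * M\<^sup>2 * norm h powr (2 * (s - 1 / 2))))))"
proof -
  \<comment> \<open>steps start at \<open>2\<^sup>-\<^sup>k\<^sup>0 < r\<close>, where the second difference estimate holds\<close>
  obtain k0 where "1 / r < 2 ^ k0" using real_arch_pow[of 2 "1 / r"] by auto
  then have k0: "1 / 2 ^ k0 < r" using r by (simp add: field_simps)
  define q where "q = 2 powr (- (s - 1 / 2))"
  have q: "0 < q" "q < 1" using s powr_less_mono[of "- (s - 1/2)" 0 2] by (auto simp: q_def)
  define y where "y k = 1 / (2::real) ^ (k0 + k)" for k
  have y: "0 < y k" "y k < r" "y (Suc k) = y k / 2" for k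
  proof -
    show "0 < y k" "y (Suc k) = y k / 2" by (simp_all add: y_def)
    have "y k \<le> 1 / 2 ^ k0" unfolding y_def by (intro divide_left_mono power_increasing) auto
    then show "y k < r" using k0 by linarith
  qed
  have y0: "0 \<le> y k" for k using less_imp_le[OF y(1)] .
  have qy: "(q ^ k0 * q ^ k)\<^sup>2 = y k powr (2 * s - 1)" for k
  proof -
    have "q ^ j = (1 / 2 ^ j) powr (s - 1 / 2)" for j
      unfolding q_def two_powr_minus_power by (simp add: powr_divide two_power_powr)
    from this[of "k0 + k"] have "q ^ k0 * q ^ k = y k powr (s - 1 / 2)"
      by (simp only: y_def power_add)
    then show ?thesis by (simp add: power2_eq_square powr_add[symmetric])
  qed
  define C' where "C' = C * (8 * 4 ^ k0 + 8 / (1 - q)\<^sup>2 + 4)"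
  have C': "0 < C'" using C q by (auto simp: C'_def intro!: mult_pos_pos add_nonneg_pos)
  have main: "\<exists>g\<in>borel_measurable borel. is_weak_pderiv UNIV b u g \<and> l2sq g \<le> ennreal (C' * M\<^sup>2) \<and>
      (\<forall>h. norm h < 1 / 2 ^ k0 \<longrightarrow> l2sq (fdiff h g) \<le> ennreal (C' * M\<^sup>2 * norm h powr (2 * (s - 1 / 2))))"
    if M: "0 < M" and u: "bounded_source s \<Omega> M u" and b: "b \<in> Basis" for M u b
  proof -
    have un: "u \<in> energy_class s \<Omega>" using u by (simp add: bounded_source_def)
    then have um [measurable]: "u \<in> borel_measurable borel" by (simp add: energy_class_def)
    have bn: "norm b = 1" using b by simp
    have sb: "l2sq (fdiff k (fdiff h u)) \<le> ennreal (C * M\<^sup>2 * norm k powr (2 * s) * norm h)"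
      if "norm h < r" "norm k < r" for h k
      using S M u that by (simp add: second_bound_def powr_one')
    define \<eta> where "\<eta> k = y k *\<^sub>R b" for k
    have \<eta>n: "norm (\<eta> k) = y k" for k using y(1)[of k] bn by (simp add: \<eta>_def)
    define w where "w k x = (1 / y k) * fdiff (\<eta> k) u x" for k x
    have wm [measurable]: "w k \<in> borel_measurable borel" for k unfolding w_def by measurable
    define D where "D = sqrt C * M * q ^ k0"
    have D: "0 \<le> D" using C M q by (simp add: D_def)
    have Dq: "(D * q ^ k)\<^sup>2 = C * M\<^sup>2 * y k powr (2 * s - 1)" for k
    proof -
      have "(D * q ^ k)\<^sup>2 = (sqrt C * M)\<^sup>2 * (q ^ k0 * q ^ k)\<^sup>2"
        by (simp add: D_def power_mult_distrib mult_ac)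
      then show ?thesis using C by (simp only: qy) (simp add: power_mult_distrib)
    qed
    have step: "l2sq (\<lambda>x. w (Suc k) x - w k x) \<le> ennreal ((D * q ^ k)\<^sup>2)" for k
    proof -
      have \<eta>2: "\<eta> k = \<eta> (Suc k) + \<eta> (Suc k)"
        unfolding \<eta>_def y(3) by (simp add: scaleR_add_left[symmetric])
      have eq: "(\<lambda>x. w (Suc k) x - w k x) = (\<lambda>x. - (1 / y k) * fdiff (\<eta> (Suc k)) (fdiff (\<eta> (Suc k)) u) x)"
        using y(1)[of k] by (simp add: w_def fdiff_def y(3) \<eta>2 add.assoc field_simps fun_eq_iff)
      have "l2sq (\<lambda>x. - (1 / y k) * fdiff (\<eta> (Suc k)) (fdiff (\<eta> (Suc k)) u) x)
          \<le> ennreal ((- (1 / y k))\<^sup>2 * (C * M\<^sup>2 * norm (\<eta> (Suc k)) powr (2 * s) * norm (\<eta> (Suc k))))"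
        using C y(2) y0 by (intro l2sq_cmult_le sb) (auto simp: \<eta>n intro!: mult_nonneg_nonneg)
      also have "\<dots> \<le> ennreal ((D * q ^ k)\<^sup>2)"
      proof (rule ennreal_leI)
        have "(- (1 / y k))\<^sup>2 * (C * M\<^sup>2 * norm (\<eta> (Suc k)) powr (2 * s) * norm (\<eta> (Suc k)))
          \<le> (- (1 / y k))\<^sup>2 * (C * M\<^sup>2 * y k powr (2 * s) * y k)"
          unfolding \<eta>n using y(1)[of k] s C M unfolding y(3)
          by (intro mult_left_mono mult_mono powr_mono2) (auto intro!: mult_nonneg_nonneg)
        also have "\<dots> = C * M\<^sup>2 * (y k powr (2 * s) / y k)"
          using y(1)[of k] by (simp add: field_simps power2_eq_square)
        also have "y k powr (2 * s) / y k = y k powr (2 * s - 1)"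
          using y(1)[of k] by (simp add: powr_diff)
        finally show "(- (1 / y k))\<^sup>2 * (C * M\<^sup>2 * norm (\<eta> (Suc k)) powr (2 * s) * norm (\<eta> (Suc k)))
          \<le> (D * q ^ k)\<^sup>2" by (simp only: Dq)
      qed
      finally show ?thesis unfolding eq .
    qed
    obtain g where gm [measurable]: "g \<in> borel_measurable borel"
      and g: "\<And>k. l2sq (\<lambda>x. g x - w k x) \<le> ennreal ((D * q ^ k / (1 - q))\<^sup>2)"
      using l2_limit_of_geometric[OF wm q D step] by blast
    define Q where "Q = 1 / (1 - q)\<^sup>2"
    have Q: "0 \<le> Q" by (simp add: Q_def)
    have g': "l2sq (\<lambda>x. w k x - g x) \<le> ennreal (C * M\<^sup>2 * y k powr (2 * s - 1) * Q)" for k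
    proof -
      have "(D * q ^ k / (1 - q))\<^sup>2 = C * M\<^sup>2 * y k powr (2 * s - 1) * Q"
        unfolding power_divide Dq by (simp add: Q_def)
      then show ?thesis using g[of k] by (simp add: l2sq_uminus[of "w k"])
    qed
    have CM: "0 \<le> C * M\<^sup>2" using C by simp
    have gsq: "l2sq g \<le> ennreal (C' * M\<^sup>2)"
    proof -
      have w0: "l2sq (w 0) \<le> ennreal ((1 / y 0)\<^sup>2 * (4 * (C * M\<^sup>2)))"
        unfolding w_def using CM N[OF M u] by (intro l2sq_cmult_le l2sq_fdiff_le) auto
      have "l2sq g = l2sq (\<lambda>x. w 0 x - (w 0 x - g x))" by simp
      also have "\<dots> \<le> ennreal (2 * ((1 / y 0)\<^sup>2 * (4 * (C * M\<^sup>2))) + 2 * (C * M\<^sup>2 * y 0 powr (2 * s - 1) * Q))"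
        using CM Q by (intro l2sq_diff_le_real w0 g') auto
      also have "\<dots> \<le> ennreal (C' * M\<^sup>2)"
      proof (rule ennreal_leI)
        have "(1 / y 0)\<^sup>2 = 4 ^ k0"
          by (simp add: y_def power2_eq_square power_mult_distrib[symmetric])
        moreover have "y 0 powr (2 * s - 1) \<le> 1" using s y(1)[of 0] by (intro powr_le1) (auto simp: y_def)
        then have "2 * (C * M\<^sup>2 * y 0 powr (2 * s - 1) * Q) \<le> 2 * (C * M\<^sup>2 * 1 * Q)"
          using CM Q by (intro mult_left_mono mult_right_mono) auto
        moreover have "C' * M\<^sup>2 = C * M\<^sup>2 * (8 * 4 ^ k0) + C * M\<^sup>2 * (8 * Q) + 4 * (C * M\<^sup>2)"
          by (simp add: C'_def Q_def algebra_simps)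
        moreover have "0 \<le> C * M\<^sup>2 * Q" using CM Q by simp
        ultimately show "2 * ((1 / y 0)\<^sup>2 * (4 * (C * M\<^sup>2))) + 2 * (C * M\<^sup>2 * y 0 powr (2 * s - 1) * Q) \<le> C' * M\<^sup>2"
          using CM by simp
      qed
      finally show ?thesis .
    qed
    have gdiff: "l2sq (fdiff h g) \<le> ennreal (C' * M\<^sup>2 * norm h powr (2 * (s - 1 / 2)))" if h: "norm h < 1 / 2 ^ k0" for h
    proof (cases "h = 0")
      case True
      then show ?thesis by (simp add: fdiff_def l2sq_def)
    next
      case False
      then have hp: "0 < norm h" by simp
      obtain j where "1 / norm h < 2 ^ j" using real_arch_pow[of 2 "1 / norm h"] by auto
      then have "1 / 2 ^ j < norm h" using hp by (simp add: field_simps)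
      moreover have "y j \<le> 1 / 2 ^ j" unfolding y_def by (intro divide_left_mono power_increasing) auto
      ultimately have ex: "y j \<le> norm h" by simp
      \<comment> \<open>the dyadic step with \<open>y i \<le> norm h < 2 * y i\<close>\<close>
      define i where "i = (LEAST j. y j \<le> norm h)"
      have i: "y i \<le> norm h" unfolding i_def by (rule LeastI[of _ j]) (rule ex)
      have "i \<noteq> 0" using i h by (cases i) (auto simp: y_def)
      then obtain l where l: "i = Suc l" using not0_implies_Suc by blast
      have "norm h < y l" using not_less_Least[of l "\<lambda>j. y j \<le> norm h"] l by (auto simp: i_def[symmetric])
      then have i2: "norm h < 2 * y i" using l y(3)[of l] by simp
      have hr: "norm h < r" using h k0 by simp
      define Y where "Y = norm h powr (2 * s - 1)"
      have Y: "y i powr (2 * s - 1) \<le> Y" unfolding Y_def using i s y(1)[of i] by (intro powr_mono2) auto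
      have "l2sq (\<lambda>x. w i x - g x) \<le> ennreal (C * M\<^sup>2 * Y * Q)"
        using g'[of i] Y CM Q by (elim order_trans) (intro ennreal_leI mult_right_mono mult_left_mono, auto)
      then have 1: "l2sq (fdiff h (\<lambda>x. w i x - g x)) \<le> ennreal (4 * (C * M\<^sup>2 * Y * Q))"
        using CM Q by (intro l2sq_fdiff_le) (auto simp: Y_def)
      have eq1: "fdiff h (w i) = (\<lambda>x. (1 / y i) * fdiff h (fdiff (\<eta> i) u) x)"
        by (simp add: w_def[abs_def] fdiff_def fun_eq_iff algebra_simps diff_divide_distrib)
      have "l2sq (\<lambda>x. (1 / y i) * fdiff h (fdiff (\<eta> i) u) x)
          \<le> ennreal ((1 / y i)\<^sup>2 * (C * M\<^sup>2 * norm h powr (2 * s) * norm (\<eta> i)))"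
        using C hr y(2) y0 by (intro l2sq_cmult_le sb) (auto simp: \<eta>n intro!: mult_nonneg_nonneg)
      also have "\<dots> \<le> ennreal (2 * (C * M\<^sup>2 * Y))"
      proof (rule ennreal_leI)
        have "(1 / y i)\<^sup>2 * (C * M\<^sup>2 * norm h powr (2 * s) * norm (\<eta> i)) = C * M\<^sup>2 * (norm h powr (2 * s) / y i)"
          unfolding \<eta>n using y(1)[of i] by (simp add: field_simps power2_eq_square)
        also have "norm h powr (2 * s) / y i \<le> norm h powr (2 * s) / (norm h / 2)"
          using i2 hp y(1)[of i] by (intro divide_left_mono) auto
        also have "\<dots> = 2 * Y" using hp by (simp add: Y_def powr_diff)
        finally show "(1 / y i)\<^sup>2 * (C * M\<^sup>2 * norm h powr (2 * s) * norm (\<eta> i)) \<le> 2 * (C * M\<^sup>2 * Y)"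
          using CM by (simp add: mult_left_mono)
      qed
      finally have 2: "l2sq (fdiff h (w i)) \<le> ennreal (2 * (C * M\<^sup>2 * Y))" unfolding eq1 .
      have eq2: "fdiff h g = (\<lambda>x. fdiff h (w i) x - fdiff h (\<lambda>x. w i x - g x) x)"
        by (simp add: fdiff_def fun_eq_iff)
      have "l2sq (\<lambda>x. fdiff h (w i) x - fdiff h (\<lambda>x. w i x - g x) x)
          \<le> ennreal (2 * (2 * (C * M\<^sup>2 * Y)) + 2 * (4 * (C * M\<^sup>2 * Y * Q)))"
        using CM Q by (intro l2sq_diff_le_real 1 2) (auto simp: Y_def)
      also have "\<dots> \<le> ennreal (C' * M\<^sup>2 * Y)"
      proof (rule ennreal_leI)
        have "C' * M\<^sup>2 * Y = C * M\<^sup>2 * Y * (8 * 4 ^ k0) + 2 * (2 * (C * M\<^sup>2 * Y)) + 2 * (4 * (C * M\<^sup>2 * Y * Q))"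
          by (simp add: C'_def Q_def algebra_simps)
        moreover have "0 \<le> C * M\<^sup>2 * Y * (8 * 4 ^ k0)" using CM by (simp add: Y_def)
        ultimately show "2 * (2 * (C * M\<^sup>2 * Y)) + 2 * (4 * (C * M\<^sup>2 * Y * Q)) \<le> C' * M\<^sup>2 * Y" by linarith
      qed
      finally show ?thesis unfolding eq2 by (simp add: Y_def right_diff_distrib)
    qed
    have "is_weak_pderiv UNIV b u g"
    proof (rule weak_pderiv_of_difference_limit[OF um _ gm gsq _ b, where t=y and e="\<lambda>k. (D + 1) * q ^ k / (1 - q)"])
      show "integrable lborel u"
        using un by (intro integrable_of_l2_bounded_support[OF um _ \<Omega>]) (auto simp: energy_class_def)
      show "0 \<le> C' * M\<^sup>2" using C' by simp
      show "0 < y k" for k by (rule y)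
      have "(\<lambda>k. (1 / 2 ^ k0) * (1 / 2 :: real) ^ k) \<longlonglongrightarrow> (1 / 2 ^ k0) * 0"
        by (intro tendsto_mult tendsto_const LIMSEQ_realpow_zero) auto
      then show "y \<longlonglongrightarrow> 0" by (simp add: y_def[abs_def] power_add power_divide)
      show "0 < (D + 1) * q ^ k / (1 - q)" for k using D q by simp
      have "(\<lambda>k. (D + 1) * q ^ k / (1 - q)) \<longlonglongrightarrow> (D + 1) * 0 / (1 - q)"
        using q by (intro tendsto_intros LIMSEQ_realpow_zero) auto
      then show "(\<lambda>k. (D + 1) * q ^ k / (1 - q)) \<longlonglongrightarrow> 0" by simp
      fix k
      have "l2sq (\<lambda>x. g x - fdiff (y k *\<^sub>R b) u x / y k) \<le> ennreal ((D * q ^ k / (1 - q))\<^sup>2)"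
        using g[of k] by (simp add: w_def \<eta>_def)
      also have "\<dots> \<le> ennreal (((D + 1) * q ^ k / (1 - q))\<^sup>2)"
        using D q by (intro ennreal_leI power_mono divide_right_mono mult_right_mono) auto
      finally show "l2sq (\<lambda>x. g x - fdiff (y k *\<^sub>R b) u x / y k) \<le> ennreal (((D + 1) * q ^ k / (1 - q))\<^sup>2)" .
    qed
    then show ?thesis using gm gsq gdiff by blast
  qed
  have "(0::real) < 1 / 2 ^ k0" "1 / 2 ^ k0 \<le> (1::real)" by auto
  then show ?thesis using C' main by (intro exI[of _ C'] conjI exI[of _ "1 / 2 ^ k0"] allI impI ballI) auto
qed

section \<open>Smooth bump functions\<close>

lemma pderivs_snoc: "pderivs (bs @ [b]) f = pderivs bs (pderivs [b] f)"
  by (induction bs) auto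

text \<open>To show smoothness it suffices to exhibit a class of differentiable functions that is closed under
  partial derivatives.\<close>

lemma smooth_coinduct:
  fixes f :: "'a::euclidean_space \<Rightarrow> real"
  assumes "P f" and diff: "\<And>f x. P f \<Longrightarrow> f differentiable at x"
    and step: "\<And>f b. P f \<Longrightarrow> b \<in> Basis \<Longrightarrow> P (pderivs [b] f)"
  shows "smooth f"
proof -
  have "pderivs bs f differentiable_on UNIV" if "P f" "set bs \<subseteq> Basis" for bs f
    using that
  proof (induction bs arbitrary: f rule: rev_induct)
    case Nil
    then show ?case using diff by (auto simp: differentiable_on_def)
  next
    case (snoc b bs)
    then show ?case using step by (simp add: pderivs_snoc del: pderivs.simps)
  qed
  then show ?thesis using \<open>P f\<close> by (auto simp: smooth_def multi_indices_def)
qed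

lemma frechet_derivative_eqI:
  "(f has_derivative f') (at x) \<Longrightarrow> frechet_derivative f (at x) v = f' v"
  by (metis frechet_derivative_at)

text \<open>The algebra generated by the ridge functions \<open>\<psi> k (v \<bullet> x + c)\<close>; it is closed under
  partial derivatives as soon as \<open>\<psi> (Suc k)\<close> is the derivative of \<open>\<psi> k\<close>.\<close>

inductive smooth_alg :: "(nat \<Rightarrow> real \<Rightarrow> real) \<Rightarrow> ('a::euclidean_space \<Rightarrow> real) \<Rightarrow> bool" for \<psi> where
  const: "smooth_alg \<psi> (\<lambda>x. c)"
| atom: "smooth_alg \<psi> (\<lambda>x. \<psi> k (v \<bullet> x + c))"
| add: "smooth_alg \<psi> f \<Longrightarrow> smooth_alg \<psi> g \<Longrightarrow> smooth_alg \<psi> (\<lambda>x. f x + g x)"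
| mult: "smooth_alg \<psi> f \<Longrightarrow> smooth_alg \<psi> g \<Longrightarrow> smooth_alg \<psi> (\<lambda>x. f x * g x)"

lemma smooth_alg_derivative:
  assumes \<psi>: "\<And>k t. (\<psi> k has_real_derivative \<psi> (Suc k) t) (at t)" and f: "smooth_alg \<psi> f"
  shows "\<exists>f'. (\<forall>x. (f has_derivative f' x) (at x)) \<and> (\<forall>b. smooth_alg \<psi> (\<lambda>x. f' x b))"
  using f
proof induction
  case (const c)
  then show ?case by (intro exI[of _ "\<lambda>x v. 0"]) (auto intro: smooth_alg.const)
next
  case (atom k v c)
  have "((\<lambda>x. \<psi> k (v \<bullet> x + c)) has_derivative (\<lambda>h. \<psi> (Suc k) (v \<bullet> x + c) * (v \<bullet> h))) (at x)" for x
    by (rule has_derivative_compose[OF _ \<psi>[unfolded has_field_derivative_def]])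
      (auto intro!: derivative_eq_intros)
  then show ?case
    by (intro exI[of _ "\<lambda>x h. \<psi> (Suc k) (v \<bullet> x + c) * (v \<bullet> h)"])
      (auto intro!: smooth_alg.mult[of \<psi> "\<lambda>x. \<psi> (Suc k) (v \<bullet> x + c)"] smooth_alg.const smooth_alg.atom)
next
  case (add f g)
  then obtain f' g' where "\<And>x. (f has_derivative f' x) (at x)" "\<And>b. smooth_alg \<psi> (\<lambda>x. f' x b)"
    "\<And>x. (g has_derivative g' x) (at x)" "\<And>b. smooth_alg \<psi> (\<lambda>x. g' x b)" by blast
  then show ?case
    by (intro exI[of _ "\<lambda>x h. f' x h + g' x h"]) (auto intro!: derivative_intros smooth_alg.add)
next
  case (mult f g)
  then obtain f' g' where "\<And>x. (f has_derivative f' x) (at x)" "\<And>b. smooth_alg \<psi> (\<lambda>x. f' x b)"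
    "\<And>x. (g has_derivative g' x) (at x)" "\<And>b. smooth_alg \<psi> (\<lambda>x. g' x b)" by blast
  then show ?case using mult.hyps
    by (intro exI[of _ "\<lambda>x h. f x * g' x h + f' x h * g x"])
      (auto intro!: has_derivative_mult smooth_alg.add smooth_alg.mult)
qed

lemma smooth_alg_smooth:
  assumes \<psi>: "\<And>k t. (\<psi> k has_real_derivative \<psi> (Suc k) t) (at t)" and f: "smooth_alg \<psi> f"
  shows "smooth f"
proof (rule smooth_coinduct[where P="smooth_alg \<psi>", OF f])
  fix f :: "'a \<Rightarrow> real" assume "smooth_alg \<psi> f"
  from smooth_alg_derivative[OF \<psi> this]
  obtain f' where f': "\<And>x. (f has_derivative f' x) (at x)" "\<And>b. smooth_alg \<psi> (\<lambda>x. f' x b)"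
    by blast
  show "f differentiable at x" for x using f'(1) by (rule differentiableI)
  show "smooth_alg \<psi> (pderivs [b] f)" for b
    using f'(2)[of b] frechet_derivative_eqI[OF f'(1)] by simp
qed

lemma smooth_alg_prod:
  assumes "\<And>i. i \<in> I \<Longrightarrow> smooth_alg \<psi> (f i)"
  shows "smooth_alg \<psi> (\<lambda>x. \<Prod>i\<in>I. f i x)"
  using assms by (induction I rule: infinite_finite_induct)
    (auto intro: smooth_alg.const smooth_alg.mult)

text \<open>The polynomial \<open>P k\<close> for which the \<open>k\<close>-th derivative of \<open>exp (- c / t)\<close> is
  \<open>P k (1 / t) * exp (- c / t)\<close>. All derivatives are given by formulas, so that they can be glued to
  zero on the negative half-line one at a time.\<close>

primrec flat_poly :: "real \<Rightarrow> nat \<Rightarrow> real poly" where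
  "flat_poly c 0 = 1"
| "flat_poly c (Suc k) = [:0, 0, 1:] * (smult c (flat_poly c k) - pderiv (flat_poly c k))"

definition flat_deriv :: "real \<Rightarrow> nat \<Rightarrow> real \<Rightarrow> real" where
  "flat_deriv c k t = (if 0 < t then poly (flat_poly c k) (1 / t) * exp (- (c / t)) else 0)"

lemma poly_exp_decay:
  fixes c :: real and p :: "real poly"
  assumes c: "0 < c"
  shows "((\<lambda>x. poly p x * exp (- (c * x))) \<longlongrightarrow> 0) at_top"
proof -
  have "((\<lambda>x. \<Sum>i\<le>degree p. coeff p i * (x ^ i * exp (- (c * x)))) \<longlongrightarrow> (\<Sum>i\<le>degree p. coeff p i * 0)) at_top"
  proof (intro tendsto_sum tendsto_mult tendsto_const)
    fix i
    have "filterlim (\<lambda>x. c * x) at_top at_top"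
      by (rule filterlim_tendsto_pos_mult_at_top[OF tendsto_const c filterlim_ident])
    from filterlim_compose[OF tendsto_power_div_exp_0 this, of i]
    have "((\<lambda>x. (1 / c ^ i) * ((c * x) ^ i / exp (c * x))) \<longlongrightarrow> (1 / c ^ i) * 0) at_top"
      by (intro tendsto_mult tendsto_const)
    then show "((\<lambda>x. x ^ i * exp (- (c * x))) \<longlongrightarrow> 0) at_top"
      using c by (simp add: power_mult_distrib exp_minus field_simps)
  qed
  then show ?thesis by (simp add: poly_altdef sum_distrib_right mult.assoc)
qed

lemma flat_deriv_has_derivative:
  assumes c: "0 < c"
  shows "(flat_deriv c k has_real_derivative flat_deriv c (Suc k) t) (at t)"
proof -
  consider "t < 0" | "t = 0" | "0 < t" by linarith
  then show ?thesis
  proof cases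
    case 1
    have "((\<lambda>t. 0) has_real_derivative 0) (at t)" by simp
    then have "(flat_deriv c k has_real_derivative 0) (at t)"
      by (rule has_field_derivative_transform_within_open[where S="{..<0}"])
        (use 1 in \<open>auto simp: flat_deriv_def\<close>)
    then show ?thesis using 1 by (simp add: flat_deriv_def)
  next
    case 3
    have "((\<lambda>t. poly (flat_poly c k) (1 / t) * exp (- (c / t))) has_real_derivative
        poly (flat_poly c (Suc k)) (1 / t) * exp (- (c / t))) (at t)"
      using 3 by (auto intro!: derivative_eq_intros DERIV_chain2[OF poly_DERIV]
          simp: field_simps power2_eq_square)
    then have "(flat_deriv c k has_real_derivative poly (flat_poly c (Suc k)) (1 / t) * exp (- (c / t))) (at t)"
      by (rule has_field_derivative_transform_within_open[where S="{0<..}"])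
        (use 3 in \<open>auto simp: flat_deriv_def\<close>)
    then show ?thesis using 3 by (simp add: flat_deriv_def)
  next
    case 2
    have "((\<lambda>h. flat_deriv c k h / h) \<longlongrightarrow> 0) (at_right 0)"
    proof -
      have "((\<lambda>x. poly ([:0, 1:] * flat_poly c k) x * exp (- (c * x))) \<longlongrightarrow> 0) at_top"
        by (rule poly_exp_decay[OF c])
      then have "((\<lambda>h. poly ([:0, 1:] * flat_poly c k) (inverse h) * exp (- (c * inverse h))) \<longlongrightarrow> 0) (at_right 0)"
        by (rule filterlim_compose[OF _ filterlim_inverse_at_top_right])
      moreover have "\<forall>\<^sub>F h in at_right 0. poly ([:0, 1:] * flat_poly c k) (inverse h) * exp (- (c * inverse h))
          = flat_deriv c k h / h"
        unfolding eventually_at_right_field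
        by (intro exI[of _ 1]) (auto simp: flat_deriv_def field_simps)
      ultimately show ?thesis by (rule Lim_transform_eventually)
    qed
    moreover have "((\<lambda>h. flat_deriv c k h / h) \<longlongrightarrow> 0) (at_left 0)"
    proof -
      have "\<forall>\<^sub>F h in at_left (0::real). 0 = flat_deriv c k h / h"
        unfolding eventually_at_left_field
        by (intro exI[of _ "-1"]) (auto simp: flat_deriv_def)
      then show ?thesis by (rule Lim_transform_eventually[OF tendsto_const])
    qed
    ultimately have "((\<lambda>h. flat_deriv c k h / h) \<longlongrightarrow> 0) (at 0)"
      by (simp add: filterlim_split_at)
    then show ?thesis using 2 by (simp add: DERIV_def flat_deriv_def)
  qed
qed

text \<open>Products over all faces of the box. As \<open>c\<close> tends to zero the functions increase to the
  indicator of the open box, which makes a separate plateau construction unnecessary.\<close>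

definition box_bump :: "'a::euclidean_space \<Rightarrow> 'a \<Rightarrow> real \<Rightarrow> 'a \<Rightarrow> real" where
  "box_bump l u c x = (\<Prod>b\<in>Basis. flat_deriv c 0 (b \<bullet> x + - (l \<bullet> b)) * flat_deriv c 0 (- b \<bullet> x + u \<bullet> b))"

lemma box_bump_smooth:
  fixes l u :: "'a::euclidean_space"
  assumes "0 < c" shows "smooth (box_bump l u c)"
  unfolding box_bump_def[abs_def]
  by (rule smooth_alg_smooth[of "flat_deriv c", OF flat_deriv_has_derivative[OF assms]])
    (intro smooth_alg_prod smooth_alg.mult smooth_alg.atom)

lemma box_bump_eq:
  assumes c: "0 < c"
  shows "box_bump l u c x = indicator (box l u) x *
    exp (- c * (\<Sum>b\<in>Basis. 1 / (x \<bullet> b - l \<bullet> b) + 1 / (u \<bullet> b - x \<bullet> b)))"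
proof (cases "x \<in> box l u")
  case True
  have "box_bump l u c x = (\<Prod>b\<in>Basis. exp (- c * (1 / (x \<bullet> b - l \<bullet> b) + 1 / (u \<bullet> b - x \<bullet> b))))"
    unfolding box_bump_def
  proof (rule prod.cong)
    fix b :: 'a assume "b \<in> Basis"
    then have "0 < x \<bullet> b - l \<bullet> b" "0 < u \<bullet> b - x \<bullet> b" using True by (auto simp: box_def)
    then show "flat_deriv c 0 (b \<bullet> x + - (l \<bullet> b)) * flat_deriv c 0 (- b \<bullet> x + u \<bullet> b)
      = exp (- c * (1 / (x \<bullet> b - l \<bullet> b) + 1 / (u \<bullet> b - x \<bullet> b)))"
      by (simp add: flat_deriv_def inner_commute[of b] exp_add[symmetric] algebra_simps)
  qed simp
  also have "\<dots> = exp (\<Sum>b\<in>Basis. - c * (1 / (x \<bullet> b - l \<bullet> b) + 1 / (u \<bullet> b - x \<bullet> b)))"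
    by (simp add: exp_sum)
  also have "(\<Sum>b\<in>Basis. - c * (1 / (x \<bullet> b - l \<bullet> b) + 1 / (u \<bullet> b - x \<bullet> b)))
      = - c * (\<Sum>b\<in>Basis. 1 / (x \<bullet> b - l \<bullet> b) + 1 / (u \<bullet> b - x \<bullet> b))"
    by (rule sum_distrib_left[symmetric])
  finally show ?thesis using True by simp
next
  case False
  then obtain b where b: "b \<in> Basis" "\<not> (l \<bullet> b < x \<bullet> b \<and> x \<bullet> b < u \<bullet> b)" by (auto simp: box_def)
  then have "flat_deriv c 0 (b \<bullet> x + - (l \<bullet> b)) * flat_deriv c 0 (- b \<bullet> x + u \<bullet> b) = 0"
    by (auto simp: flat_deriv_def inner_commute[of b])
  then have "box_bump l u c x = 0" unfolding box_bump_def using b(1) by (intro prod_zero) auto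
  then show ?thesis using False by simp
qed

lemma box_bump_test_function:
  assumes "0 < c" shows "box_bump l u c \<in> test_functions UNIV"
proof -
  have "box_bump l u c x = 0" if "x \<notin> cbox l u" for x
  proof -
    have "x \<notin> box l u" using that box_subset_cbox[of l u] by blast
    then show ?thesis by (simp add: box_bump_eq[OF assms])
  qed
  then show ?thesis using box_bump_smooth[OF assms] by (auto simp: test_functions_def intro!: exI[of _ "cbox l u"])
qed

section \<open>Uniqueness of weak derivatives\<close>

lemma box_integral_zero:
  fixes d :: "'a::euclidean_space \<Rightarrow> real"
  assumes d [measurable]: "d \<in> borel_measurable borel" and fin: "l2sq d \<le> ennreal F" "0 \<le> F"
    and 0: "\<And>\<phi>. \<phi> \<in> test_functions UNIV \<Longrightarrow> \<phi> \<in> borel_measurable borel \<Longrightarrow> (\<integral>x. d x * \<phi> x \<partial>lborel) = 0"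
  shows "integrable lborel (\<lambda>x. d x * indicator (box l u) x)"
    and "(\<integral>x. d x * indicator (box l u) x \<partial>lborel) = 0"
proof -
  have [measurable]: "box l u \<in> sets borel" by simp
  have "\<exists>P\<ge>0. l2sq (indicator (box l u) :: 'a \<Rightarrow> real) \<le> ennreal P"
    by (rule l2sq_bounded_compact_support[of "cbox l u" _ 1])
      (use box_subset_cbox[of l u] in \<open>auto simp: indicator_def\<close>)
  then obtain P where P: "0 \<le> P" "l2sq (indicator (box l u) :: 'a \<Rightarrow> real) \<le> ennreal P" by blast
  show i: "integrable lborel (\<lambda>x. d x * indicator (box l u) x)"
    by (rule l2_pairing_bound(1)[OF d _ fin P(2,1), of 1]) auto
  define c where "c k = 1 / real (Suc k)" for k
  have c: "0 < c k" for k by (simp add: c_def)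
  have bm [measurable]: "box_bump l u (c k) \<in> borel_measurable borel" for k
  proof -
    have "continuous_on UNIV (box_bump l u (c k))"
      using SOME_Basis by (rule test_function_facts(2)[OF box_bump_test_function[OF c]])
    then show ?thesis by (rule borel_measurable_continuous_onI)
  qed
  have "(\<lambda>k. \<integral>x. d x * box_bump l u (c k) x \<partial>lborel) \<longlonglongrightarrow> (\<integral>x. d x * indicator (box l u) x \<partial>lborel)"
  proof (rule integral_dominated_convergence[where w="\<lambda>x. \<bar>d x * indicator (box l u) x\<bar>"])
    show "integrable lborel (\<lambda>x. \<bar>d x * indicator (box l u) x\<bar>)" using i by simp
    have "(\<lambda>k. d x * box_bump l u (c k) x) \<longlonglongrightarrow> d x * indicator (box l u) x" for x
    proof -
      have c0: "c \<longlonglongrightarrow> 0" unfolding c_def[abs_def] by (rule LIMSEQ_inverse_real_of_nat[unfolded inverse_eq_divide])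
      have "(\<lambda>k. indicator (box l u) x * exp (- c k * (\<Sum>b\<in>Basis. 1 / (x \<bullet> b - l \<bullet> b) + 1 / (u \<bullet> b - x \<bullet> b))))
          \<longlonglongrightarrow> indicator (box l u) x * exp (- 0 * (\<Sum>b\<in>Basis. 1 / (x \<bullet> b - l \<bullet> b) + 1 / (u \<bullet> b - x \<bullet> b)))"
        by (intro tendsto_mult tendsto_const tendsto_exp tendsto_minus c0)
      then show ?thesis unfolding box_bump_eq[OF c] by (intro tendsto_mult tendsto_const) simp
    qed
    then show "AE x in lborel. (\<lambda>k. d x * box_bump l u (c k) x) \<longlonglongrightarrow> d x * indicator (box l u) x" by simp
    have "norm (d x * box_bump l u (c k) x) \<le> \<bar>d x * indicator (box l u) x\<bar>" for k x
    proof (cases "x \<in> box l u")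
      case True
      then have "0 \<le> (\<Sum>b\<in>Basis. 1 / (x \<bullet> b - l \<bullet> b) + 1 / (u \<bullet> b - x \<bullet> b))"
        by (intro sum_nonneg add_nonneg_nonneg) (auto simp: box_def intro: less_imp_le)
      then have "exp (- c k * (\<Sum>b\<in>Basis. 1 / (x \<bullet> b - l \<bullet> b) + 1 / (u \<bullet> b - x \<bullet> b))) \<le> 1"
        using c[of k] by (simp add: mult_nonneg_nonneg less_imp_le)
      then show ?thesis using True unfolding box_bump_eq[OF c] by (simp add: abs_mult mult_left_le)
    qed (simp add: box_bump_eq[OF c])
    then show "AE x in lborel. norm (d x * box_bump l u (c k) x) \<le> \<bar>d x * indicator (box l u) x\<bar>" for k by simp
  qed measurable
  moreover have "(\<integral>x. d x * box_bump l u (c k) x \<partial>lborel) = 0" for k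
    by (rule 0[OF box_bump_test_function[OF c] bm])
  ultimately show "(\<integral>x. d x * indicator (box l u) x \<partial>lborel) = 0"
    by (simp add: LIMSEQ_const_iff)
qed

text \<open>Boxes form an intersection-stable generator, so the densities given by the positive and the negative
  part coincide as measures.\<close>

lemma AE_zero_of_box_integrals:
  fixes d :: "'a::euclidean_space \<Rightarrow> real"
  assumes d [measurable]: "d \<in> borel_measurable borel"
    and i: "\<And>l u. integrable lborel (\<lambda>x. d x * indicator (box l u) x)"
    and 0: "\<And>l u. (\<integral>x. d x * indicator (box l u) x \<partial>lborel) = 0"
  shows "AE x in lborel. d x = 0"
proof -
  let ?p = "\<lambda>x. ennreal (d x)" and ?m = "\<lambda>x. ennreal (- d x)"
  have fin: "(\<integral>\<^sup>+x. ?p x * indicator (box l u) x \<partial>lborel) < \<infinity>" for l u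
  proof -
    have "(\<integral>\<^sup>+x. ?p x * indicator (box l u) x \<partial>lborel) \<le> (\<integral>\<^sup>+x. ennreal (norm (d x * indicator (box l u) x)) \<partial>lborel)"
      by (intro nn_integral_mono) (auto simp: indicator_def intro: ennreal_leI)
    also have "\<dots> < \<infinity>" using i[of l u] by (simp add: integrable_iff_bounded)
    finally show ?thesis .
  qed
  have eq: "(\<integral>\<^sup>+x. ?p x * indicator (box l u) x \<partial>lborel) = (\<integral>\<^sup>+x. ?m x * indicator (box l u) x \<partial>lborel)" for l u
  proof -
    let ?f = "\<lambda>x. d x * indicator (box l u) x"
    have pm: "(\<integral>\<^sup>+x. ?p x * indicator (box l u) x \<partial>lborel) = (\<integral>\<^sup>+x. ennreal (?f x) \<partial>lborel)"
      "(\<integral>\<^sup>+x. ?m x * indicator (box l u) x \<partial>lborel) = (\<integral>\<^sup>+x. ennreal (- ?f x) \<partial>lborel)"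
      by (auto intro!: nn_integral_cong simp: indicator_def)
    have f1: "(\<integral>\<^sup>+x. ennreal (?f x) \<partial>lborel) < \<infinity>" "(\<integral>\<^sup>+x. ennreal (- ?f x) \<partial>lborel) < \<infinity>"
      using i[of l u] by (auto simp: real_integrable_def less_top)
    have "enn2real (\<integral>\<^sup>+x. ennreal (?f x) \<partial>lborel) = enn2real (\<integral>\<^sup>+x. ennreal (- ?f x) \<partial>lborel)"
      using 0[of l u] real_lebesgue_integral_def[OF i[of l u]] by simp
    then show ?thesis unfolding pm using f1
      by (metis ennreal_enn2real less_top infinity_ennreal_def)
  qed
  have "density lborel ?p = density lborel ?m"
  proof (rule measure_eqI_generator_eq)
    let ?E = "range (\<lambda>(a, b). box a b::'a set)"
    show "Int_stable ?E" by (auto simp: Int_stable_def box_Int_box)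
    show "?E \<subseteq> Pow UNIV" "sets (density lborel ?p) = sigma_sets UNIV ?E" "sets (density lborel ?m) = sigma_sets UNIV ?E"
      by (simp_all add: borel_eq_box)
    let ?A = "\<lambda>n::nat. box (- (real n *\<^sub>R One)) (real n *\<^sub>R One) :: 'a set"
    show "range ?A \<subseteq> ?E" "(\<Union>i. ?A i) = UNIV" unfolding UN_box_eq_UNIV by auto
    show "emeasure (density lborel ?p) (?A i) \<noteq> \<infinity>" for i
      using fin by (simp add: emeasure_density less_top[symmetric] less_imp_neq)
    show "emeasure (density lborel ?p) X = emeasure (density lborel ?m) X" if "X \<in> ?E" for X
      using that eq by (auto simp: emeasure_density)
  qed
  then have "AE x in lborel. ?p x = ?m x" by (intro sigma_finite_measure.density_unique[OF sigma_finite_lborel]) auto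
  then show ?thesis
  proof eventually_elim
    case (elim x)
    show ?case
    proof (cases "0 \<le> d x")
      case True
      then have "ennreal (- d x) = 0" by (simp add: ennreal_neg)
      then show ?thesis using elim True by simp
    next
      case False
      then have "ennreal (d x) = 0" by (simp add: ennreal_neg)
      then show ?thesis using elim False by simp
    qed
  qed
qed

lemma weak_pderiv_unique:
  fixes u g g' :: "'a::euclidean_space \<Rightarrow> real"
  assumes g: "is_weak_pderiv UNIV b u g" and [measurable]: "g \<in> borel_measurable borel" and gF: "l2sq g \<le> ennreal F" "0 \<le> F"
    and g': "is_weak_pderiv UNIV b u g'" and [measurable]: "g' \<in> borel_measurable borel" and gF': "l2sq g' \<le> ennreal F'" "0 \<le> F'"
  shows "AE x in lborel. g x = g' x"
proof -
  define d where "d x = g x - g' x" for x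
  have dm [measurable]: "d \<in> borel_measurable borel" unfolding d_def by measurable
  have dF: "l2sq d \<le> ennreal (2 * F + 2 * F')" unfolding d_def by (intro l2sq_diff_le_real gF gF') auto
  have z: "(\<integral>x. d x * \<phi> x \<partial>lborel) = 0" if \<phi>: "\<phi> \<in> test_functions UNIV" and [measurable]: "\<phi> \<in> borel_measurable borel" for \<phi>
  proof -
    obtain b' :: 'a where b': "b' \<in> Basis" using SOME_Basis by blast
    obtain K B where "compact K" "\<And>x. x \<notin> K \<Longrightarrow> \<phi> x = 0" "\<And>x. \<bar>\<phi> x\<bar> \<le> B"
      using test_function_facts(4)[OF \<phi> b'] by blast
    then have "\<exists>P\<ge>0. l2sq \<phi> \<le> ennreal P" by (rule l2sq_bounded_compact_support)
    then obtain P where P: "0 \<le> P" "l2sq \<phi> \<le> ennreal P" by blast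
    have "integrable lborel (\<lambda>x. g x * \<phi> x)" "integrable lborel (\<lambda>x. g' x * \<phi> x)"
      by (rule l2_pairing_bound(1)[OF _ _ gF P(2,1), of 1], auto)
        (rule l2_pairing_bound(1)[OF _ _ gF' P(2,1), of 1], auto)
    moreover have "(\<integral>x. g x * \<phi> x \<partial>lebesgue_on UNIV) = (\<integral>x. g' x * \<phi> x \<partial>lebesgue_on UNIV)"
      using g g' \<phi> by (auto simp: is_weak_pderiv_def)
    then have "(\<integral>x. g x * \<phi> x \<partial>lborel) = (\<integral>x. g' x * \<phi> x \<partial>lborel)"
      by (subst (asm) (1 2) integral_lebesgue_on_UNIV_eq) auto
    ultimately show ?thesis by (simp add: d_def left_diff_distrib)
  qed
  have "AE x in lborel. d x = 0"
    using gF gF' by (intro AE_zero_of_box_integrals[OF dm] box_integral_zero[OF dm dF] z) auto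
  then show ?thesis by eventually_elim (simp add: d_def)
qed

section \<open>Borel representatives\<close>

lemma sigma_finite_lebesgue: "sigma_finite_measure (lebesgue :: 'a::euclidean_space measure)"
proof -
  obtain A :: "'a set set" where A: "countable A" "A \<subseteq> sets lborel" "\<Union>A = space lborel"
    "\<forall>a\<in>A. emeasure lborel a \<noteq> \<infinity>"
    using sigma_finite_lborel unfolding sigma_finite_measure_def by blast
  have "A \<subseteq> sets lebesgue" using A(2) by (auto intro: sets_completionI_sets)
  moreover have "emeasure lebesgue a \<noteq> \<infinity>" if "a \<in> A" for a
    using A(2,4) that by (subst emeasure_completion) auto
  ultimately show ?thesis
    using A(1,3) unfolding sigma_finite_measure_def by (intro exI[of _ A]) auto
qed

lemma id_measurable_pair_lebesgue:
  "(\<lambda>z. z) \<in> (lebesgue \<Otimes>\<^sub>M lebesgue) \<rightarrow>\<^sub>M ((lborel :: 'a::euclidean_space measure) \<Otimes>\<^sub>M (lborel :: 'a measure))"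
proof -
  have id: "(\<lambda>x. x) \<in> lebesgue \<rightarrow>\<^sub>M (lborel :: 'a measure)"
    by (rule measurableI) (auto intro: sets_completionI_sets)
  have f: "fst \<in> (lebesgue \<Otimes>\<^sub>M (lebesgue :: 'a measure)) \<rightarrow>\<^sub>M (lborel :: 'a measure)"
    by (rule measurable_compose[OF measurable_fst id])
  have g: "snd \<in> (lebesgue \<Otimes>\<^sub>M (lebesgue :: 'a measure)) \<rightarrow>\<^sub>M (lborel :: 'a measure)"
    by (rule measurable_compose[OF measurable_snd id])
  from measurable_Pair[OF f g] show ?thesis by simp
qed

text \<open>The product of two completed measures lives on a larger sigma-algebra than the Borel product, but
  cannot be pulled back along shears. Both measures agree on Borel sets, and this is enough because all
  functions are first replaced by Borel representatives.\<close>

lemma distr_pair_lebesgue: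
  "distr (lebesgue \<Otimes>\<^sub>M lebesgue) (lborel \<Otimes>\<^sub>M lborel) (\<lambda>z. z)
    = (lborel :: 'a::euclidean_space measure) \<Otimes>\<^sub>M (lborel :: 'a measure)"
proof (rule measure_eqI)
  interpret L: sigma_finite_measure "lebesgue :: 'a measure" by (rule sigma_finite_lebesgue)
  fix A :: "('a \<times> 'a) set"
  assume "A \<in> sets (distr (lebesgue \<Otimes>\<^sub>M lebesgue) (lborel \<Otimes>\<^sub>M (lborel :: 'a measure)) (\<lambda>z. z))"
  then have A: "A \<in> sets (lborel \<Otimes>\<^sub>M lborel)" by simp
  have A': "A \<in> sets (lebesgue \<Otimes>\<^sub>M lebesgue)"
  proof -
    have "(\<lambda>z. z) -` A \<inter> space (lebesgue \<Otimes>\<^sub>M lebesgue) \<in> sets (lebesgue \<Otimes>\<^sub>M (lebesgue :: 'a measure))"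
      by (rule measurable_sets[OF id_measurable_pair_lebesgue A])
    then show ?thesis by (simp add: space_pair_measure)
  qed
  have "emeasure (distr (lebesgue \<Otimes>\<^sub>M lebesgue) (lborel \<Otimes>\<^sub>M lborel) (\<lambda>z. z)) A = emeasure (lebesgue \<Otimes>\<^sub>M lebesgue) A"
    using id_measurable_pair_lebesgue A by (subst emeasure_distr) (auto simp: space_pair_measure)
  also have "\<dots> = (\<integral>\<^sup>+x. \<integral>\<^sup>+y. indicator A (x, y) \<partial>lebesgue \<partial>lebesgue)"
    by (rule L.emeasure_pair_measure[OF A'])
  also have "\<dots> = (\<integral>\<^sup>+x. \<integral>\<^sup>+y. indicator A (x, y) \<partial>lborel \<partial>lborel)"
    by (simp add: nn_integral_completion)
  also have "\<dots> = emeasure (lborel \<Otimes>\<^sub>M lborel) A"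
    by (rule lborel.emeasure_pair_measure[OF A, symmetric])
  finally show "emeasure (distr (lebesgue \<Otimes>\<^sub>M lebesgue) (lborel \<Otimes>\<^sub>M lborel) (\<lambda>z. z)) A = emeasure (lborel \<Otimes>\<^sub>M lborel) A" .
qed simp

lemma AE_pair_lebesgue:
  fixes v v' :: "'a::euclidean_space \<Rightarrow> real"
  assumes [measurable]: "v \<in> borel_measurable lebesgue" "v' \<in> borel_measurable lebesgue"
    and ae: "AE x in lebesgue. v x = v' x"
  shows "AE z in lebesgue \<Otimes>\<^sub>M lebesgue. v (fst z) = v' (fst z) \<and> v (snd z) = v' (snd z)"
proof -
  interpret L: sigma_finite_measure "lebesgue :: 'a measure" by (rule sigma_finite_lebesgue)
  interpret P: pair_sigma_finite "lebesgue :: 'a measure" "lebesgue :: 'a measure" ..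
  show ?thesis
  proof (rule P.AE_pair_measure)
    show "{z \<in> space (lebesgue \<Otimes>\<^sub>M lebesgue). v (fst z) = v' (fst z) \<and> v (snd z) = v' (snd z)}
      \<in> sets (lebesgue \<Otimes>\<^sub>M lebesgue)" by measurable
    show "AE x in lebesgue. AE y in lebesgue. v (fst (x, y)) = v' (fst (x, y)) \<and> v (snd (x, y)) = v' (snd (x, y))"
      using ae by eventually_elim (use ae in auto)
  qed
qed

lemma gagliardo_eq_gag:
  fixes v v' :: "'a::euclidean_space \<Rightarrow> real"
  assumes v [measurable]: "v \<in> borel_measurable lebesgue" and v' [measurable]: "v' \<in> borel_measurable borel"
    and ae: "AE x in lebesgue. v x = v' x"
  shows "gagliardo s UNIV v = gag s v'"
proof -
  have v'l: "v' \<in> borel_measurable lebesgue" by (rule measurable_completion) simp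
  define F where "F z = ennreal ((v' (fst z) - v' (snd z))\<^sup>2 / norm (fst z - snd z) powr (real DIM('a) + 2 * s))" for z
  have Fm [measurable]: "F \<in> borel_measurable (lborel \<Otimes>\<^sub>M lborel)" unfolding F_def by measurable
  have "gagliardo s UNIV v = (\<integral>\<^sup>+z. F z \<partial>(lebesgue \<Otimes>\<^sub>M lebesgue))"
    unfolding gagliardo_def lebesgue_on_UNIV_eq
  proof (rule nn_integral_cong_AE)
    show "AE z in lebesgue \<Otimes>\<^sub>M lebesgue. (case z of (x, y) \<Rightarrow>
      ennreal ((v x - v y)\<^sup>2 / norm (x - y) powr (real DIM('a) + 2 * s))) = F z"
      using AE_pair_lebesgue[OF v v'l ae] by eventually_elim (simp add: F_def case_prod_unfold)
  qed
  also have "\<dots> = (\<integral>\<^sup>+z. F z \<partial>distr (lebesgue \<Otimes>\<^sub>M lebesgue) (lborel \<Otimes>\<^sub>M lborel) (\<lambda>z. z))"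
    by (subst nn_integral_distr[OF id_measurable_pair_lebesgue]) auto
  also have "\<dots> = (\<integral>\<^sup>+z. F z \<partial>(lborel \<Otimes>\<^sub>M lborel))" by (simp only: distr_pair_lebesgue)
  also have "\<dots> = gag s v'"
    unfolding gag_def F_def by (subst lborel.nn_integral_fst[symmetric]) auto
  finally show ?thesis .
qed

lemma L2_space_iff:
  fixes v v' :: "'a::euclidean_space \<Rightarrow> real"
  assumes v: "v \<in> borel_measurable lebesgue" and v' [measurable]: "v' \<in> borel_measurable borel"
    and ae: "AE x in lebesgue. v x = v' x"
  shows "v \<in> L2_space UNIV \<longleftrightarrow> l2sq v' < \<infinity>"
proof -
  have "integrable lebesgue (\<lambda>x. (v x)\<^sup>2) \<longleftrightarrow> integrable lebesgue (\<lambda>x. (v' x)\<^sup>2)"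
    by (intro integrable_cong_AE) (use v ae in \<open>auto intro: measurable_completion\<close>)
  also have "\<dots> \<longleftrightarrow> integrable lborel (\<lambda>x. (v' x)\<^sup>2)" by (intro integrable_completion) simp
  also have "\<dots> \<longleftrightarrow> l2sq v' < \<infinity>" by (simp add: integrable_iff_bounded l2sq_def)
  finally show ?thesis using v by (simp add: L2_space_def lebesgue_on_UNIV_eq)
qed

lemma L2_space_borel_representative:
  fixes v :: "'a::euclidean_space \<Rightarrow> real"
  assumes "v \<in> L2_space UNIV"
  obtains v' where "v' \<in> borel_measurable borel" "AE x in lebesgue. v x = v' x" "v \<in> borel_measurable lebesgue" "l2sq v' < \<infinity>"
proof -
  have v: "v \<in> borel_measurable lebesgue" using assms by (simp add: L2_space_def lebesgue_on_UNIV_eq)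
  then obtain v' where v': "v' \<in> borel_measurable lborel" "AE x in lborel. v x = v' x"
    using completion_ex_borel_measurable_real by blast
  have ae: "AE x in lebesgue. v x = v' x" using v'(2) by (rule AE_completion)
  have "l2sq v' < \<infinity>" using assms L2_space_iff[OF v _ ae] v' by simp
  then show ?thesis using v v' ae by (intro that) auto
qed

text \<open>Neither the function nor its derivative is seen on null sets.\<close>

lemma is_weak_pderiv_cong:
  fixes v v' g g' :: "'a::euclidean_space \<Rightarrow> real"
  assumes m: "v \<in> borel_measurable lebesgue" "v' \<in> borel_measurable lebesgue"
      "g \<in> borel_measurable lebesgue" "g' \<in> borel_measurable lebesgue"
    and ae: "AE x in lebesgue. v x = v' x" "AE x in lebesgue. g x = g' x" and b: "b \<in> Basis"
  shows "is_weak_pderiv UNIV b v g \<longleftrightarrow> is_weak_pderiv UNIV b v' g'"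
proof -
  have "(\<integral>x. v x * pderivs [b] \<phi> x \<partial>lebesgue) = (\<integral>x. v' x * pderivs [b] \<phi> x \<partial>lebesgue)
      \<and> (\<integral>x. g x * \<phi> x \<partial>lebesgue) = (\<integral>x. g' x * \<phi> x \<partial>lebesgue)" if \<phi>: "\<phi> \<in> test_functions UNIV" for \<phi>
  proof -
    have \<phi>m [measurable]: "\<phi> \<in> borel_measurable lebesgue" "pderivs [b] \<phi> \<in> borel_measurable lebesgue"
      using test_function_facts(2,3)[OF \<phi> b]
      by (auto intro!: measurable_completion borel_measurable_continuous_onI simp del: pderivs.simps)
    note m [measurable]
    show ?thesis
    proof
      show "(\<integral>x. v x * pderivs [b] \<phi> x \<partial>lebesgue) = (\<integral>x. v' x * pderivs [b] \<phi> x \<partial>lebesgue)"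
      proof (rule integral_cong_AE)
        show "AE x in lebesgue. v x * pderivs [b] \<phi> x = v' x * pderivs [b] \<phi> x"
          using ae(1) by eventually_elim simp
      qed measurable
      show "(\<integral>x. g x * \<phi> x \<partial>lebesgue) = (\<integral>x. g' x * \<phi> x \<partial>lebesgue)"
      proof (rule integral_cong_AE)
        show "AE x in lebesgue. g x * \<phi> x = g' x * \<phi> x" using ae(2) by eventually_elim simp
      qed measurable
    qed
  qed
  then show ?thesis unfolding is_weak_pderiv_def lebesgue_on_UNIV_eq by simp
qed

lemma weak_pderiv_eq_AE:
  fixes u u' g :: "'a::euclidean_space \<Rightarrow> real"
  assumes u: "u \<in> borel_measurable lebesgue" and u': "u' \<in> borel_measurable borel" "AE x in lebesgue. u x = u' x"
    and g: "g \<in> borel_measurable borel" "is_weak_pderiv UNIV b u' g" "l2sq g \<le> ennreal F" "0 \<le> F" and b: "b \<in> Basis"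
  shows "g \<in> L2_space UNIV" "is_weak_pderiv UNIV b u g"
    "weak_pderiv UNIV b u \<in> borel_measurable lebesgue" "AE x in lebesgue. weak_pderiv UNIV b u x = g x"
proof -
  have gl: "g \<in> borel_measurable lebesgue" and ul: "u' \<in> borel_measurable lebesgue"
    using g(1) u'(1) by (auto intro: measurable_completion)
  show gL: "g \<in> L2_space UNIV"
    using L2_space_iff[OF gl g(1)] g(3) by (simp add: le_less_trans)
  show gw: "is_weak_pderiv UNIV b u g"
    using is_weak_pderiv_cong[OF u ul gl gl u'(2) _ b] g(2) by simp
  define W where "W = weak_pderiv UNIV b u"
  have "\<exists>g. g \<in> L2_space UNIV \<and> is_weak_pderiv UNIV b u g" using gL gw by blast
  then have W: "W \<in> L2_space UNIV \<and> is_weak_pderiv UNIV b u W"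
    unfolding W_def weak_pderiv_def by (rule someI_ex)
  obtain W' where W': "W' \<in> borel_measurable borel" "AE x in lebesgue. W x = W' x"
    "W \<in> borel_measurable lebesgue" "l2sq W' < \<infinity>"
    using L2_space_borel_representative[of W] W by blast
  obtain F' where F': "l2sq W' = ennreal F'" "0 \<le> F'" using W'(4) by (cases "l2sq W'") auto
  have "is_weak_pderiv UNIV b u' W'"
    using is_weak_pderiv_cong[OF u ul W'(3) measurable_completion u'(2) W'(2) b] W W'(1) by simp
  then have "AE x in lborel. W' x = g x"
    using weak_pderiv_unique[of b u' W' F' g F] W' F' g by simp
  then have "AE x in lebesgue. W' x = g x" by (rule AE_completion)
  with W'(2) show "AE x in lebesgue. weak_pderiv UNIV b u x = g x"
    unfolding W_def[symmetric] by eventually_elim simp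
  show "weak_pderiv UNIV b u \<in> borel_measurable lebesgue" using W'(3) by (simp add: W_def)
qed

section \<open>Weak solutions in terms of Borel functions\<close>

lemma frac_laplace_const_pos: "0 < n \<Longrightarrow> 0 < s \<Longrightarrow> s < 1 \<Longrightarrow> 0 < frac_laplace_const n s"
  unfolding frac_laplace_const_def by (intro divide_pos_pos mult_pos_pos Gamma_real_pos) auto

lemma energy_class_subset_energy_space:
  fixes v :: "'a::euclidean_space \<Rightarrow> real"
  assumes v: "v \<in> energy_class s \<Omega>" and s: "s < 1"
  shows "v \<in> energy_space s \<Omega>"
proof -
  have vm: "v \<in> borel_measurable borel" using v by (simp add: energy_class_def)
  then have vl: "v \<in> borel_measurable lebesgue" by (auto intro: measurable_completion)
  show ?thesis
    using v s L2_space_iff[OF vl vm] gagliardo_eq_gag[OF vl vm]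
    by (auto simp: energy_space_def sobolev_space_def energy_class_def)
qed

text \<open>Outside the set over which the energy form integrates, both points lie in the complement of
  \<open>\<Omega>\<close>, where the test function vanishes; so the integral may be extended to the whole product.\<close>

lemma energy_form_eq_gag_form:
  fixes u u' v :: "'a::euclidean_space \<Rightarrow> real"
  assumes u [measurable]: "u \<in> borel_measurable lebesgue" and u': "u' \<in> energy_class s \<Omega>"
    and ae: "AE x in lebesgue. u x = u' x" and v: "v \<in> energy_class s \<Omega>" and \<Omega>: "open \<Omega>"
  shows "energy_form s \<Omega> u v = frac_laplace_const DIM('a) s / 2 * gag_form s u' v"
proof -
  have [measurable]: "u' \<in> borel_measurable borel" "v \<in> borel_measurable borel"
    using u' v by (auto simp: energy_class_def)
  have l [measurable]: "u' \<in> borel_measurable lebesgue" "v \<in> borel_measurable lebesgue"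
    by (auto intro: measurable_completion)
  have [measurable]: "\<Omega> \<in> sets lebesgue" using \<Omega> by auto
  let ?Q = "\<Omega> \<times> UNIV \<union> UNIV \<times> \<Omega>"
  let ?p = "real DIM('a) + 2 * s"
  have Qm: "?Q \<in> sets (lebesgue \<Otimes>\<^sub>M (lebesgue :: 'a measure))"
    by (intro sets.Un pair_measureI) auto
  have pm: "(\<lambda>z. norm (fst z - snd z) powr ?p) \<in> borel_measurable (lebesgue \<Otimes>\<^sub>M (lebesgue :: 'a measure))"
    by (rule measurable_compose[OF id_measurable_pair_lebesgue]) measurable
  have dm: "(\<lambda>z. dquot s u' z * dquot s v z) \<in> borel_measurable (lborel \<Otimes>\<^sub>M lborel)" by measurable
  have "set_lebesgue_integral (lebesgue \<Otimes>\<^sub>M lebesgue) ?Q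
      (\<lambda>(x, y). (u x - u y) * (v x - v y) / norm (x - y) powr ?p)
    = (\<integral>z. dquot s u' z * dquot s v z \<partial>(lebesgue \<Otimes>\<^sub>M lebesgue))"
    unfolding set_lebesgue_integral_def
  proof (rule integral_cong_AE)
    have "(\<lambda>z. (u (fst z) - u (snd z)) * (v (fst z) - v (snd z)) / norm (fst z - snd z) powr ?p)
        \<in> borel_measurable (lebesgue \<Otimes>\<^sub>M lebesgue)"
      using pm by measurable
    then show "(\<lambda>z. indicat_real ?Q z *\<^sub>R (case z of (x, y) \<Rightarrow>
        (u x - u y) * (v x - v y) / norm (x - y) powr ?p)) \<in> borel_measurable (lebesgue \<Otimes>\<^sub>M lebesgue)"
      using Qm unfolding case_prod_unfold by (intro borel_measurable_scaleR borel_measurable_indicator)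
    show "(\<lambda>z. dquot s u' z * dquot s v z) \<in> borel_measurable (lebesgue \<Otimes>\<^sub>M lebesgue)"
      by (rule measurable_compose[OF id_measurable_pair_lebesgue dm])
    show "AE z in lebesgue \<Otimes>\<^sub>M lebesgue. indicat_real ?Q z *\<^sub>R (case z of (x, y) \<Rightarrow>
        (u x - u y) * (v x - v y) / norm (x - y) powr ?p) = dquot s u' z * dquot s v z"
      using AE_pair_lebesgue[OF u l(1) ae]
    proof eventually_elim
      case (elim z)
      show ?case
      proof (cases "z \<in> ?Q")
        case True
        then show ?thesis using elim by (simp add: dquot_mult case_prod_unfold)
      next
        case False
        then have "v (fst z) = 0" "v (snd z) = 0" using v by (auto simp: energy_class_def mem_Times_iff)
        then show ?thesis using False by (simp add: dquot_mult)
      qed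
    qed
  qed
  also have "\<dots> = (\<integral>z. dquot s u' z * dquot s v z \<partial>distr (lebesgue \<Otimes>\<^sub>M lebesgue) (lborel \<Otimes>\<^sub>M lborel) (\<lambda>z. z))"
    by (rule integral_distr[OF id_measurable_pair_lebesgue dm, symmetric])
  also have "\<dots> = gag_form s u' v" by (simp only: distr_pair_lebesgue gag_form_def)
  finally show ?thesis by (simp only: energy_form_def)
qed

text \<open>If \<open>f * v\<close> is not integrable, its Bochner integral is zero by convention.\<close>

lemma integral_source_le:
  fixes f v :: "'a::euclidean_space \<Rightarrow> real"
  assumes v: "v \<in> energy_class s \<Omega>" and \<Omega>: "open \<Omega>" "bounded \<Omega>" and f: "\<And>x. x \<in> \<Omega> \<Longrightarrow> \<bar>f x\<bar> \<le> F" and F: "0 \<le> F"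
  shows "\<bar>\<integral>x. f x * v x \<partial>lebesgue_on \<Omega>\<bar> \<le> F * (\<integral>x. \<bar>v x\<bar> \<partial>lborel)"
proof -
  have vm [measurable]: "v \<in> borel_measurable borel" using v by (simp add: energy_class_def)
  have [simp]: "\<Omega> \<in> sets lebesgue" using \<Omega> by auto
  have v0: "v x = 0" if "x \<notin> \<Omega>" for x using v that by (simp add: energy_class_def)
  have vi: "integrable lborel v"
    using v by (intro integrable_of_l2_bounded_support[OF vm _ \<Omega>]) (auto simp: energy_class_def)
  have ind: "indicator \<Omega> x *\<^sub>R \<bar>v x\<bar> = \<bar>v x\<bar>" for x using v0[of x] by (cases "x \<in> \<Omega>") auto
  have ia: "integrable lebesgue (\<lambda>x. \<bar>v x\<bar>)"
    using vi by (subst integrable_completion) auto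
  have i1: "integrable (lebesgue_on \<Omega>) (\<lambda>x. \<bar>v x\<bar>)"
    using ia by (subst integrable_restrict_space) (simp_all only: ind, simp)
  have i2: "(\<integral>x. \<bar>v x\<bar> \<partial>lebesgue_on \<Omega>) = (\<integral>x. \<bar>v x\<bar> \<partial>lborel)"
  proof -
    have "(\<integral>x. \<bar>v x\<bar> \<partial>lebesgue_on \<Omega>) = (\<integral>x. indicator \<Omega> x *\<^sub>R \<bar>v x\<bar> \<partial>lebesgue)"
      by (rule integral_restrict_space) simp
    also have "\<dots> = (\<integral>x. \<bar>v x\<bar> \<partial>lborel)" unfolding ind by (rule integral_completion) measurable
    finally show ?thesis .
  qed
  show ?thesis
  proof (cases "integrable (lebesgue_on \<Omega>) (\<lambda>x. f x * v x)")
    case True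
    have "\<bar>\<integral>x. f x * v x \<partial>lebesgue_on \<Omega>\<bar> \<le> (\<integral>x. norm (f x * v x) \<partial>lebesgue_on \<Omega>)"
      using integral_norm_bound[of "lebesgue_on \<Omega>" "\<lambda>x. f x * v x"] by simp
    also have "\<dots> \<le> (\<integral>x. F * \<bar>v x\<bar> \<partial>lebesgue_on \<Omega>)"
    proof (rule integral_mono)
      show "integrable (lebesgue_on \<Omega>) (\<lambda>x. norm (f x * v x))" using True by (rule integrable_norm)
      show "integrable (lebesgue_on \<Omega>) (\<lambda>x. F * \<bar>v x\<bar>)" using i1 by simp
      fix x assume "x \<in> space (lebesgue_on \<Omega>)"
      then have "x \<in> \<Omega>" by simp
      then show "norm (f x * v x) \<le> F * \<bar>v x\<bar>" using f by (simp add: abs_mult mult_right_mono)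
    qed
    also have "\<dots> = F * (\<integral>x. \<bar>v x\<bar> \<partial>lborel)" using i2 by simp
    finally show ?thesis .
  next
    case False
    then show ?thesis using F by (simp add: not_integrable_integral_eq)
  qed
qed

lemma weak_solution_bounded_source:
  fixes f u :: "'a::euclidean_space \<Rightarrow> real"
  assumes u: "weak_solution s \<Omega> f u" and \<Omega>: "open \<Omega>" "bounded \<Omega>" and s: "0 < s" "s < 1"
    and f: "\<And>x. x \<in> \<Omega> \<Longrightarrow> \<bar>f x\<bar> \<le> F" and F: "0 \<le> F"
  obtains u' where "bounded_source s \<Omega> (2 / frac_laplace_const DIM('a) s * F) u'" "AE x in lebesgue. u x = u' x"
proof -
  let ?c = "frac_laplace_const DIM('a) s"
  have c: "0 < ?c" using s by (intro frac_laplace_const_pos) auto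
  have ue: "u \<in> energy_space s \<Omega>" using u by (simp add: weak_solution_def)
  then have uL: "u \<in> L2_space UNIV" and ug: "gagliardo s UNIV u < \<infinity>"
    and u0: "AE x in lebesgue. x \<notin> \<Omega> \<longrightarrow> u x = 0"
    using s by (auto simp: energy_space_def sobolev_space_def)
  obtain w where w [measurable]: "w \<in> borel_measurable borel" and ae: "AE x in lebesgue. u x = w x"
    and ul: "u \<in> borel_measurable lebesgue"
    using L2_space_borel_representative[OF uL] by blast
  have [measurable]: "\<Omega> \<in> sets borel" using \<Omega> by auto
  define u' where "u' x = indicator \<Omega> x * w x" for x
  have u'm [measurable]: "u' \<in> borel_measurable borel" unfolding u'_def by measurable
  have ae': "AE x in lebesgue. u x = u' x"
    using ae u0 by eventually_elim (auto simp: u'_def indicator_def)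
  have "l2sq u' < \<infinity>" using L2_space_iff[OF ul u'm ae'] uL by simp
  moreover have "gag s u' < \<infinity>" using gagliardo_eq_gag[OF ul u'm ae', of s] ug by simp
  moreover have "u' x = 0" if "x \<notin> \<Omega>" for x using that by (simp add: u'_def)
  ultimately have un: "u' \<in> energy_class s \<Omega>" using u'm by (simp add: energy_class_def)
  have "\<bar>gag_form s u' v\<bar> \<le> 2 / ?c * F * (\<integral>x. \<bar>v x\<bar> \<partial>lborel)" if v: "v \<in> energy_class s \<Omega>" for v
  proof -
    have "?c / 2 * gag_form s u' v = (\<integral>x. f x * v x \<partial>lebesgue_on \<Omega>)"
      using u energy_class_subset_energy_space[OF v s(2)] energy_form_eq_gag_form[OF ul un ae' v \<Omega>(1)]
      by (simp add: weak_solution_def)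
    then have "\<bar>?c / 2 * gag_form s u' v\<bar> \<le> F * (\<integral>x. \<bar>v x\<bar> \<partial>lborel)"
      using integral_source_le[OF v \<Omega> f F] by simp
    then have "?c / 2 * \<bar>gag_form s u' v\<bar> \<le> F * (\<integral>x. \<bar>v x\<bar> \<partial>lborel)"
      using c by (simp add: abs_mult)
    then show ?thesis using c by (simp add: field_simps)
  qed
  then have "bounded_source s \<Omega> (2 / ?c * F) u'" using un by (simp add: bounded_source_def)
  then show ?thesis using ae' by (rule that)
qed

text \<open>Every summand of the norm is a supremum of a nonempty bounded set of nonnegative numbers; a second
  point of \<open>\<Omega>\<close> is needed for the set of quotients to be nonempty.\<close>

lemma hoelder_norm_bounds:
  fixes \<Omega> :: "'a::euclidean_space set"
  assumes f: "f \<in> hoelder_space \<beta> \<Omega>" and \<Omega>: "open \<Omega>" "\<Omega> \<noteq> {}"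
  shows "0 \<le> hoelder_norm \<beta> \<Omega> f" "\<And>x. x \<in> \<Omega> \<Longrightarrow> \<bar>f x\<bar> \<le> hoelder_norm \<beta> \<Omega> f"
proof -
  let ?k = "hoelder_order \<beta>"
  have bd: "bdd_above (sup_values j \<Omega> f)" if "j \<le> ?k" for j using f that by (simp add: hoelder_space_def)
  have bq: "bdd_above (hoelder_quotients ?k (hoelder_exponent \<beta>) \<Omega> f)" using f by (simp add: hoelder_space_def)
  obtain b :: 'a where b: "b \<in> Basis" using SOME_Basis by blast
  have mi: "replicate j b \<in> multi_indices j" for j using b by (auto simp: multi_indices_def)
  obtain x0 where x0: "x0 \<in> \<Omega>" using \<Omega> by blast
  obtain e where e: "0 < e" "ball x0 e \<subseteq> \<Omega>" using \<Omega>(1) x0 by (meson openE)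
  define x1 where "x1 = x0 + (e / 2) *\<^sub>R b"
  have x1: "x1 \<in> \<Omega>" "x0 \<noteq> x1"
    using e b by (auto simp: x1_def dist_norm subset_iff nonzero_Basis)
  have s0: "0 \<le> Sup (sup_values j \<Omega> f)" if "j \<le> ?k" for j
  proof -
    have "\<bar>pderivs (replicate j b) f x0\<bar> \<in> sup_values j \<Omega> f"
      unfolding sup_values_def using mi x0 by blast
    then have "\<bar>pderivs (replicate j b) f x0\<bar> \<le> Sup (sup_values j \<Omega> f)" by (rule cSup_upper[OF _ bd[OF that]])
    then show ?thesis using abs_ge_zero order_trans by blast
  qed
  have q0: "0 \<le> Sup (hoelder_quotients ?k (hoelder_exponent \<beta>) \<Omega> f)"
  proof -
    let ?q = "\<bar>pderivs (replicate ?k b) f x0 - pderivs (replicate ?k b) f x1\<bar> / norm (x0 - x1) powr hoelder_exponent \<beta>"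
    have "?q \<in> hoelder_quotients ?k (hoelder_exponent \<beta>) \<Omega> f"
      unfolding hoelder_quotients_def using mi x0 x1 by blast
    then have "?q \<le> Sup (hoelder_quotients ?k (hoelder_exponent \<beta>) \<Omega> f)" by (rule cSup_upper[OF _ bq])
    moreover have "0 \<le> ?q" by simp
    ultimately show ?thesis by linarith
  qed
  show "0 \<le> hoelder_norm \<beta> \<Omega> f"
    unfolding hoelder_norm_def using s0 q0 by (intro add_nonneg_nonneg sum_nonneg) auto
  fix x assume x: "x \<in> \<Omega>"
  have "[] \<in> multi_indices 0" by (simp add: multi_indices_def)
  then have "\<bar>pderivs [] f x\<bar> \<in> sup_values 0 \<Omega> f" unfolding sup_values_def using x by blast
  then have "\<bar>f x\<bar> \<le> Sup (sup_values 0 \<Omega> f)" using bd[of 0] by (simp add: cSup_upper)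
  also have "\<dots> \<le> (\<Sum>j\<le>?k. Sup (sup_values j \<Omega> f))" using s0 by (intro member_le_sum) auto
  also have "\<dots> \<le> hoelder_norm \<beta> \<Omega> f" unfolding hoelder_norm_def using q0 by simp
  finally show "\<bar>f x\<bar> \<le> hoelder_norm \<beta> \<Omega> f" .
qed

section \<open>Sobolev regularity\<close>

lemma sqrt_enn2real_le:
  assumes "G \<le> ennreal (K * M\<^sup>2 / \<epsilon>)" "0 \<le> K" "0 \<le> M" "0 < \<epsilon>"
  shows "sqrt (enn2real G) \<le> sqrt K * M / sqrt \<epsilon>"
proof -
  have "enn2real G \<le> K * M\<^sup>2 / \<epsilon>"
    using assms by (intro enn2real_leI) auto
  then have "sqrt (enn2real G) \<le> sqrt (K * M\<^sup>2 / \<epsilon>)" by (rule real_sqrt_le_mono)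
  also have "\<dots> = sqrt K * M / sqrt \<epsilon>" using assms(3) by (simp add: real_sqrt_mult real_sqrt_divide)
  finally show ?thesis .
qed

text \<open>Below order one the modulus of \<open>u\<close> is integrated, above order one that of its derivatives.
  The order one itself is covered by the \<open>L\<^sup>2\<close> bound for the derivatives. In the first two cases
  the factor \<open>1 / sqrt \<epsilon>\<close> is obtained for free, since \<open>\<epsilon>\<close> is bounded.\<close>

lemma sobolev_regularity:
  fixes \<Omega> :: "'a::euclidean_space set"
  assumes \<Omega>: "lipschitz_domain \<Omega>" "bounded \<Omega>" and s: "1 / 2 < s" "s < 1" and \<delta>: "0 < \<delta>"
  shows "\<exists>K>0. \<forall>M>0. \<forall>u' u. bounded_source s \<Omega> M u' \<longrightarrow> u \<in> borel_measurable lebesgue \<longrightarrow> (AE x in lebesgue. u x = u' x) \<longrightarrow>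
    (\<forall>\<epsilon>. 0 < \<epsilon> \<and> \<epsilon> < s + 1 / 2 \<longrightarrow> u \<in> sobolev_space (s + 1 / 2 - \<epsilon>) UNIV \<and>
      (order_separated \<delta> (s + 1 / 2 - \<epsilon>) \<longrightarrow> sobolev_seminorm (s + 1 / 2 - \<epsilon>) UNIV u \<le> K * M / sqrt \<epsilon>))"
proof -
  have op: "open \<Omega>" using \<Omega>(1) by (simp add: lipschitz_domain_def)
  obtain C r where C: "0 < C" and r: "0 < r" "r \<le> 1" and T: "translate_bound s \<Omega> 1 C r" and S: "second_bound s \<Omega> 1 C r"
    and N: "\<And>M u. 0 < M \<Longrightarrow> bounded_source s \<Omega> M u \<Longrightarrow> l2sq u \<le> ennreal (C * M\<^sup>2)"
    using regularity_estimates[OF \<Omega> s] by blast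
  obtain C' \<rho> where C': "0 < C'" and \<rho>: "0 < \<rho>" "\<rho> \<le> 1"
    and W: "\<And>M u b. 0 < M \<Longrightarrow> bounded_source s \<Omega> M u \<Longrightarrow> b \<in> Basis \<Longrightarrow> \<exists>g\<in>borel_measurable borel.
      is_weak_pderiv UNIV b u g \<and> l2sq g \<le> ennreal (C' * M\<^sup>2) \<and>
      (\<forall>h. norm h < \<rho> \<longrightarrow> l2sq (fdiff h g) \<le> ennreal (C' * M\<^sup>2 * norm h powr (2 * (s - 1 / 2))))"
    using weak_derivative_estimates[OF op \<Omega>(2) s C r(1) S N] by blast
  define C0 where "C0 = radial_const TYPE('a)"
  have C0: "0 < C0" unfolding C0_def by (rule radial_const_pos)
  define n where "n = real DIM('a)"
  have n: "0 < n" by (simp add: n_def)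
  define K1 where "K1 = C0 * C * (1 + 1 / \<delta>) * (1 + 1 / r\<^sup>2) * 2"
  define K2 where "K2 = n * C' * 2"
  define K3 where "K3 = C0 * C' * (3 + 1 / \<rho>\<^sup>2 * (1 + 1 / \<delta>) * 2)"
  have "0 < 1 + 1 / \<delta>" "0 < 1 + 1 / r\<^sup>2" using \<delta> r by (auto intro: add_pos_pos)
  moreover have "0 \<le> 1 / \<rho>\<^sup>2 * (1 + 1 / \<delta>) * 2" using \<delta> by simp
  then have "0 < 3 + 1 / \<rho>\<^sup>2 * (1 + 1 / \<delta>) * 2" by linarith
  ultimately have K: "0 < K1" "0 < K2" "0 < K3"
    using C C' C0 n by (auto simp: K1_def K2_def K3_def intro!: mult_pos_pos)
  define K where "K = sqrt K1 + sqrt K2 + n * sqrt K3"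
  have Kpos: "0 < K" unfolding K_def using K n by (intro add_pos_pos) auto
  have main: "u \<in> sobolev_space (s + 1 / 2 - \<epsilon>) UNIV \<and>
      (order_separated \<delta> (s + 1 / 2 - \<epsilon>) \<longrightarrow> sobolev_seminorm (s + 1 / 2 - \<epsilon>) UNIV u \<le> K * M / sqrt \<epsilon>)"
    if M: "0 < M" and u': "bounded_source s \<Omega> M u'" and u: "u \<in> borel_measurable lebesgue"
      and ae: "AE x in lebesgue. u x = u' x" and \<epsilon>: "0 < \<epsilon>" "\<epsilon> < s + 1 / 2" for M u' u \<epsilon>
  proof -
    have un: "u' \<in> energy_class s \<Omega>" using u' by (simp add: bounded_source_def)
    then have u'm [measurable]: "u' \<in> borel_measurable borel" by (simp add: energy_class_def)
    have uL: "u \<in> L2_space UNIV" using L2_space_iff[OF u u'm ae] un by (simp add: energy_class_def)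
    have \<epsilon>2: "\<epsilon> \<le> 2" using \<epsilon> s by simp
    have one: "1 \<le> 2 / \<epsilon>" using \<epsilon> \<epsilon>2 by simp
    have Kle: "k * M / sqrt \<epsilon> \<le> K * M / sqrt \<epsilon>" if "k \<le> K" for k
      using that M \<epsilon> by (intro divide_right_mono mult_right_mono) auto
    have CM: "0 \<le> C * M\<^sup>2" "0 \<le> C' * M\<^sup>2" using C C' by auto
    define \<sigma> where "\<sigma> = s + 1 / 2 - \<epsilon>"
    have \<sigma>0: "0 < \<sigma>" using \<epsilon> by (simp add: \<sigma>_def)
    have "\<forall>b\<in>Basis. \<exists>g. g \<in> borel_measurable borel \<and> is_weak_pderiv UNIV b u' g \<and> l2sq g \<le> ennreal (C' * M\<^sup>2) \<and>
      (\<forall>h. norm h < \<rho> \<longrightarrow> l2sq (fdiff h g) \<le> ennreal (C' * M\<^sup>2 * norm h powr (2 * (s - 1 / 2))))"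
      using W[OF M u'] by blast
    from bchoice[OF this] obtain g where g: "\<And>b. b \<in> Basis \<Longrightarrow> g b \<in> borel_measurable borel"
      "\<And>b. b \<in> Basis \<Longrightarrow> is_weak_pderiv UNIV b u' (g b)" "\<And>b. b \<in> Basis \<Longrightarrow> l2sq (g b) \<le> ennreal (C' * M\<^sup>2)"
      "\<And>b h. b \<in> Basis \<Longrightarrow> norm h < \<rho> \<Longrightarrow> l2sq (fdiff h (g b)) \<le> ennreal (C' * M\<^sup>2 * norm h powr (2 * (s - 1 / 2)))"
      by blast
    have gw: "g b \<in> L2_space UNIV" "is_weak_pderiv UNIV b u (g b)"
      "weak_pderiv UNIV b u \<in> borel_measurable lebesgue" "AE x in lebesgue. weak_pderiv UNIV b u x = g b x"
      if b: "b \<in> Basis" for b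
      using weak_pderiv_eq_AE[OF u u'm ae g(1)[OF b] g(2)[OF b] g(3)[OF b] CM(2) b] by auto
    have H1: "u \<in> H1_space UNIV" using uL gw(1,2) by (auto simp: H1_space_def)
    consider "\<sigma> < 1" | "\<sigma> = 1" | "1 < \<sigma>" by linarith
    then have "u \<in> sobolev_space \<sigma> UNIV \<and> (order_separated \<delta> \<sigma> \<longrightarrow> sobolev_seminorm \<sigma> UNIV u \<le> K * M / sqrt \<epsilon>)"
    proof cases
      case 1
      have "gag \<sigma> u' \<le> ennreal (C0 * (C * M\<^sup>2 * (1 + 1 / (1 - \<sigma>)) + C * M\<^sup>2 / r\<^sup>2 * (1 + 1 / \<sigma>)))"
        using 1 \<sigma>0 r CM N[OF M u'] T M u'
        unfolding C0_def by (intro gag_le_of_translates) (auto simp: translate_bound_def less_imp_le)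
      then have G: "gagliardo \<sigma> UNIV u \<le> ennreal (C0 * (C * M\<^sup>2 * (1 + 1 / (1 - \<sigma>)) + C * M\<^sup>2 / r\<^sup>2 * (1 + 1 / \<sigma>)))"
        by (simp only: gagliardo_eq_gag[OF u u'm ae])
      also have "\<dots> < \<infinity>" by simp
      finally have "u \<in> sobolev_space \<sigma> UNIV" using uL 1 by (simp add: sobolev_space_def)
      moreover have "sobolev_seminorm \<sigma> UNIV u \<le> K * M / sqrt \<epsilon>" if os: "order_separated \<delta> \<sigma>"
      proof -
        have d: "\<delta> \<le> \<sigma>" "\<delta> \<le> 1 - \<sigma>" using os 1 by (auto simp: order_separated_def)
        have "C0 * (C * M\<^sup>2 * (1 + 1 / (1 - \<sigma>)) + C * M\<^sup>2 / r\<^sup>2 * (1 + 1 / \<sigma>))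
           \<le> C0 * (C * M\<^sup>2 * (1 + 1 / \<delta>) + C * M\<^sup>2 / r\<^sup>2 * (1 + 1 / \<delta>))"
          using d \<delta> C0 CM \<sigma>0 by (intro mult_left_mono add_mono divide_left_mono mult_pos_pos) auto
        also have "\<dots> = C0 * C * (1 + 1 / \<delta>) * (1 + 1 / r\<^sup>2) * M\<^sup>2 * 1"
          using \<delta> r by (simp add: field_simps)
        also have "\<dots> \<le> C0 * C * (1 + 1 / \<delta>) * (1 + 1 / r\<^sup>2) * M\<^sup>2 * (2 / \<epsilon>)"
          using one C0 C \<delta> by (intro mult_left_mono mult_nonneg_nonneg) auto
        also have "\<dots> = K1 * M\<^sup>2 / \<epsilon>" by (simp add: K1_def)
        finally have "gagliardo \<sigma> UNIV u \<le> ennreal (K1 * M\<^sup>2 / \<epsilon>)"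
          by (intro order_trans[OF G] ennreal_leI)
        then have "sqrt (enn2real (gagliardo \<sigma> UNIV u)) \<le> sqrt K1 * M / sqrt \<epsilon>"
          using K M \<epsilon> by (intro sqrt_enn2real_le) auto
        also have "\<dots> \<le> K * M / sqrt \<epsilon>" using K n by (intro Kle) (simp add: K_def)
        finally show ?thesis using 1 by (simp add: sobolev_seminorm_def)
      qed
      ultimately show ?thesis by blast
    next
      case 2
      have gi: "integrable lborel (\<lambda>x. (g b x)\<^sup>2)" "(\<integral>x. (g b x)\<^sup>2 \<partial>lborel) \<le> C' * M\<^sup>2" if b: "b \<in> Basis" for b
      proof -
        note [measurable] = g(1)[OF b]
        show i: "integrable lborel (\<lambda>x. (g b x)\<^sup>2)"
          by (rule integrableI_bounded) (use g(3)[OF b] in \<open>auto simp: l2sq_def intro: le_less_trans\<close>)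
        have "ennreal (\<integral>x. (g b x)\<^sup>2 \<partial>lborel) = l2sq (g b)"
          unfolding l2sq_def using i by (simp add: nn_integral_eq_integral)
        then have "ennreal (\<integral>x. (g b x)\<^sup>2 \<partial>lborel) \<le> ennreal (C' * M\<^sup>2)" using g(3)[OF b] by (simp only:)
        then show "(\<integral>x. (g b x)\<^sup>2 \<partial>lborel) \<le> C' * M\<^sup>2" using CM(2) ennreal_le_iff by blast
      qed
      have gm: "(\<lambda>x. \<Sum>b\<in>Basis. (g b x)\<^sup>2) \<in> borel_measurable borel"
        using g(1) by (intro borel_measurable_sum borel_measurable_power)
      have "(\<integral>x. (\<Sum>b\<in>Basis. (weak_pderiv UNIV b u x)\<^sup>2) \<partial>lebesgue) = (\<integral>x. (\<Sum>b\<in>Basis. (g b x)\<^sup>2) \<partial>lebesgue)"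
      proof (rule integral_cong_AE)
        show "(\<lambda>x. \<Sum>b\<in>Basis. (weak_pderiv UNIV b u x)\<^sup>2) \<in> borel_measurable lebesgue"
          using gw(3) by (intro borel_measurable_sum borel_measurable_power)
        show "(\<lambda>x. \<Sum>b\<in>Basis. (g b x)\<^sup>2) \<in> borel_measurable lebesgue"
          using gm by (auto intro: measurable_completion)
        have "AE x in lebesgue. \<forall>b\<in>Basis. weak_pderiv UNIV b u x = g b x"
          using gw(4) by (intro AE_finite_allI) auto
        then show "AE x in lebesgue. (\<Sum>b\<in>Basis. (weak_pderiv UNIV b u x)\<^sup>2) = (\<Sum>b\<in>Basis. (g b x)\<^sup>2)"
          by eventually_elim simp
      qed
      also have "\<dots> = (\<integral>x. (\<Sum>b\<in>Basis. (g b x)\<^sup>2) \<partial>lborel)" using gm by (intro integral_completion) simp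
      also have "\<dots> = (\<Sum>b\<in>Basis. \<integral>x. (g b x)\<^sup>2 \<partial>lborel)" using gi(1) by (rule Bochner_Integration.integral_sum)
      also have "\<dots> \<le> (\<Sum>b\<in>(Basis :: 'a set). C' * M\<^sup>2)" by (intro sum_mono gi(2))
      also have "\<dots> = n * C' * M\<^sup>2 * 1" by (simp add: n_def)
      also have "\<dots> \<le> n * C' * M\<^sup>2 * (2 / \<epsilon>)"
        using one n C' by (intro mult_left_mono mult_nonneg_nonneg) auto
      also have "\<dots> = K2 * M\<^sup>2 / \<epsilon>" by (simp add: K2_def)
      finally have "sqrt (\<integral>x. (\<Sum>b\<in>Basis. (weak_pderiv UNIV b u x)\<^sup>2) \<partial>lebesgue) \<le> sqrt (K2 * M\<^sup>2 / \<epsilon>)"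
        by (rule real_sqrt_le_mono)
      also have "\<dots> = sqrt K2 * M / sqrt \<epsilon>" using M by (simp add: real_sqrt_mult real_sqrt_divide)
      also have "\<dots> \<le> K * M / sqrt \<epsilon>" using K n by (intro Kle) (simp add: K_def)
      finally show ?thesis using 2 H1 by (simp add: sobolev_space_def sobolev_seminorm_def lebesgue_on_UNIV_eq)
    next
      case 3
      define t where "t = \<sigma> - 1"
      have t: "0 < t" "t < s - 1 / 2" "t \<le> 1" "(s - 1 / 2) - t = \<epsilon>"
        using 3 \<epsilon> s by (auto simp: t_def \<sigma>_def)
      have G: "gagliardo t UNIV (weak_pderiv UNIV b u)
          \<le> ennreal (C0 * (C' * M\<^sup>2 * (1 + 1 / \<epsilon>) + C' * M\<^sup>2 / \<rho>\<^sup>2 * (1 + 1 / t)))" if b: "b \<in> Basis" for b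
      proof -
        have "gag t (g b) \<le> ennreal (C0 * (C' * M\<^sup>2 * (1 + 1 / ((s - 1 / 2) - t)) + C' * M\<^sup>2 / \<rho>\<^sup>2 * (1 + 1 / t)))"
          using t \<rho> CM g(3)[OF b] g(4)[OF b] unfolding C0_def
          by (intro gag_le_of_translates g(1)[OF b]) auto
        then show ?thesis unfolding t(4) by (simp only: gagliardo_eq_gag[OF gw(3)[OF b] g(1)[OF b] gw(4)[OF b]])
      qed
      have "gagliardo t UNIV (weak_pderiv UNIV b u) < \<infinity>" if b: "b \<in> Basis" for b
        by (rule le_less_trans[OF G[OF b]]) simp
      then have "u \<in> sobolev_space \<sigma> UNIV"
        using H1 3 by (simp add: sobolev_space_def t_def[symmetric])
      moreover have "sobolev_seminorm \<sigma> UNIV u \<le> K * M / sqrt \<epsilon>" if os: "order_separated \<delta> \<sigma>"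
      proof -
        have d: "\<delta> \<le> t" using os 3 by (auto simp: order_separated_def t_def)
        have bd: "C0 * (C' * M\<^sup>2 * (1 + 1 / \<epsilon>) + C' * M\<^sup>2 / \<rho>\<^sup>2 * (1 + 1 / t)) \<le> K3 * M\<^sup>2 / \<epsilon>"
        proof -
          have "1 + 1 / \<epsilon> \<le> 3 / \<epsilon>" using one by (simp add: field_simps)
          then have "C' * M\<^sup>2 * (1 + 1 / \<epsilon>) \<le> C' * M\<^sup>2 * (3 / \<epsilon>)" using CM by (intro mult_left_mono)
          moreover have "C' * M\<^sup>2 / \<rho>\<^sup>2 * (1 + 1 / t) \<le> C' * M\<^sup>2 / \<rho>\<^sup>2 * (1 + 1 / \<delta>) * (2 / \<epsilon>)"
          proof -
            have "C' * M\<^sup>2 / \<rho>\<^sup>2 * (1 + 1 / t) \<le> C' * M\<^sup>2 / \<rho>\<^sup>2 * (1 + 1 / \<delta>) * 1"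
              unfolding mult_1_right using d \<delta> t CM
              by (intro mult_left_mono add_left_mono divide_left_mono) auto
            also have "\<dots> \<le> C' * M\<^sup>2 / \<rho>\<^sup>2 * (1 + 1 / \<delta>) * (2 / \<epsilon>)"
              using one CM \<delta> by (intro mult_left_mono mult_nonneg_nonneg) auto
            finally show ?thesis .
          qed
          ultimately have "C0 * (C' * M\<^sup>2 * (1 + 1 / \<epsilon>) + C' * M\<^sup>2 / \<rho>\<^sup>2 * (1 + 1 / t))
              \<le> C0 * (C' * M\<^sup>2 * (3 / \<epsilon>) + C' * M\<^sup>2 / \<rho>\<^sup>2 * (1 + 1 / \<delta>) * (2 / \<epsilon>))"
            using C0 by (intro mult_left_mono[OF add_mono]) auto
          also have "\<dots> = K3 * M\<^sup>2 / \<epsilon>"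
            by (simp add: K3_def algebra_simps add_divide_distrib)
          finally show ?thesis .
        qed
        have "sqrt (enn2real (gagliardo t UNIV (weak_pderiv UNIV b u))) \<le> sqrt K3 * M / sqrt \<epsilon>" if b: "b \<in> Basis" for b
          using K M \<epsilon> by (intro sqrt_enn2real_le order_trans[OF G[OF b] ennreal_leI[OF bd]]) auto
        then have "(\<Sum>b\<in>Basis. sqrt (enn2real (gagliardo t UNIV (weak_pderiv UNIV b u)))) \<le> (\<Sum>b\<in>(Basis :: 'a set). sqrt K3 * M / sqrt \<epsilon>)"
          by (intro sum_mono)
        also have "\<dots> = n * sqrt K3 * M / sqrt \<epsilon>" by (simp add: n_def)
        also have "\<dots> \<le> K * M / sqrt \<epsilon>" using K n by (intro Kle) (simp add: K_def)
        finally show ?thesis using 3 by (simp add: sobolev_seminorm_def t_def[symmetric])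
      qed
      ultimately show ?thesis by blast
    qed
    then show ?thesis unfolding \<sigma>_def .
  qed
  then show ?thesis using Kpos by blast
qed

theorem proposition3p15:
  fixes \<Omega> :: "'a::euclidean_space set" and s \<beta> :: real
  assumes "bounded \<Omega>" and "lipschitz_domain \<Omega>" and "exterior_ball_condition \<Omega>"
    and "1 / 2 < s" and "s < 1" and "0 < \<beta>"
  shows "\<forall>\<delta>>0. \<exists>C. \<forall>f\<in>hoelder_space \<beta> \<Omega>. \<forall>u. weak_solution s \<Omega> f u \<longrightarrow>
           (\<forall>\<epsilon>. 0 < \<epsilon> \<and> \<epsilon> < s + 1 / 2 \<longrightarrow>
              u \<in> sobolev_space (s + 1 / 2 - \<epsilon>) UNIV \<and>
              (order_separated \<delta> (s + 1 / 2 - \<epsilon>) \<longrightarrow>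
                 sobolev_seminorm (s + 1 / 2 - \<epsilon>) UNIV u
                   \<le> C / (sqrt \<epsilon> * (2 * s - 1)) * hoelder_norm \<beta> \<Omega> f))"
proof (intro allI impI)
  fix \<delta> :: real assume \<delta>: "0 < \<delta>"
  note s = \<open>1 / 2 < s\<close> \<open>s < 1\<close>
  have op: "open \<Omega>" and ne: "\<Omega> \<noteq> {}" using \<open>lipschitz_domain \<Omega>\<close> by (auto simp: lipschitz_domain_def)
  let ?c = "frac_laplace_const DIM('a) s"
  have c: "0 < ?c" using s by (intro frac_laplace_const_pos) auto
  obtain K where K: "0 < K" and reg: "\<And>M u' u \<epsilon>. 0 < M \<Longrightarrow> bounded_source s \<Omega> M u' \<Longrightarrow> u \<in> borel_measurable lebesgue \<Longrightarrow>
      (AE x in lebesgue. u x = u' x) \<Longrightarrow> 0 < \<epsilon> \<Longrightarrow> \<epsilon> < s + 1 / 2 \<Longrightarrow> u \<in> sobolev_space (s + 1 / 2 - \<epsilon>) UNIV \<and>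
      (order_separated \<delta> (s + 1 / 2 - \<epsilon>) \<longrightarrow> sobolev_seminorm (s + 1 / 2 - \<epsilon>) UNIV u \<le> K * M / sqrt \<epsilon>)"
    using sobolev_regularity[OF \<open>lipschitz_domain \<Omega>\<close> \<open>bounded \<Omega>\<close> s \<delta>] by blast
  \<comment> \<open>the constant may depend on \<open>s\<close>, so the factor \<open>2 * s - 1\<close> of the claim is compensated here\<close>
  define C where "C = K * (2 / ?c) * (2 * s - 1)"
  show "\<exists>C. \<forall>f\<in>hoelder_space \<beta> \<Omega>. \<forall>u. weak_solution s \<Omega> f u \<longrightarrow>
           (\<forall>\<epsilon>. 0 < \<epsilon> \<and> \<epsilon> < s + 1 / 2 \<longrightarrow>
              u \<in> sobolev_space (s + 1 / 2 - \<epsilon>) UNIV \<and>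
              (order_separated \<delta> (s + 1 / 2 - \<epsilon>) \<longrightarrow>
                 sobolev_seminorm (s + 1 / 2 - \<epsilon>) UNIV u
                   \<le> C / (sqrt \<epsilon> * (2 * s - 1)) * hoelder_norm \<beta> \<Omega> f))"
  proof (intro exI[of _ C] ballI allI impI)
    fix f u and \<epsilon> :: real
    assume f: "f \<in> hoelder_space \<beta> \<Omega>" and u: "weak_solution s \<Omega> f u" and \<epsilon>: "0 < \<epsilon> \<and> \<epsilon> < s + 1 / 2"
    define H where "H = hoelder_norm \<beta> \<Omega> f"
    have H: "0 \<le> H" "\<And>x. x \<in> \<Omega> \<Longrightarrow> \<bar>f x\<bar> \<le> H"
      using hoelder_norm_bounds[OF f op ne] by (auto simp: H_def)
    have um: "u \<in> borel_measurable lebesgue"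
      using u s by (auto simp: weak_solution_def energy_space_def sobolev_space_def L2_space_def lebesgue_on_UNIV_eq)
    \<comment> \<open>the estimates assume a positive bound of the source, hence the small \<open>\<eta>\<close>, removed at the end\<close>
    have est: "u \<in> sobolev_space (s + 1 / 2 - \<epsilon>) UNIV \<and>
      (order_separated \<delta> (s + 1 / 2 - \<epsilon>) \<longrightarrow> sobolev_seminorm (s + 1 / 2 - \<epsilon>) UNIV u
        \<le> K * (2 / ?c * (H + \<eta>)) / sqrt \<epsilon>)" if \<eta>: "0 < \<eta>" for \<eta>
    proof -
      have F: "\<bar>f x\<bar> \<le> H + \<eta>" if "x \<in> \<Omega>" for x using H(2)[OF that] \<eta> by linarith
      obtain u' where "bounded_source s \<Omega> (2 / ?c * (H + \<eta>)) u'" "AE x in lebesgue. u x = u' x"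
        using weak_solution_bounded_source[OF u op \<open>bounded \<Omega>\<close> _ s(2) F] s H(1) \<eta> by auto
      then show ?thesis using c H(1) \<eta> um \<epsilon> by (intro reg) auto
    qed
    show "u \<in> sobolev_space (s + 1 / 2 - \<epsilon>) UNIV \<and>
              (order_separated \<delta> (s + 1 / 2 - \<epsilon>) \<longrightarrow>
                 sobolev_seminorm (s + 1 / 2 - \<epsilon>) UNIV u
                   \<le> C / (sqrt \<epsilon> * (2 * s - 1)) * hoelder_norm \<beta> \<Omega> f)"
    proof (intro conjI impI)
      show "u \<in> sobolev_space (s + 1 / 2 - \<epsilon>) UNIV" using est[of 1] by simp
      assume os: "order_separated \<delta> (s + 1 / 2 - \<epsilon>)"
      define k where "k = K * (2 / ?c) / sqrt \<epsilon>"
      have k: "0 < k" using K c \<epsilon> by (simp add: k_def)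
      have "sobolev_seminorm (s + 1 / 2 - \<epsilon>) UNIV u \<le> k * H + e" if e: "0 < e" for e
      proof -
        have "sobolev_seminorm (s + 1 / 2 - \<epsilon>) UNIV u \<le> K * (2 / ?c * (H + e / k)) / sqrt \<epsilon>"
          using est[of "e / k"] os e k by simp
        also have "\<dots> = k * (H + e / k)" by (simp add: k_def)
        also have "\<dots> = k * H + e" using k by (simp add: distrib_left)
        finally show ?thesis .
      qed
      then have "sobolev_seminorm (s + 1 / 2 - \<epsilon>) UNIV u \<le> k * H" by (rule field_le_epsilon)
      also have "k = C / (sqrt \<epsilon> * (2 * s - 1))" using s by (simp add: k_def C_def)
      finally show "sobolev_seminorm (s + 1 / 2 - \<epsilon>) UNIV u
         \<le> C / (sqrt \<epsilon> * (2 * s - 1)) * hoelder_norm \<beta> \<Omega> f" by (simp add: H_def)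
    qed
  qed
qed

end
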